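(* Let $F:\mathbb{R}^n\rightrightarrows\mathbb{R}^n$ be a multifunction such that: (i) $F(x)$ is nonempty, convex and compact for each $x\in\mathbb{R}^n$; (ii) $F$ is locally Lipschitz with respect to the Hausdorff metric; (iii) there exists $\rho>0$ with $\max\{|v|: v\in F(x)\}\le \rho(1+|x|)$ for all $x\in\mathbb{R}^n$. Let $H(x,p)=\sup_{v\in F(x)}\langle v,p\rangle$ and assume that for every nonempty, convex, compact $K\subset\mathbb{R}^n$: (iv) there exists $c\ge 0$ such that, for every $p\in\mathbb{R}^n$, the map $x\mapsto H(x,p)$ is semiconvex on $K$ with constant $c|p|$; (v) the gradient $\nabla_pH(x,p)$ exists for all $x\in K$, $p\neq 0$, and is locally Lipschitz in $x$ on $K$, uniformly over $p$ in any compact subset of $\mathbb{R}^n\smallsetminus\{0\}$. Let $\phi:\mathbb{R}^n\to\mathbb{R}$ be locally Lipschitz. Let $\overline{x}:[t_0,T]\to\mathbb{R}^n$ be an optimal solution of the Mayer problem $\mathcal{P}(t_0,x_0)$ and let $\overline{p}:[t_0,T]\to\mathbb{R}^n$ be any absolutely continuous solution of $$-\dot{\overline p}(t)\in\partial_x^-H(\overline{x}(t),\overline p(t)),\qquad \dot{\overline{x}}(t)\in\partial_pH(\overline{x}(t),\overline p(t))\qquad\text{for a.e. } t\in[t_0,T],$$ satisfying the transversality condition $-\overline{p}(T)\in\partial^{+}\phi(\overline{x}(T))$. Then $\overline p(\cdot)$ satisfies the full sensitivity relation $$\bigl(H(\overline{x}(t),\overline{p}(t)),-\overline{p}(t)\bigr)\in\partial^+V(t,\overline{x}(t))\qquad\text{for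 all } t\in(t_0,T).$$
   Context: $T>0$ is fixed, $|\cdot|$ is the Euclidean norm, $\langle\cdot,\cdot\rangle$ the inner product. Mayer problem. For $(t_0,x_0)\in[0,T]\times\mathbb{R}^n$, a trajectory is an absolutely continuous $x:[t_0,T]\to\mathbb{R}^n$ with $\dot x(s)\in F(x(s))$ for a.e. $s\in[t_0,T]$ and $x(t_0)=x_0$. The problem $\mathcal{P}(t_0,x_0)$ is to minimize $\phi(x(T))$ over all such trajectories; an optimal solution is a trajectory attaining the infimum. The value function $V:[0,T]\times\mathbb{R}^n\to\mathbb{R}$ is $V(t_0,x_0)=\inf\phi(x(T))$, the infimum being over all trajectories with $x(t_0)=x_0$. Semiconvexity. $u$ is semiconvex on $K$ with constant $C$ if it is continuous there and $u(x+h)+u(x-h)-2u(x)\ge -C|h|^2$ for all $x,h$ with the segment $[x-h,x+h]\subset K$. Generalized differentials. For $f$ real-valued, the Fréchet subdifferential $\partial^-f(x)$ is the set of $p$ with $\liminf_{y\to x}\frac{f(y)-f(x)-\langle p,y-x\rangle}{|y-x|}\ge 0$, and the Fréchet superdifferential $\partial^+f(x)$ is the set of $p$ with $\limsup_{y\to x}\frac{f(y)-f(x)-\langle p,y-x\rangle}{|y-x|}\le 0$. $\partial_x^-H(x,p)$ is the Fréchet subdifferential of $H(\cdot,p)$ at $x$; $\partial_pH(x,p)$ is Clarke's generalized gradient of $H(x,\cdot)$ at $p$; $\partial^+V(t,x)\subset\mathbb{R}\times\mathbb{R}^n$ is the Fréchet superdifferential of $V$ jointly in $(t,x)$. *)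

theory Defs
  imports "HOL-Analysis.Analysis"
begin

text \<open>Absolute continuity of a curve on the interval \<open>{a..b}\<close> (not the absolute continuity of
  measures from the library); only the restriction of the function to \<open>{a..b}\<close> matters.\<close>

definition abs_cont_on :: "real \<Rightarrow> real \<Rightarrow> (real \<Rightarrow> 'a::real_normed_vector) \<Rightarrow> bool" where
  "abs_cont_on a b f \<longleftrightarrow>
     (\<forall>\<epsilon>>0. \<exists>\<delta>>0. \<forall>(m::nat) l u.
        (\<forall>i<m. a \<le> l i \<and> l i \<le> u i \<and> u i \<le> b) \<longrightarrow>
        disjoint_family_on (\<lambda>i. {l i<..<u i}) {..<m} \<longrightarrow>
        (\<Sum>i<m. u i - l i) < \<delta> \<longrightarrow>
        (\<Sum>i<m. norm (f (u i) - f (l i))) < \<epsilon>)"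

text \<open>The real-valued suprema are the genuine ones when both sets are nonempty and bounded.\<close>

definition hausdorff_dist :: "'a::metric_space set \<Rightarrow> 'a set \<Rightarrow> real" where
  "hausdorff_dist A B = max (SUP a\<in>A. infdist a B) (SUP b\<in>B. infdist b A)"

definition locally_lipschitz_multi :: "('a::metric_space \<Rightarrow> 'b::metric_space set) \<Rightarrow> bool" where
  "locally_lipschitz_multi F \<longleftrightarrow>
     (\<forall>x. \<exists>r>0. \<exists>L\<ge>0. \<forall>y\<in>ball x r. \<forall>z\<in>ball x r. hausdorff_dist (F y) (F z) \<le> L * dist y z)"

definition locally_lipschitz :: "('a::metric_space \<Rightarrow> 'b::metric_space) \<Rightarrow> bool" where
  "locally_lipschitz f \<longleftrightarrow> (\<forall>x. \<exists>r>0. \<exists>L. L-lipschitz_on (ball x r) f)"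

text \<open>For nonempty bounded \<open>F x\<close> the supremum is the usual (finite) one.\<close>

definition hamiltonian :: "('a::real_inner \<Rightarrow> 'a set) \<Rightarrow> 'a \<Rightarrow> 'a \<Rightarrow> real" where
  "hamiltonian F x p = (SUP v\<in>F x. v \<bullet> p)"

definition semiconvex_on :: "'a::real_normed_vector set \<Rightarrow> real \<Rightarrow> ('a \<Rightarrow> real) \<Rightarrow> bool" where
  "semiconvex_on K C u \<longleftrightarrow> continuous_on K u \<and>
     (\<forall>x h. closed_segment (x - h) (x + h) \<subseteq> K \<longrightarrow>
        u (x + h) + u (x - h) - 2 * u x \<ge> - C * (norm h)\<^sup>2)"

definition frechet_subdiff :: "('a::real_inner \<Rightarrow> real) \<Rightarrow> 'a \<Rightarrow> 'a set" where
  "frechet_subdiff f x =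
     {p. Liminf (at x) (\<lambda>y. ereal ((f y - f x - p \<bullet> (y - x)) / norm (y - x))) \<ge> 0}"

definition frechet_superdiff :: "('a::real_inner \<Rightarrow> real) \<Rightarrow> 'a \<Rightarrow> 'a set" where
  "frechet_superdiff f x =
     {p. Limsup (at x) (\<lambda>y. ereal ((f y - f x - p \<bullet> (y - x)) / norm (y - x))) \<le> 0}"

text \<open>Clarke's generalized directional derivative: the upper limit is taken as the base point
  tends to \<open>x\<close> (being allowed to equal \<open>x\<close>) and the step size decreases to \<open>0\<close>.\<close>

definition clarke_dirderiv :: "('a::real_normed_vector \<Rightarrow> real) \<Rightarrow> 'a \<Rightarrow> 'a \<Rightarrow> ereal" where
  "clarke_dirderiv f x v =
     Limsup (nhds x \<times>\<^sub>F at_right 0) (\<lambda>(y, s). ereal ((f (y + s *\<^sub>R v) - f y) / s))"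

definition clarke_gradient :: "('a::real_inner \<Rightarrow> real) \<Rightarrow> 'a \<Rightarrow> 'a set" where
  "clarke_gradient f x = {\<xi>. \<forall>v. ereal (\<xi> \<bullet> v) \<le> clarke_dirderiv f x v}"

text \<open>Curves are total functions on the reals, of which only the values on \<open>{t0..T}\<close> are used.
  The derivative within \<open>{t0..T}\<close> is the ordinary one except at the two endpoints, which form a
  null set.\<close>

definition trajectory ::
  "('a::euclidean_space \<Rightarrow> 'a set) \<Rightarrow> real \<Rightarrow> real \<Rightarrow> 'a \<Rightarrow> (real \<Rightarrow> 'a) \<Rightarrow> bool" where
  "trajectory F T t0 x0 x \<longleftrightarrow>
     abs_cont_on t0 T x \<and> x t0 = x0 \<and>
     (AE s in lebesgue_on {t0..T}.
        \<exists>v\<in>F (x s). (x has_vector_derivative v) (at s within {t0..T}))"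

text \<open>The value function, meaningful for \<open>t0 \<le> T\<close>. The real infimum is the genuine one when the
  set of costs is nonempty and bounded below, as is the case for \<open>F\<close> locally Lipschitz with
  nonempty convex compact values and linear growth, and \<open>\<phi>\<close> continuous.\<close>

definition mayer_value ::
  "('a::euclidean_space \<Rightarrow> 'a set) \<Rightarrow> ('a \<Rightarrow> real) \<Rightarrow> real \<Rightarrow> real \<times> 'a \<Rightarrow> real" where
  "mayer_value F \<phi> T = (\<lambda>(t0, x0). Inf {\<phi> (x T) | x. trajectory F T t0 x0 x})"

definition mayer_optimal ::
  "('a::euclidean_space \<Rightarrow> 'a set) \<Rightarrow> ('a \<Rightarrow> real) \<Rightarrow> real \<Rightarrow> real \<Rightarrow> 'a \<Rightarrow> (real \<Rightarrow> 'a) \<Rightarrow> bool" where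
  "mayer_optimal F \<phi> T t0 x0 x \<longleftrightarrow>
     trajectory F T t0 x0 x \<and> \<phi> (x T) = mayer_value F \<phi> T (t0, x0)"

end

(* Given a point (tau, y) near (t, xbar t), construct a trajectory z from (tau, y) that stays within
   O(|(tau, y) - (t, xbar t)|) of xbar and satisfies <z', pbar> = H(z, pbar). Semiconvexity of
   H(., p) and the adjoint inclusion make the derivative of <pbar, z - xbar> at least -c |z - xbar|^2, so
   transversality at T, transported back to tau, bounds V(tau, y) <= phi(z(T)) from above to first
   order. The costate either vanishes identically or never. If it never vanishes, z solves the
   ordinary differential equation z' = grad_p H(z, pbar). If it vanishes identically, the condition
   on z' is void, and any trajectory close to xbar will do. Both are limits of one Filippov iteration
   in which all velocities are continuous. Integration of almost everywhere information uses a
   monotonicity criterion for absolutely continuous functions. *)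

theory Submission
  imports Defs
begin

section \<open>Absolutely continuous functions\<close>

text \<open>The pair to be verified also carries a time increment, while \<open>xbar\<close> is
  differentiable only almost everywhere, perhaps not at the time \<open>t\<close> in question. The
  perturbed trajectory therefore starts at time \<open>tau\<close> and is compared with
  \<open>xbar tau\<close>. The remaining increment \<open>xbar tau - xbar t\<close> is paired with
  \<open>pbar t\<close>; its first order part is the Hamiltonian times \<open>tau - t\<close>, since
  the velocities maximise the pairing and the maximum is Lipschitz in time. All errors are then
  quadratic, except the one from transversality. Optimality enters as the lower bound
  \<open>\<phi> (xbar T)\<close> for the value at \<open>(t, xbar t)\<close>. The dichotomy for the
  costate is forced by hypothesis (v), which speaks of \<open>p \<noteq> 0\<close> only. For a zero
  costate the reference velocity is merely measurable; averages over short windows supply continuous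
  starting data, at the price of an error of the order of the perturbation. The windows reach into
  the past, so starting times must keep a distance from \<open>t0\<close>. States and costates turn
  out to be Lipschitz, by the growth of \<open>F\<close> and by the linear dependence of the adjoint
  inclusion on the costate, and products are formed at that level.\<close>

lemma AE_lebesgue_on_Icc_iff:
  fixes a b :: real
  shows "(AE s in lebesgue_on {a..b}. P s) \<longleftrightarrow> (\<exists>N. negligible N \<and> (\<forall>s\<in>{a..b} - N. P s))"
proof
  assume "AE s in lebesgue_on {a..b}. P s"
  then have "AE s in lebesgue. s \<in> {a..b} \<longrightarrow> P s"
    by (simp add: AE_restrict_space_iff)
  then obtain N where "N \<in> null_sets lebesgue" "{s \<in> space lebesgue. \<not> (s \<in> {a..b} \<longrightarrow> P s)} \<subseteq> N"
    by (auto simp: eventually_ae_filter)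
  then show "\<exists>N. negligible N \<and> (\<forall>s\<in>{a..b} - N. P s)"
    by (intro exI[of _ N]) (auto simp: negligible_iff_null_sets)
next
  assume "\<exists>N. negligible N \<and> (\<forall>s\<in>{a..b} - N. P s)"
  then obtain N where N: "N \<in> null_sets lebesgue" "\<forall>s\<in>{a..b} - N. P s"
    by (auto simp: negligible_iff_null_sets)
  have "AE s in lebesgue. s \<in> {a..b} \<longrightarrow> P s"
    by (rule AE_I'[OF N(1)]) (use N(2) in auto)
  then show "AE s in lebesgue_on {a..b}. P s"
    by (simp add: AE_restrict_space_iff)
qed

text \<open>Outer regularity; removing the null set \<open>N\<close> from \<open>U\<close> does not
  change the measure. The open set gives room for the gauge balls around exceptional tags.\<close>

lemma negligible_open_cover:
  fixes N :: "'a::euclidean_space set"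
  assumes "negligible N" "e > 0"
  obtains U where "open U" "N \<subseteq> U" "U \<in> lmeasurable" "measure lebesgue U < e"
proof -
  obtain U where U: "open U" "N \<subseteq> U" "U - N \<in> lmeasurable" "emeasure lebesgue (U - N) < ennreal e"
    using sets_lebesgue_outer_open[of N e] assms negligible_imp_sets by blast
  have nl: "N \<in> null_sets lebesgue" using assms by (simp add: negligible_iff_null_sets)
  have "U \<in> lmeasurable"
    by (metis U(3) borel_open[OF U(1)] measurable_Diff_null_set[OF nl] sets_completionI_sets sets_lborel)
  moreover have "measure lebesgue (U - N) = measure lebesgue U"
    using nl calculation by (simp add: fmeasurableD measure_Diff_null_set)
  moreover have "measure lebesgue (U - N) < e"
    using U(3,4) assms by (simp add: emeasure_eq_measure2 ennreal_less_iff)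
  ultimately show ?thesis using that U by auto
qed

lemma abs_cont_on_subset:
  assumes "abs_cont_on a b f" "a \<le> c" "d \<le> b"
  shows "abs_cont_on c d f"
  unfolding abs_cont_on_def
proof (intro allI impI)
  fix \<epsilon> :: real assume "\<epsilon> > 0"
  with assms(1) obtain \<delta> where "\<delta> > 0" and \<delta>: "\<forall>(m::nat) l u.
        (\<forall>i<m. a \<le> l i \<and> l i \<le> u i \<and> u i \<le> b) \<longrightarrow>
        disjoint_family_on (\<lambda>i. {l i<..<u i}) {..<m} \<longrightarrow>
        (\<Sum>i<m. u i - l i) < \<delta> \<longrightarrow>
        (\<Sum>i<m. norm (f (u i) - f (l i))) < \<epsilon>"
    unfolding abs_cont_on_def by meson
  show "\<exists>\<delta>>0. \<forall>(m::nat) l u.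
        (\<forall>i<m. c \<le> l i \<and> l i \<le> u i \<and> u i \<le> d) \<longrightarrow>
        disjoint_family_on (\<lambda>i. {l i<..<u i}) {..<m} \<longrightarrow>
        (\<Sum>i<m. u i - l i) < \<delta> \<longrightarrow>
        (\<Sum>i<m. norm (f (u i) - f (l i))) < \<epsilon>"
  proof (intro exI[of _ \<delta>] conjI \<open>\<delta> > 0\<close> allI impI)
    fix m :: nat and l u
    assume lu: "\<forall>i<m. c \<le> l i \<and> l i \<le> u i \<and> u i \<le> d"
    then have "\<forall>i<m. a \<le> l i \<and> l i \<le> u i \<and> u i \<le> b" using assms(2,3) by force
    moreover assume "disjoint_family_on (\<lambda>i. {l i<..<u i}) {..<m}" "(\<Sum>i<m. u i - l i) < \<delta>"
    ultimately show "(\<Sum>i<m. norm (f (u i) - f (l i))) < \<epsilon>" using \<delta> by blast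
  qed
qed

lemma abs_cont_on_imp_continuous_on:
  assumes "abs_cont_on a b f"
  shows "continuous_on {a..b} f"
  unfolding continuous_on_iff
proof (intro ballI allI impI)
  fix x \<epsilon> :: real assume x: "x \<in> {a..b}" and "\<epsilon> > 0"
  with assms obtain \<delta> where "\<delta> > 0" and \<delta>: "\<forall>(m::nat) l u.
        (\<forall>i<m. a \<le> l i \<and> l i \<le> u i \<and> u i \<le> b) \<longrightarrow>
        disjoint_family_on (\<lambda>i. {l i<..<u i}) {..<m} \<longrightarrow>
        (\<Sum>i<m. u i - l i) < \<delta> \<longrightarrow>
        (\<Sum>i<m. norm (f (u i) - f (l i))) < \<epsilon>"
    unfolding abs_cont_on_def by meson
  have \<delta>1: "norm (f v - f u) < \<epsilon>" if "a \<le> u" "u \<le> v" "v \<le> b" "v - u < \<delta>" for u v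
  proof -
    have "disjoint_family_on (\<lambda>i. {u<..<v}) {..<1::nat}" by (auto simp: disjoint_family_on_def)
    then show ?thesis
      using \<delta>[rule_format, of 1 "\<lambda>_. u" "\<lambda>_. v"] that by simp
  qed
  have "dist (f y) (f x) < \<epsilon>" if y: "y \<in> {a..b}" "dist y x < \<delta>" for y
  proof (cases "x \<le> y")
    case True
    then show ?thesis using \<delta>1[of x y] x y by (simp add: dist_norm)
  next
    case False
    then show ?thesis using \<delta>1[of y x] x y by (simp add: dist_norm norm_minus_commute)
  qed
  then show "\<exists>d>0. \<forall>x'\<in>{a..b}. dist x' x < d \<longrightarrow> dist (f x') (f x) < \<epsilon>"
    using \<open>\<delta> > 0\<close> by blast
qed

lemma lipschitz_on_imp_abs_cont_on:
  assumes "C-lipschitz_on {a..b} f"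
  shows "abs_cont_on a b f"
  unfolding abs_cont_on_def
proof (intro allI impI)
  fix \<epsilon> :: real assume "\<epsilon> > 0"
  have C: "C \<ge> 0" using assms lipschitz_on_nonneg by blast
  show "\<exists>\<delta>>0. \<forall>(m::nat) l u.
        (\<forall>i<m. a \<le> l i \<and> l i \<le> u i \<and> u i \<le> b) \<longrightarrow>
        disjoint_family_on (\<lambda>i. {l i<..<u i}) {..<m} \<longrightarrow>
        (\<Sum>i<m. u i - l i) < \<delta> \<longrightarrow>
        (\<Sum>i<m. norm (f (u i) - f (l i))) < \<epsilon>"
  proof (intro exI[of _ "\<epsilon> / (C + 1)"] conjI allI impI)
    show "\<epsilon> / (C + 1) > 0" using \<open>\<epsilon> > 0\<close> C by simp
    fix m :: nat and l u
    assume lu: "\<forall>i<m. a \<le> l i \<and> l i \<le> u i \<and> u i \<le> b" and s: "(\<Sum>i<m. u i - l i) < \<epsilon> / (C + 1)"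
    have s0: "(\<Sum>i<m. u i - l i) \<ge> 0" using lu by (intro sum_nonneg) auto
    have "norm (f (u i) - f (l i)) \<le> C * (u i - l i)" if "i < m" for i
      using lipschitz_onD[OF assms, of "u i" "l i"] lu that by (force simp: dist_norm)
    then have "(\<Sum>i<m. norm (f (u i) - f (l i))) \<le> (\<Sum>i<m. C * (u i - l i))"
      by (intro sum_mono) auto
    also have "\<dots> = C * (\<Sum>i<m. u i - l i)" by (simp add: sum_distrib_left)
    also have "\<dots> \<le> (C + 1) * (\<Sum>i<m. u i - l i)" using s0 by (simp add: algebra_simps)
    also have "\<dots> < \<epsilon>" using s C by (simp add: field_simps)
    finally show "(\<Sum>i<m. norm (f (u i) - f (l i))) < \<epsilon>" .
  qed
qed

text \<open>Pairing with \<open>e\<close> and subtracting a slope \<open>k\<close> reduces growth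
  estimates for vector-valued curves to the claim that a real function does not increase.\<close>

lemma abs_cont_on_inner_affine:
  fixes f :: "real \<Rightarrow> 'a::real_inner"
  assumes "abs_cont_on a b f"
  shows "abs_cont_on a b (\<lambda>s. f s \<bullet> e - k * s)"
  unfolding abs_cont_on_def
proof (intro allI impI)
  fix \<epsilon> :: real assume "\<epsilon> > 0"
  then have e2: "\<epsilon> / (2 * (norm e + 1)) > 0" "\<epsilon> / (2 * (\<bar>k\<bar> + 1)) > 0"
    by (auto intro!: divide_pos_pos mult_pos_pos add_nonneg_pos)
  with assms obtain \<delta> where "\<delta> > 0" and \<delta>: "\<forall>(m::nat) l u.
        (\<forall>i<m. a \<le> l i \<and> l i \<le> u i \<and> u i \<le> b) \<longrightarrow>
        disjoint_family_on (\<lambda>i. {l i<..<u i}) {..<m} \<longrightarrow>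
        (\<Sum>i<m. u i - l i) < \<delta> \<longrightarrow>
        (\<Sum>i<m. norm (f (u i) - f (l i))) < \<epsilon> / (2 * (norm e + 1))"
    unfolding abs_cont_on_def by meson
  show "\<exists>\<delta>>0. \<forall>(m::nat) l u.
        (\<forall>i<m. a \<le> l i \<and> l i \<le> u i \<and> u i \<le> b) \<longrightarrow>
        disjoint_family_on (\<lambda>i. {l i<..<u i}) {..<m} \<longrightarrow>
        (\<Sum>i<m. u i - l i) < \<delta> \<longrightarrow>
        (\<Sum>i<m. norm ((f (u i) \<bullet> e - k * u i) - (f (l i) \<bullet> e - k * l i))) < \<epsilon>"
  proof (intro exI[of _ "min \<delta> (\<epsilon> / (2 * (\<bar>k\<bar> + 1)))"] conjI allI impI)
    show "min \<delta> (\<epsilon> / (2 * (\<bar>k\<bar> + 1))) > 0" using \<open>\<delta> > 0\<close> e2 by simp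
    fix m :: nat and l u
    assume lu: "\<forall>i<m. a \<le> l i \<and> l i \<le> u i \<and> u i \<le> b"
      and dj: "disjoint_family_on (\<lambda>i. {l i<..<u i}) {..<m}"
      and s: "(\<Sum>i<m. u i - l i) < min \<delta> (\<epsilon> / (2 * (\<bar>k\<bar> + 1)))"
    let ?S = "\<Sum>i<m. norm (f (u i) - f (l i))" and ?R = "\<Sum>i<m. u i - l i"
    have S: "?S < \<epsilon> / (2 * (norm e + 1))" using \<delta> lu dj s by auto
    have S0: "?S \<ge> 0" by (intro sum_nonneg) auto
    have R0: "?R \<ge> 0" using lu by (intro sum_nonneg) auto
    have "norm ((f (u i) \<bullet> e - k * u i) - (f (l i) \<bullet> e - k * l i))
        \<le> norm e * norm (f (u i) - f (l i)) + \<bar>k\<bar> * (u i - l i)" if "i < m" for i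
    proof -
      have "(f (u i) \<bullet> e - k * u i) - (f (l i) \<bullet> e - k * l i) = (f (u i) - f (l i)) \<bullet> e - k * (u i - l i)"
        by (simp add: algebra_simps)
      then have "norm ((f (u i) \<bullet> e - k * u i) - (f (l i) \<bullet> e - k * l i))
         \<le> \<bar>(f (u i) - f (l i)) \<bullet> e\<bar> + \<bar>k * (u i - l i)\<bar>" by (simp only: real_norm_def abs_triangle_ineq4)
      also have "\<dots> \<le> norm e * norm (f (u i) - f (l i)) + \<bar>k\<bar> * (u i - l i)"
        using Cauchy_Schwarz_ineq2[of "f (u i) - f (l i)" e] lu that by (auto simp: abs_mult mult.commute)
      finally show ?thesis .
    qed
    then have "(\<Sum>i<m. norm ((f (u i) \<bullet> e - k * u i) - (f (l i) \<bullet> e - k * l i)))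
       \<le> (\<Sum>i<m. norm e * norm (f (u i) - f (l i)) + \<bar>k\<bar> * (u i - l i))" by (intro sum_mono) auto
    also have "\<dots> = norm e * ?S + \<bar>k\<bar> * ?R" by (simp add: sum.distrib sum_distrib_left)
    also have "\<dots> \<le> (norm e + 1) * ?S + (\<bar>k\<bar> + 1) * ?R"
      using S0 R0 by (simp add: algebra_simps)
    also have "\<dots> < \<epsilon> / 2 + \<epsilon> / 2"
    proof (rule add_strict_mono)
      have "0 < norm e + 1" by (simp add: add_nonneg_pos)
      then show "(norm e + 1) * ?S < \<epsilon> / 2" using S by (simp add: field_simps)
      have "0 < \<bar>k\<bar> + 1" by simp
      then show "(\<bar>k\<bar> + 1) * ?R < \<epsilon> / 2" using s by (simp add: field_simps)
    qed
    finally show "(\<Sum>i<m. norm ((f (u i) \<bullet> e - k * u i) - (f (l i) \<bullet> e - k * l i))) < \<epsilon>" by simp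
  qed
qed

text \<open>The definition numbers its intervals by an initial segment of the naturals; tagged
  divisions are indexed by pairs of a tag and an interval, hence the transfer to an arbitrary finite
  index set.\<close>

lemma abs_cont_on_finite_family:
  fixes l u :: "'i \<Rightarrow> real" and f :: "real \<Rightarrow> 'a::real_normed_vector"
  assumes f: "\<forall>(m::nat) l u.
        (\<forall>i<m. a \<le> l i \<and> l i \<le> u i \<and> u i \<le> b) \<longrightarrow>
        disjoint_family_on (\<lambda>i. {l i<..<u i}) {..<m} \<longrightarrow>
        (\<Sum>i<m. u i - l i) < \<delta> \<longrightarrow>
        (\<Sum>i<m. norm (f (u i) - f (l i))) < \<epsilon>"
    and "finite I"
    and lu: "\<And>i. i \<in> I \<Longrightarrow> a \<le> l i \<and> l i \<le> u i \<and> u i \<le> b"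
    and dj: "disjoint_family_on (\<lambda>i. {l i<..<u i}) I"
    and "(\<Sum>i\<in>I. u i - l i) < \<delta>"
  shows "(\<Sum>i\<in>I. norm (f (u i) - f (l i))) < \<epsilon>"
proof -
  obtain h where h: "bij_betw h {..<card I} I"
    using ex_bij_betw_nat_finite[OF \<open>finite I\<close>] by (auto simp: atLeast0LessThan)
  have s: "(\<Sum>i<card I. g (h i)) = (\<Sum>i\<in>I. g i)" for g :: "'i \<Rightarrow> real"
    by (rule sum.reindex_bij_betw[OF h])
  have hI: "h i \<in> I" if "i < card I" for i using h that by (auto simp: bij_betw_def)
  have "disjoint_family_on (\<lambda>i. {l (h i)<..<u (h i)}) {..<card I}"
    unfolding disjoint_family_on_def
  proof (intro ballI impI)
    fix i j assume "i \<in> {..<card I}" "j \<in> {..<card I}" "i \<noteq> j"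
    then have "h i \<in> I" "h j \<in> I" "h i \<noteq> h j" using hI h by (auto simp: bij_betw_def inj_on_def)
    then show "{l (h i)<..<u (h i)} \<inter> {l (h j)<..<u (h j)} = {}"
      using dj unfolding disjoint_family_on_def by blast
  qed
  moreover have "\<forall>i<card I. a \<le> l (h i) \<and> l (h i) \<le> u (h i) \<and> u (h i) \<le> b" using lu hI by blast
  moreover have "(\<Sum>i<card I. u (h i) - l (h i)) < \<delta>" using assms(5) by (simp only: s[of "\<lambda>i. u i - l i"])
  ultimately have "(\<Sum>i<card I. norm (f (u (h i)) - f (l (h i)))) < \<epsilon>"
    using f[THEN spec, of "card I", THEN spec, of "\<lambda>i. l (h i)", THEN spec, of "\<lambda>i. u (h i)"]
    by blast
  then show ?thesis by (simp only: s[of "\<lambda>i. norm (f (u i) - f (l i))"])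
qed

text \<open>A Cousin argument: on a sufficiently fine tagged division, the intervals with a tag outside
  \<open>N\<close> contribute at most a small slope, those with a tag in \<open>N\<close> have small total length.\<close>

lemma abs_cont_on_deriv_nonpos_imp_le:
  fixes f :: "real \<Rightarrow> real"
  assumes ac: "abs_cont_on a b f" and "a \<le> b" and N: "negligible N"
    and der: "\<And>s. s \<in> {a..b} - N \<Longrightarrow> \<exists>d\<le>0. (f has_vector_derivative d) (at s within {a..b})"
  shows "f b \<le> f a"
proof (rule field_le_epsilon)
  fix e :: real assume "e > 0"
  \<comment> \<open>Intervals with exceptional tags will contribute \<open>\<epsilon>\<close>, the
    others \<open>\<epsilon> * (b - a)\<close>; together this is \<open>e\<close>.\<close>
  define \<epsilon> where "\<epsilon> = e / (b - a + 1)"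
  have "\<epsilon> > 0" using \<open>e > 0\<close> \<open>a \<le> b\<close> by (simp add: \<epsilon>_def)
  obtain \<delta> where "\<delta> > 0" and \<delta>: "\<forall>(m::nat) l u.
        (\<forall>i<m. a \<le> l i \<and> l i \<le> u i \<and> u i \<le> b) \<longrightarrow>
        disjoint_family_on (\<lambda>i. {l i<..<u i}) {..<m} \<longrightarrow>
        (\<Sum>i<m. u i - l i) < \<delta> \<longrightarrow>
        (\<Sum>i<m. norm (f (u i) - f (l i))) < \<epsilon>"
    using ac \<open>\<epsilon> > 0\<close> unfolding abs_cont_on_def by meson
  obtain U where U: "open U" "N \<subseteq> U" "U \<in> lmeasurable" "measure lebesgue U < \<delta>"
    using negligible_open_cover[OF N \<open>\<delta> > 0\<close>] .
  \<comment> \<open>Radius of the gauge at \<open>s\<close>: at an exceptional point the ball stays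
    inside the small open set, at a regular point every interval that contains \<open>s\<close> and
    has its endpoints in the ball has slope at most \<open>\<epsilon>\<close>.\<close>
  have "\<exists>r>0. (s \<in> N \<longrightarrow> ball s r \<subseteq> U) \<and>
     (s \<in> {a..b} - N \<longrightarrow> (\<forall>u\<in>{a..b}. \<forall>v\<in>{a..b}. u \<in> ball s r \<longrightarrow> v \<in> ball s r \<longrightarrow> u \<le> s \<longrightarrow> s \<le> v \<longrightarrow>
        f v - f u \<le> \<epsilon> * (v - u)))" for s
  proof -
    consider "s \<in> N" | "s \<in> {a..b} - N" | "s \<notin> N" "s \<notin> {a..b}" by blast
    then show ?thesis
    proof cases
      case 1
      then show ?thesis using U openE by blast
    next
      case 2
      then obtain d where "d \<le> 0" and d: "(f has_vector_derivative d) (at s within {a..b})"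
        using der by blast
      then obtain r where "r > 0" and r: "\<And>y. y \<in> {a..b} \<Longrightarrow> norm (y - s) < r \<Longrightarrow>
            norm (f y - f s - (y - s) * d) \<le> \<epsilon> * norm (y - s)"
        using \<open>\<epsilon> > 0\<close> unfolding has_vector_derivative_def has_derivative_within_alt
        by (metis real_scaleR_def)
      \<comment> \<open>Both increments are measured from the tag, where the linear terms have the
        favourable sign because of \<open>d \<le> 0\<close>; the two errors add up to
        \<open>\<epsilon>\<close> times the length.\<close>
      have "f v - f u \<le> \<epsilon> * (v - u)" if "u \<in> {a..b}" "v \<in> {a..b}" "u \<in> ball s r" "v \<in> ball s r" "u \<le> s" "s \<le> v" for u v
      proof -
        have "\<bar>f v - f s - (v - s) * d\<bar> \<le> \<epsilon> * (v - s)"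
          using r[of v] that by (simp add: dist_norm norm_minus_commute)
        moreover have "\<bar>f u - f s - (u - s) * d\<bar> \<le> \<epsilon> * (s - u)"
          using r[of u] that by (simp add: dist_norm norm_minus_commute)
        moreover have "(v - s) * d \<le> 0" "(u - s) * d \<ge> 0"
          using that \<open>d \<le> 0\<close> by (auto intro: mult_nonneg_nonpos mult_nonpos_nonpos)
        moreover have "\<epsilon> * (v - u) = \<epsilon> * (v - s) + \<epsilon> * (s - u)" by (simp add: algebra_simps)
        ultimately show ?thesis by linarith
      qed
      then show ?thesis using 2 \<open>r > 0\<close> by blast
    next
      case 3
      then show ?thesis using zero_less_one by blast
    qed
  qed
  then obtain r where r0: "\<And>s. r s > 0" and rN: "\<And>s. s \<in> N \<Longrightarrow> ball s (r s) \<subseteq> U"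
    and rg: "\<And>s u v. s \<in> {a..b} - N \<Longrightarrow> u \<in> {a..b} \<Longrightarrow> v \<in> {a..b} \<Longrightarrow> u \<in> ball s (r s) \<Longrightarrow> v \<in> ball s (r s)
        \<Longrightarrow> u \<le> s \<Longrightarrow> s \<le> v \<Longrightarrow> f v - f u \<le> \<epsilon> * (v - u)"
    by metis
  have "gauge (\<lambda>s. ball s (r s))" using r0 by (auto simp: gauge_def)
  then obtain p where p: "p tagged_division_of {a..b}" and fine: "(\<lambda>s. ball s (r s)) fine p"
    using fine_division_exists_real by blast
  have fin: "finite p" using p by (rule tagged_division_of_finite)
  have pK: "\<exists>u v. K = {u..v} \<and> u \<le> x \<and> x \<le> v \<and> a \<le> u \<and> v \<le> b \<and> {u..v} \<subseteq> ball x (r x)" if "(x, K) \<in> p" for x K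
  proof -
    have "\<exists>u v. K = cbox u v" by (rule tagged_division_ofD(4)[OF p that])
    then obtain u v where "K = {u..v}" by auto
    moreover have "x \<in> K" "K \<subseteq> {a..b}" using tagged_division_ofD(2,3)[OF p that] by auto
    moreover have "K \<subseteq> ball x (r x)" using fine that by (auto simp: fine_def)
    ultimately show ?thesis by auto
  qed
  define B where "B = {xK \<in> p. fst xK \<in> N}"
  define l where "l = (\<lambda>xK::real \<times> real set. Inf (snd xK))"
  define u where "u = (\<lambda>xK::real \<times> real set. Sup (snd xK))"
  have K: "a \<le> l z \<and> l z \<le> fst z \<and> fst z \<le> u z \<and> u z \<le> b \<and> snd z = {l z..u z} \<and> {l z..u z} \<subseteq> ball (fst z) (r (fst z))"
    if "z \<in> p" for z
    using pK[of "fst z" "snd z"] that by (auto simp: l_def u_def)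
  have dj: "disjoint_family_on (\<lambda>z. {l z<..<u z}) p"
    unfolding disjoint_family_on_def
  proof (intro ballI impI)
    fix z w assume zw: "z \<in> p" "w \<in> p" "z \<noteq> w"
    then have "interior (snd z) \<inter> interior (snd w) = {}"
      using tagged_division_ofD(5)[OF p, of "fst z" "snd z" "fst w" "snd w"] by (auto simp: prod_eq_iff)
    then show "{l z<..<u z} \<inter> {l w<..<u w} = {}"
      using K[OF zw(1)] K[OF zw(2)] by (metis interior_atLeastAtMost_real)
  qed
  have Bp: "B \<subseteq> p" "finite B" using fin by (auto simp: B_def)
  have djB: "disjoint_family_on (\<lambda>z. {l z<..<u z}) B"
    using dj Bp disjoint_family_on_mono by blast
  \<comment> \<open>The nonoverlapping intervals with exceptional tags lie in \<open>U\<close>, so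
    their total length is at most the measure of \<open>U\<close>, which is below the threshold
    \<open>\<delta>\<close> of absolute continuity.\<close>
  have "(\<Sum>z\<in>B. u z - l z) = (\<Sum>z\<in>B. measure lebesgue {l z<..<u z})"
  proof (rule sum.cong[OF refl])
    fix z assume "z \<in> B"
    then have "l z \<le> u z" using K[of z] Bp by force
    then show "u z - l z = measure lebesgue {l z<..<u z}" by simp
  qed
  also have "\<dots> = measure lebesgue (\<Union>z\<in>B. {l z<..<u z})"
  proof (rule measure_finite_Union[symmetric, OF \<open>finite B\<close> _ djB])
    fix z assume "z \<in> B"
    show "emeasure lebesgue {l z<..<u z} \<noteq> \<infinity>"
      using lmeasurable_box[of "l z" "u z"] unfolding fmeasurable_def by auto
  qed auto
  also have "\<dots> \<le> measure lebesgue U"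
  proof (rule measure_mono_fmeasurable)
    show "(\<Union>z\<in>B. {l z<..<u z}) \<subseteq> U"
    proof (rule UN_least)
      fix z assume z: "z \<in> B"
      then have "{l z..u z} \<subseteq> U" using K[of z] rN[of "fst z"] by (auto simp: B_def)
      then show "{l z<..<u z} \<subseteq> U" by (meson greaterThanLessThan_subseteq_atLeastAtMost_iff order_refl subset_trans)
    qed
  qed (use U Bp in auto)
  finally have lenB: "(\<Sum>z\<in>B. u z - l z) < \<delta>" using U(4) by simp
  have "(\<Sum>z\<in>B. norm (f (u z) - f (l z))) < \<epsilon>"
    by (rule abs_cont_on_finite_family[OF \<delta> \<open>finite B\<close> _ djB lenB]) (use K Bp in force)
  moreover have "(\<Sum>z\<in>B. f (u z) - f (l z)) \<le> (\<Sum>z\<in>B. norm (f (u z) - f (l z)))"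
    by (intro sum_mono) auto
  ultimately have sB: "(\<Sum>z\<in>B. f (u z) - f (l z)) \<le> \<epsilon>" by linarith
  have len: "(\<Sum>z\<in>p. u z - l z) = b - a"
    using additive_tagged_division_1[OF \<open>a \<le> b\<close> p, of "\<lambda>x. x"] by (simp add: u_def l_def split_beta)
  have fba: "(\<Sum>z\<in>p. f (u z) - f (l z)) = f b - f a"
    using additive_tagged_division_1[OF \<open>a \<le> b\<close> p, of f] by (simp add: u_def l_def split_beta)
  have "(\<Sum>z\<in>p - B. f (u z) - f (l z)) \<le> (\<Sum>z\<in>p - B. \<epsilon> * (u z - l z))"
  proof (intro sum_mono)
    fix z assume z: "z \<in> p - B"
    then show "f (u z) - f (l z) \<le> \<epsilon> * (u z - l z)"
      using K[of z] by (intro rg[of "fst z"]) (auto simp: B_def subset_iff)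
  qed
  also have "\<dots> \<le> (\<Sum>z\<in>p. \<epsilon> * (u z - l z))"
  proof (rule sum_mono2[OF fin])
    fix z assume "z \<in> p - (p - B)"
    then show "0 \<le> \<epsilon> * (u z - l z)"
      using K[of z] \<open>\<epsilon> > 0\<close> by (intro mult_nonneg_nonneg) auto
  qed auto
  also have "\<dots> = \<epsilon> * (b - a)" by (simp add: len flip: sum_distrib_left)
  finally have "f b - f a \<le> \<epsilon> + \<epsilon> * (b - a)"
    using sB fba sum.subset_diff[OF Bp(1) fin, of "\<lambda>z. f (u z) - f (l z)"] by linarith
  also have "\<dots> = \<epsilon> * (b - a + 1)" by (simp add: algebra_simps)
  also have "\<dots> = e" using \<open>a \<le> b\<close> by (simp add: \<epsilon>_def)
  finally show "f b \<le> f a + e" by simp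
qed

section \<open>Differential inequalities and Filippov iteration\<close>

text \<open>The increment \<open>e = f v - f u\<close> is its own test vector: the scalar criterion
  for \<open>f s \<bullet> e - M * norm e * s\<close> gives
  \<open>e \<bullet> e \<le> M * norm e * (v - u)\<close>, and one factor \<open>norm e\<close>
  cancels.\<close>

lemma abs_cont_on_deriv_bound_imp_lipschitz_on:
  fixes f :: "real \<Rightarrow> 'a::real_inner"
  assumes ac: "abs_cont_on a b f" and "0 \<le> M" and N: "negligible N"
    and der: "\<And>s. s \<in> {a..b} - N \<Longrightarrow> \<exists>v. norm v \<le> M \<and> (f has_vector_derivative v) (at s within {a..b})"
  shows "M-lipschitz_on {a..b} f"
proof -
  have *: "norm (f v - f u) \<le> M * (v - u)" if uv: "a \<le> u" "u \<le> v" "v \<le> b" for u v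
  proof -
    define e where "e = f v - f u"
    have "f v \<bullet> e - M * norm e * v \<le> f u \<bullet> e - M * norm e * u"
    proof (rule abs_cont_on_deriv_nonpos_imp_le[OF _ uv(2) N])
      show "abs_cont_on u v (\<lambda>s. f s \<bullet> e - M * norm e * s)"
        by (rule abs_cont_on_inner_affine[OF abs_cont_on_subset[OF ac uv(1,3)]])
      fix s assume s: "s \<in> {u..v} - N"
      then obtain w where w: "norm w \<le> M" "(f has_vector_derivative w) (at s within {a..b})"
        using der[of s] uv by auto
      have "(f has_vector_derivative w) (at s within {u..v})"
        using has_vector_derivative_within_subset[OF w(2)] uv by auto
      then have "((\<lambda>s. f s \<bullet> e - M * norm e * s) has_vector_derivative (w \<bullet> e - M * norm e)) (at s within {u..v})"
        unfolding has_vector_derivative_def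
        by (auto intro!: derivative_eq_intros simp: algebra_simps)
      moreover have "w \<bullet> e \<le> M * norm e"
        using norm_cauchy_schwarz[of w e] w(1) mult_right_mono[of "norm w" M "norm e"] by simp
      ultimately show "\<exists>d\<le>0. ((\<lambda>s. f s \<bullet> e - M * norm e * s) has_vector_derivative d) (at s within {u..v})"
        by (intro exI[of _ "w \<bullet> e - M * norm e"]) auto
    qed
    then have "e \<bullet> e \<le> M * norm e * (v - u)" by (simp add: e_def algebra_simps)
    then have "norm e * norm e \<le> norm e * (M * (v - u))"
      by (simp add: dot_square_norm power2_eq_square algebra_simps)
    then show ?thesis using uv \<open>0 \<le> M\<close> unfolding e_def[symmetric]
      by (cases "e = 0") auto
  qed
  show ?thesis
  proof (rule lipschitz_onI[OF _ \<open>0 \<le> M\<close>])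
    fix x y assume "x \<in> {a..b}" "y \<in> {a..b}"
    then show "dist (f x) (f y) \<le> M * dist x y"
      using *[of x y] *[of y x] by (cases "x \<le> y") (auto simp: dist_norm norm_minus_commute)
  qed
qed

section \<open>Calculus of Lipschitz curves and Gronwall's inequality\<close>

lemma continuous_on_Icc_norm_bound:
  fixes f :: "real \<Rightarrow> 'a::real_normed_vector"
  assumes "continuous_on {a..b} f"
  obtains B where "B > 0" "\<And>s. s \<in> {a..b} \<Longrightarrow> norm (f s) \<le> B"
  using compact_imp_bounded[OF compact_continuous_image[OF assms compact_Icc]]
  by (auto simp: bounded_pos)

lemma C1_imp_lipschitz_on_Icc:
  fixes f :: "real \<Rightarrow> 'a::real_normed_vector"
  assumes v: "continuous_on {a..b} v"
    and der: "\<And>s. s \<in> {a..b} \<Longrightarrow> (f has_vector_derivative v s) (at s within {a..b})"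
  shows "\<exists>C. C-lipschitz_on {a..b} f"
proof -
  obtain B where B: "B > 0" "\<And>s. s \<in> {a..b} \<Longrightarrow> norm (v s) \<le> B"
    using continuous_on_Icc_norm_bound[OF v] by blast
  have "B-lipschitz_on {a..b} f"
  proof (rule bounded_derivative_imp_lipschitz)
    show "(f has_derivative (\<lambda>h. h *\<^sub>R v s)) (at s within {a..b})" if "s \<in> {a..b}" for s
      using der[OF that] by (simp add: has_vector_derivative_def)
    show "onorm (\<lambda>h. h *\<^sub>R v s) \<le> B" if "s \<in> {a..b}" for s
      using B(2)[OF that] by (simp add: onorm_scaleR_left[OF bounded_linear_ident] onorm_id)
  qed (use B in auto)
  then show ?thesis by blast
qed

text \<open>Differential inequalities below concern pairings of two Lipschitz curves. The constant
  stays existential because only the absolute continuity of the product is used, never its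
  modulus.\<close>

lemma lipschitz_on_Icc_inner:
  fixes f g :: "real \<Rightarrow> 'a::real_inner"
  assumes "\<exists>C. C-lipschitz_on {a..b} f" "\<exists>C. C-lipschitz_on {a..b} g"
  shows "\<exists>C. C-lipschitz_on {a..b} (\<lambda>s. f s \<bullet> g s)"
proof -
  obtain C D where C: "C-lipschitz_on {a..b} f" and D: "D-lipschitz_on {a..b} g" using assms by blast
  have CD: "C \<ge> 0" "D \<ge> 0" using C D lipschitz_on_nonneg by blast+
  obtain A B where A: "A > 0" "\<And>s. s \<in> {a..b} \<Longrightarrow> norm (f s) \<le> A"
    and B: "B > 0" "\<And>s. s \<in> {a..b} \<Longrightarrow> norm (g s) \<le> B"
    using continuous_on_Icc_norm_bound[OF lipschitz_on_continuous_on[OF C]]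
      continuous_on_Icc_norm_bound[OF lipschitz_on_continuous_on[OF D]] by metis
  have "(A * D + B * C)-lipschitz_on {a..b} (\<lambda>s. f s \<bullet> g s)"
  proof (rule lipschitz_onI)
    fix x y assume xy: "x \<in> {a..b}" "y \<in> {a..b}"
    have "f x \<bullet> g x - f y \<bullet> g y = f x \<bullet> (g x - g y) + (f x - f y) \<bullet> g y" by (simp add: algebra_simps)
    then have "\<bar>f x \<bullet> g x - f y \<bullet> g y\<bar> \<le> \<bar>f x \<bullet> (g x - g y)\<bar> + \<bar>(f x - f y) \<bullet> g y\<bar>" by simp
    also have "\<dots> \<le> norm (f x) * norm (g x - g y) + norm (f x - f y) * norm (g y)"
      by (intro add_mono Cauchy_Schwarz_ineq2)
    also have "\<dots> \<le> A * (D * dist x y) + (C * dist x y) * B"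
      using A B CD lipschitz_onD[OF C xy] lipschitz_onD[OF D xy] xy
      by (intro add_mono mult_mono) (auto simp: dist_norm)
    finally show "dist (f x \<bullet> g x) (f y \<bullet> g y) \<le> (A * D + B * C) * dist x y"
      by (simp add: dist_real_def algebra_simps)
  qed (use A B CD in auto)
  then show ?thesis by blast
qed

lemma lipschitz_on_Icc_diff:
  fixes f g :: "real \<Rightarrow> 'a::real_normed_vector"
  assumes "\<exists>C. C-lipschitz_on {a..b} f" "\<exists>C. C-lipschitz_on {a..b} g"
  shows "\<exists>C. C-lipschitz_on {a..b} (\<lambda>s. f s - g s)"
  using assms lipschitz_on_diff by blast

lemma lipschitz_deriv_bound_imp_le:
  fixes f :: "real \<Rightarrow> real"
  assumes "\<exists>C. C-lipschitz_on {a..b} f" and "a \<le> b" and N: "negligible N"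
    and der: "\<And>s. s \<in> {a..b} - N \<Longrightarrow> \<exists>d\<le>k. (f has_vector_derivative d) (at s within {a..b})"
  shows "f b \<le> f a + k * (b - a)"
proof -
  \<comment> \<open>The factor \<open>\<bullet> 1\<close> is multiplication by one; it lets the
    inner product version of the affine correction serve a real function.\<close>
  have "f b \<bullet> 1 - k * b \<le> f a \<bullet> 1 - k * a"
  proof (rule abs_cont_on_deriv_nonpos_imp_le[OF _ \<open>a \<le> b\<close> N])
    show "abs_cont_on a b (\<lambda>s. f s \<bullet> 1 - k * s)"
      using assms(1) abs_cont_on_inner_affine lipschitz_on_imp_abs_cont_on by blast
    fix s assume "s \<in> {a..b} - N"
    then obtain d where "d \<le> k" "(f has_vector_derivative d) (at s within {a..b})" using der by blast
    then show "\<exists>d\<le>0. ((\<lambda>s. f s \<bullet> 1 - k * s) has_vector_derivative d) (at s within {a..b})"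
      by (intro exI[of _ "d - k"]) (auto simp: has_vector_derivative_def intro!: derivative_eq_intros simp: algebra_simps)
  qed
  then show ?thesis by (simp add: algebra_simps)
qed

text \<open>Integrating factor: \<open>f s * exp (- k * s)\<close> has a nonpositive derivative
  almost everywhere. The rate \<open>k\<close> may be negative, which later gives a backward
  estimate for the costate.\<close>

lemma lipschitz_gronwall:
  fixes f :: "real \<Rightarrow> real"
  assumes lip: "\<exists>C. C-lipschitz_on {a..b} f" and N: "negligible N" and uv: "a \<le> u" "u \<le> v" "v \<le> b"
    and der: "\<And>s. s \<in> {a..b} - N \<Longrightarrow> \<exists>d. d \<le> k * f s \<and> (f has_vector_derivative d) (at s within {a..b})"
  shows "f v \<le> f u * exp (k * (v - u))"
proof -
  have "\<exists>C. C-lipschitz_on {u..v} (\<lambda>s. exp (- k * s))"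
    by (rule C1_imp_lipschitz_on_Icc[where v = "\<lambda>s. - k * exp (- k * s)"])
      (auto intro!: continuous_intros derivative_eq_intros simp: has_vector_derivative_def)
  moreover have "\<exists>C. C-lipschitz_on {u..v} f"
    using lip lipschitz_on_subset[of _ "{a..b}" f "{u..v}"] uv by auto
  ultimately have l: "\<exists>C. C-lipschitz_on {u..v} (\<lambda>s. f s * exp (- k * s))"
    using lipschitz_on_Icc_inner[of u v f "\<lambda>s. exp (- k * s)"] by simp
  have "f v * exp (- k * v) \<le> f u * exp (- k * u) + 0 * (v - u)"
  proof (rule lipschitz_deriv_bound_imp_le[OF l uv(2) N])
    fix s assume s: "s \<in> {u..v} - N"
    then obtain d where d: "d \<le> k * f s" "(f has_vector_derivative d) (at s within {a..b})" using der[of s] uv by auto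
    then have "(f has_vector_derivative d) (at s within {u..v})"
      using has_vector_derivative_within_subset[OF d(2)] uv by auto
    then have "((\<lambda>s. f s * exp (- k * s)) has_vector_derivative ((d - k * f s) * exp (- k * s))) (at s within {u..v})"
      unfolding has_vector_derivative_def
      by (auto intro!: derivative_eq_intros simp: algebra_simps)
    moreover have "(d - k * f s) * exp (- k * s) \<le> 0" using d by (intro mult_nonpos_nonneg) auto
    ultimately show "\<exists>d\<le>0. ((\<lambda>s. f s * exp (- k * s)) has_vector_derivative d) (at s within {u..v})"
      by blast
  qed
  then have "f v * exp (- k * v) * exp (k * v) \<le> f u * exp (- k * u) * exp (k * v)"
    by (intro mult_right_mono) auto
  then show ?thesis by (simp add: mult.assoc right_diff_distrib flip: exp_add)
qed

text \<open>The difference from the primitive of \<open>g\<close> has derivative zero almost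
  everywhere, so it is 0-Lipschitz, that is, constant. An almost everywhere equation with continuous
  right-hand side thus becomes a classical one.\<close>

lemma lipschitz_ae_deriv_imp_C1:
  fixes f :: "real \<Rightarrow> 'a::euclidean_space"
  assumes lip: "\<exists>C. C-lipschitz_on {a..b} f" and N: "negligible N" and g: "continuous_on {a..b} g"
    and der: "\<And>s. s \<in> {a..b} - N \<Longrightarrow> (f has_vector_derivative g s) (at s within {a..b})"
    and "s \<in> {a..b}"
  shows "(f has_vector_derivative g s) (at s within {a..b})"
proof -
  define G where "G = (\<lambda>s. integral {a..s} g)"
  have G: "(G has_vector_derivative g s) (at s within {a..b})" if "s \<in> {a..b}" for s
    unfolding G_def by (rule integral_has_vector_derivative[OF g that])
  have "\<exists>C. C-lipschitz_on {a..b} (\<lambda>s. f s - G s)"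
    by (intro lipschitz_on_Icc_diff lip C1_imp_lipschitz_on_Icc[OF g G])
  then have "abs_cont_on a b (\<lambda>s. f s - G s)" using lipschitz_on_imp_abs_cont_on by blast
  then have "0-lipschitz_on {a..b} (\<lambda>s. f s - G s)"
  proof (rule abs_cont_on_deriv_bound_imp_lipschitz_on[OF _ _ N])
    fix s assume s: "s \<in> {a..b} - N"
    then show "\<exists>v. norm v \<le> 0 \<and> ((\<lambda>s. f s - G s) has_vector_derivative v) (at s within {a..b})"
      using has_vector_derivative_diff[OF der[of s] G[of s]] by auto
  qed auto
  then have c: "f r = G r + (f a - G a)" if "r \<in> {a..b}" for r
    using that lipschitz_onD[of 0 "{a..b}" "\<lambda>s. f s - G s" r a] by (auto simp: algebra_simps)
  have "((\<lambda>r. G r + (f a - G a)) has_vector_derivative g s) (at s within {a..b})"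
    using G[OF \<open>s \<in> {a..b}\<close>] by (auto simp: has_vector_derivative_def intro!: derivative_eq_intros)
  then show ?thesis
    by (rule has_vector_derivative_transform_within[OF _ zero_less_one \<open>s \<in> {a..b}\<close>]) (rule c[symmetric])
qed

text \<open>Filippov's iteration with continuous data: no measurable selections are needed, and the limit
  is continuously differentiable.\<close>

lemma filippov_continuous:
  fixes P :: "real \<Rightarrow> 'a::euclidean_space \<Rightarrow> 'a \<Rightarrow> 'a" and \<Gamma> :: "real \<Rightarrow> 'a \<Rightarrow> 'a set"
  assumes "L > 0"
    and P_in: "\<And>s x v. s \<in> {a..b} \<Longrightarrow> P s x v \<in> \<Gamma> s x"
    and P_lip: "\<And>s x y v. s \<in> {a..b} \<Longrightarrow> v \<in> \<Gamma> s y \<Longrightarrow> norm (P s x v - v) \<le> L * norm (x - y)"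
    and P_cont: "\<And>x v. continuous_on {a..b} x \<Longrightarrow> continuous_on {a..b} v \<Longrightarrow> continuous_on {a..b} (\<lambda>s. P s (x s) (v s))"
    and \<Gamma>: "\<And>s x. closed (\<Gamma> s x)"
    and v0: "continuous_on {a..b} v0"
    and z0: "\<And>s. s \<in> {a..b} \<Longrightarrow> (z0 has_vector_derivative v0 s) (at s within {a..b})"
    and init: "\<And>s. s \<in> {a..b} \<Longrightarrow> norm (P s (z0 s) (v0 s) - v0 s) \<le> \<eta>"
  shows "\<exists>z v. continuous_on {a..b} v \<and> z a = z0 a \<and>
     (\<forall>s\<in>{a..b}. (z has_vector_derivative v s) (at s within {a..b}) \<and> v s \<in> \<Gamma> s (z s) \<and>
        norm (z s - z0 s) \<le> \<eta> * (exp (2 * L * (b - a)) / L))"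
proof (cases "a \<le> b")
  case False
  then show ?thesis by auto
next
  case True
  then have "\<eta> \<ge> 0" using init[of a] norm_ge_zero order_trans by (metis atLeastAtMost_iff order_refl)
  \<comment> \<open>The iteration runs on velocities: \<open>Z w\<close> is the curve through
    \<open>z0 a\<close> with velocity \<open>w\<close>, and each new velocity is the old one,
    corrected by \<open>P\<close> so as to be admissible along the old curve.\<close>
  define Z where "Z = (\<lambda>w s. z0 a + integral {a..s} (w :: real \<Rightarrow> 'a))"
  define v where "v = rec_nat v0 (\<lambda>_ w s. P s (Z w s) (w s))"
  have v_0: "v 0 = v0" and v_Suc: "v (Suc k) s = P s (Z (v k) s) (v k s)" for k s
    by (simp_all add: v_def)
  \<comment> \<open>Exponential weight: integrating \<open>E\<close> yields a factor
    \<open>1 / (2 * L)\<close> and the Lipschitz estimate a factor \<open>L\<close>, so successive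
    corrections shrink by one half whatever the length of the interval.\<close>
  define E where "E = (\<lambda>s. exp (2 * L * (s - a)))"
  have E1: "E s \<ge> 1" if "s \<in> {a..b}" for s using that \<open>L > 0\<close> by (simp add: E_def)
  have Emono: "E s \<le> E b" if "s \<in> {a..b}" for s using that \<open>L > 0\<close> by (simp add: E_def)
  have Zd: "(Z w has_vector_derivative w s) (at s within {a..b})" if "continuous_on {a..b} w" "s \<in> {a..b}" for w s
    unfolding Z_def using integral_has_vector_derivative[OF that]
    by (auto simp: has_vector_derivative_def intro!: derivative_eq_intros)
  have Zc: "continuous_on {a..b} (Z w)" if "continuous_on {a..b} w" for w
    unfolding continuous_on_eq_continuous_within by (intro ballI has_vector_derivative_continuous[OF Zd[OF that]])
  have vc: "continuous_on {a..b} (v k)" for k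
    by (induction k) (auto simp: v_0 v0 v_Suc[abs_def] intro!: P_cont Zc)
  have Z0: "Z v0 s = z0 s" if "s \<in> {a..b}" for s
  proof -
    have "(v0 has_integral (z0 s - z0 a)) {a..s}"
      by (rule fundamental_theorem_of_calculus) (use that in \<open>auto intro!: has_vector_derivative_within_subset[OF z0]\<close>)
    then show ?thesis by (simp add: Z_def integral_unique)
  qed
  have intE: "(E has_integral ((E s - 1) / (2 * L))) {a..s}" if "s \<in> {a..b}" for s
  proof -
    have "(E has_integral (E s / (2 * L) - E a / (2 * L))) {a..s}"
      by (rule fundamental_theorem_of_calculus)
        (use that \<open>L > 0\<close> in \<open>auto simp: E_def has_vector_derivative_def intro!: derivative_eq_intros\<close>)
    then show ?thesis by (simp add: E_def diff_divide_distrib)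
  qed
  have Zdiff: "norm (Z w s - Z w' s) \<le> c * (E s / (2 * L))"
    if w: "continuous_on {a..b} w" "continuous_on {a..b} w'" and s: "s \<in> {a..b}"
      and ww: "\<And>r. r \<in> {a..b} \<Longrightarrow> norm (w r - w' r) \<le> c * E r" for w w' s c
  proof -
    have "c * E a \<ge> 0" using ww[of a] True order_trans[OF norm_ge_zero] by auto
    then have "c \<ge> 0" by (simp add: E_def)
    have i: "w integrable_on {a..s}" "w' integrable_on {a..s}"
      using w s by (auto intro!: integrable_continuous_real intro: continuous_on_subset)
    have "Z w s - Z w' s = integral {a..s} (\<lambda>r. w r - w' r)"
      by (simp add: Z_def integral_diff[OF i])
    also have "norm \<dots> \<le> integral {a..s} (\<lambda>r. c * E r)"
      by (rule integral_norm_bound_integral)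
        (use i intE[OF s] s ww in \<open>auto intro!: integrable_diff integrable_on_mult_right simp: has_integral_iff\<close>)
    also have "\<dots> = c * ((E s - 1) / (2 * L))"
      using intE[OF s] by (simp add: has_integral_iff)
    also have "\<dots> \<le> c * (E s / (2 * L))"
      using \<open>c \<ge> 0\<close> \<open>L > 0\<close> by (intro mult_left_mono divide_right_mono) auto
    finally show ?thesis .
  qed
  have step: "norm (v (Suc k) s - v k s) \<le> \<eta> * (1/2) ^ k * E s" if "s \<in> {a..b}" for k s
    using that
  proof (induction k arbitrary: s)
    case 0
    have "norm (v (Suc 0) s - v 0 s) \<le> \<eta>"
      using init[OF 0] Z0[OF 0] by (simp add: v_Suc v_0)
    also have "\<dots> \<le> \<eta> * E s" using E1[OF 0] \<open>\<eta> \<ge> 0\<close> mult_left_mono[of 1 "E s" \<eta>] by simp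
    finally show ?case by simp
  next
    case (Suc k)
    \<comment> \<open>\<open>v (Suc k) s\<close> is admissible at \<open>Z (v k) s\<close>, so
      correcting it at \<open>Z (v (Suc k)) s\<close> moves it by at most \<open>L\<close> times the
      distance of these two points.\<close>
    have "norm (v (Suc (Suc k)) s - v (Suc k) s) \<le> L * norm (Z (v (Suc k)) s - Z (v k) s)"
      unfolding v_Suc[of "Suc k"] by (rule P_lip[OF Suc.prems]) (use Suc.prems P_in v_Suc in auto)
    also have "\<dots> \<le> L * ((\<eta> * (1/2) ^ k) * (E s / (2 * L)))"
      using \<open>L > 0\<close> by (intro mult_left_mono Zdiff vc Suc) auto
    also have "\<dots> = \<eta> * (1/2) ^ Suc k * E s" using \<open>L > 0\<close> by simp
    finally show ?case .
  qed
  have tele: "(\<Sum>k<n. v (Suc k) s - v k s) = v n s - v0 s" for n s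
    using sum_lessThan_telescope[of "\<lambda>k. v k s" n] by (simp only: v_0)
  have "uniform_limit {a..b} (\<lambda>n s. \<Sum>k<n. v (Suc k) s - v k s) (\<lambda>s. \<Sum>k. v (Suc k) s - v k s) sequentially"
  proof (rule Weierstrass_m_test)
    show "summable (\<lambda>k. \<eta> * E b * (1/2) ^ k)" by (intro summable_mult summable_geometric) auto
    show "norm (v (Suc k) s - v k s) \<le> \<eta> * E b * (1/2) ^ k" if "s \<in> {a..b}" for k s
      using order_trans[OF step[OF that, of k] mult_left_mono[OF Emono[OF that], of "\<eta> * (1/2) ^ k"]] \<open>\<eta> \<ge> 0\<close>
      by (simp add: mult_ac)
  qed
  then have ul0: "uniform_limit {a..b} (\<lambda>n s. v n s - v0 s) (\<lambda>s. \<Sum>k. v (Suc k) s - v k s) sequentially"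
    by (simp only: tele)
  define w where "w = (\<lambda>s. (\<Sum>k. v (Suc k) s - v k s) + v0 s)"
  have ul: "uniform_limit {a..b} v w sequentially"
    using uniform_limit_add[OF ul0 uniform_limit_const[of v0 "{a..b}" sequentially]] by (simp add: w_def)
  have wc: "continuous_on {a..b} w"
    by (rule uniform_limit_theorem[OF _ ul]) (auto simp: vc)
  have wlim: "(\<lambda>k. v k s) \<longlonglongrightarrow> w s" if "s \<in> {a..b}" for s
    using tendsto_uniform_limitI[OF ul that] .
  have Zlim: "(\<lambda>k. Z (v k) s) \<longlonglongrightarrow> Z w s" if s: "s \<in> {a..b}" for s
  proof -
    have sub: "{a..s} \<subseteq> {a..b}" using s by auto
    obtain I J where I: "\<And>n. (v n has_integral I n) {a..s}" "(w has_integral J) {a..s}" "I \<longlonglongrightarrow> J"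
      using uniform_limit_integral[OF uniform_limit_on_subset[OF ul sub] continuous_on_subset[OF vc sub]]
        sequentially_bot by blast
    have "I = (\<lambda>n. integral {a..s} (v n))" "J = integral {a..s} w"
      using integral_unique[OF I(1)] integral_unique[OF I(2)] by auto
    then show ?thesis using I(3) by (auto simp: Z_def intro!: tendsto_intros)
  qed
  \<comment> \<open>Correcting \<open>v (Suc k) s\<close> at the limit point \<open>Z w s\<close>
    moves it by at most \<open>L\<close> times the distance from \<open>Z w s\<close> to
    \<open>Z (v k) s\<close>, which vanishes. The corrected velocities lie in the closed set
    \<open>\<Gamma> s (Z w s)\<close> and share the limit \<open>w s\<close>.\<close>
  have sol: "w s \<in> \<Gamma> s (Z w s)" if s: "s \<in> {a..b}" for s
  proof -
    have "(\<lambda>k. P s (Z w s) (v (Suc k) s) - v (Suc k) s) \<longlonglongrightarrow> 0"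
    proof (rule Lim_null_comparison)
      show "\<forall>\<^sub>F k in sequentially. norm (P s (Z w s) (v (Suc k) s) - v (Suc k) s) \<le> L * norm (Z w s - Z (v k) s)"
        using P_in[OF s] by (intro always_eventually allI P_lip[OF s]) (auto simp: v_Suc)
      show "(\<lambda>k. L * norm (Z w s - Z (v k) s)) \<longlonglongrightarrow> 0"
        using tendsto_mult[OF tendsto_const[of L] tendsto_norm[OF tendsto_diff[OF tendsto_const[of "Z w s"] Zlim[OF s]]]]
        by simp
    qed
    from tendsto_add[OF this LIMSEQ_Suc[OF wlim[OF s]]]
    have "(\<lambda>k. P s (Z w s) (v (Suc k) s)) \<longlonglongrightarrow> w s" by simp
    then show ?thesis by (rule closed_sequentially[OF \<Gamma> P_in[OF s]])
  qed
  \<comment> \<open>The last factor is the partial sum of \<open>1/2 + 1/4 + ...\<close>, kept in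
    closed form for the induction.\<close>
  have bnd: "norm (Z (v k) s - z0 s) \<le> \<eta> * (E s / L) * (1 - (1/2) ^ k)" if s: "s \<in> {a..b}" for k s
  proof (induction k)
    case 0
    then show ?case using Z0[OF s] by (simp add: v_0)
  next
    case (Suc k)
    have "norm (Z (v (Suc k)) s - Z (v k) s) \<le> (\<eta> * (1/2) ^ k) * (E s / (2 * L))"
      by (intro Zdiff vc s step)
    with Suc have "norm (Z (v (Suc k)) s - z0 s) \<le> (\<eta> * (1/2) ^ k) * (E s / (2 * L)) + \<eta> * (E s / L) * (1 - (1/2) ^ k)"
      using norm_triangle_ineq[of "Z (v (Suc k)) s - Z (v k) s" "Z (v k) s - z0 s"] by simp
    also have "\<dots> = \<eta> * (E s / L) * (1 - (1/2) ^ Suc k)" using \<open>L > 0\<close> by (simp add: field_simps)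
    finally show ?case .
  qed
  have "norm (Z w s - z0 s) \<le> \<eta> * (E b / L)" if s: "s \<in> {a..b}" for s
  proof (rule Lim_bounded)
    show "(\<lambda>k. norm (Z (v k) s - z0 s)) \<longlonglongrightarrow> norm (Z w s - z0 s)"
      by (intro tendsto_intros Zlim s)
    have "norm (Z (v k) s - z0 s) \<le> \<eta> * (E b / L)" for k
    proof -
      have "\<eta> * (E s / L) * (1 - (1/2) ^ k) \<le> \<eta> * (E s / L) * 1"
        using \<open>\<eta> \<ge> 0\<close> \<open>L > 0\<close> E1[OF s] by (intro mult_left_mono) auto
      also have "\<dots> \<le> \<eta> * (E b / L)"
        using \<open>\<eta> \<ge> 0\<close> \<open>L > 0\<close> Emono[OF s] by (auto intro!: mult_left_mono divide_right_mono)
      finally show ?thesis using bnd[OF s, of k] by linarith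
    qed
    then show "\<forall>k\<ge>0. norm (Z (v k) s - z0 s) \<le> \<eta> * (E b / L)" by blast
  qed
  moreover have "Z w a = z0 a" by (simp add: Z_def)
  ultimately show ?thesis
    using wc Zd[OF wc] sol by (intro exI[of _ "Z w"] exI[of _ w]) (auto simp: E_def)
qed

section \<open>Nonsmooth analysis of the Hamiltonian\<close>

lemma frechet_superdiffI:
  assumes "\<And>\<epsilon>. \<epsilon> > 0 \<Longrightarrow> \<exists>\<delta>>0. \<forall>y. y \<noteq> x \<longrightarrow> dist y x < \<delta> \<longrightarrow> f y - f x - p \<bullet> (y - x) \<le> \<epsilon> * norm (y - x)"
  shows "p \<in> frechet_superdiff f x"
  unfolding frechet_superdiff_def mem_Collect_eq Limsup_le_iff
proof (intro allI impI)
  fix c :: ereal assume "c > 0"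
  then obtain \<epsilon> where \<epsilon>: "0 < ereal \<epsilon>" "ereal \<epsilon> < c" using ereal_dense2 by blast
  then obtain \<delta> where "\<delta> > 0" and \<delta>: "\<forall>y. y \<noteq> x \<longrightarrow> dist y x < \<delta> \<longrightarrow> f y - f x - p \<bullet> (y - x) \<le> \<epsilon> * norm (y - x)"
    using assms[of \<epsilon>] by auto
  have "ereal ((f y - f x - p \<bullet> (y - x)) / norm (y - x)) < c" if "y \<noteq> x" "dist y x < \<delta>" for y
  proof -
    have "(f y - f x - p \<bullet> (y - x)) / norm (y - x) \<le> \<epsilon>"
      using \<delta> that by (simp add: divide_le_eq)
    then show ?thesis using \<epsilon>(2) by (meson ereal_less_eq(3) le_less_trans)
  qed
  then show "\<forall>\<^sub>F y in at x. ereal ((f y - f x - p \<bullet> (y - x)) / norm (y - x)) < c"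
    using \<open>\<delta> > 0\<close> by (auto simp: eventually_at)
qed

lemma frechet_superdiffD:
  assumes "p \<in> frechet_superdiff f x" "\<epsilon> > 0"
  shows "\<exists>\<delta>>0. \<forall>y. dist y x < \<delta> \<longrightarrow> f y - f x - p \<bullet> (y - x) \<le> \<epsilon> * norm (y - x)"
proof -
  have "\<forall>\<^sub>F y in at x. ereal ((f y - f x - p \<bullet> (y - x)) / norm (y - x)) < ereal \<epsilon>"
    using assms unfolding frechet_superdiff_def mem_Collect_eq Limsup_le_iff
    by (metis ereal_less(2))
  then obtain \<delta> where "\<delta> > 0" and \<delta>: "\<forall>y. y \<noteq> x \<and> dist y x < \<delta> \<longrightarrow> (f y - f x - p \<bullet> (y - x)) / norm (y - x) < \<epsilon>"
    by (auto simp: eventually_at)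
  have "f y - f x - p \<bullet> (y - x) \<le> \<epsilon> * norm (y - x)" if "dist y x < \<delta>" for y
    using \<delta> that by (cases "y = x") (auto simp: divide_less_eq less_imp_le)
  then show ?thesis using \<open>\<delta> > 0\<close> by blast
qed

lemma frechet_subdiffD:
  assumes "p \<in> frechet_subdiff f x" "\<epsilon> > 0"
  shows "\<exists>\<delta>>0. \<forall>y. dist y x < \<delta> \<longrightarrow> f y - f x - p \<bullet> (y - x) \<ge> - \<epsilon> * norm (y - x)"
proof -
  have "\<forall>\<^sub>F y in at x. ereal (- \<epsilon>) < ereal ((f y - f x - p \<bullet> (y - x)) / norm (y - x))"
    using assms unfolding frechet_subdiff_def mem_Collect_eq le_Liminf_iff
    by (metis ereal_less(1) neg_less_0_iff_less)
  then obtain \<delta> where "\<delta> > 0" and \<delta>: "\<forall>y. y \<noteq> x \<and> dist y x < \<delta> \<longrightarrow> - \<epsilon> < (f y - f x - p \<bullet> (y - x)) / norm (y - x)"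
    by (auto simp: eventually_at)
  have "f y - f x - p \<bullet> (y - x) \<ge> - \<epsilon> * norm (y - x)" if "dist y x < \<delta>" for y
  proof (cases "y = x")
    case False
    then have "- \<epsilon> < (f y - f x - p \<bullet> (y - x)) / norm (y - x)" "norm (y - x) > 0" using \<delta> that by auto
    then show ?thesis by (simp only: pos_less_divide_eq) 
  qed auto
  then show ?thesis using \<open>\<delta> > 0\<close> by blast
qed

text \<open>Midpoint semiconvexity is iterated on the segments from \<open>x\<close> to \<open>x + 2\<^sup>-\<^sup>k d\<close>: the difference
  quotients along this sequence almost decrease, and the subgradient bounds them in the limit.\<close>

lemma semiconvex_on_subgradient_le:
  fixes u :: "'a::real_inner \<Rightarrow> real"
  assumes u: "semiconvex_on K C u" and "C \<ge> 0" and q: "q \<in> frechet_subdiff u x"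
    and K: "closed_segment x y \<subseteq> K"
  shows "u x + q \<bullet> (y - x) - C * (norm (y - x))\<^sup>2 \<le> u y"
proof -
  define d where "d = y - x"
  define D where "D = (\<lambda>n. 2 ^ n * (u (x + (1/2) ^ n *\<^sub>R d) - u x))"
  \<comment> \<open>The \<open>n\<close>-th segment runs from \<open>x\<close> to
    \<open>x + h + h\<close>; the second difference at its midpoint, multiplied by
    \<open>2 ^ n\<close>, compares consecutive difference quotients. The error has size
    \<open>2 ^ n * (1/4) ^ Suc n\<close>.\<close>
  have step: "D n \<ge> D (Suc n) - C * (1/2) ^ Suc (Suc n) * (norm d)\<^sup>2" for n
  proof -
    define h where "h = (1/2) ^ Suc n *\<^sub>R d"
    have h2: "h + h = (1/2) ^ n *\<^sub>R d" by (simp add: h_def scaleR_2[symmetric])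
    have e: "(1/2) ^ n \<le> (1::real)" by (simp add: power_le_one)
    have "x + h - h = x" "x + h + h = (1 - (1/2) ^ n) *\<^sub>R x + (1/2) ^ n *\<^sub>R y"
      using h2 by (auto simp: d_def algebra_simps)
    then have "closed_segment (x + h - h) (x + h + h) \<subseteq> closed_segment x y"
      using e by (intro subset_closed_segment[THEN iffD2]) (auto simp: in_segment intro!: exI[of _ "(1/2) ^ n"])
    then have "u (x + h + h) + u (x + h - h) - 2 * u (x + h) \<ge> - C * (norm h)\<^sup>2"
      using u K unfolding semiconvex_on_def by blast
    then have "u (x + (1/2) ^ n *\<^sub>R d) + u x - 2 * u (x + h) \<ge> - C * (norm h)\<^sup>2"
      using h2 by (simp add: add.assoc)
    then have "2 ^ n * (u (x + (1/2) ^ n *\<^sub>R d) + u x - 2 * u (x + h)) \<ge> 2 ^ n * (- C * (norm h)\<^sup>2)"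
      by (intro mult_left_mono) auto
    moreover have "2 ^ n * (u (x + (1/2) ^ n *\<^sub>R d) + u x - 2 * u (x + h)) = D n - D (Suc n)"
      by (simp add: D_def h_def algebra_simps)
    moreover have "2 ^ n * (- C * (norm h)\<^sup>2) = - C * (1/2) ^ Suc (Suc n) * (norm d)\<^sup>2"
      by (simp add: h_def power_mult_distrib power2_eq_square field_simps)
    ultimately show ?thesis by linarith
  qed
  \<comment> \<open>The first \<open>n\<close> terms of \<open>1/4 + 1/8 + ...\<close> sum to
    \<open>1/2 - (1/2) ^ Suc n\<close>.\<close>
  have D0: "D 0 \<ge> D n - C * (1/2 - (1/2) ^ Suc n) * (norm d)\<^sup>2" for n
  proof (induction n)
    case (Suc n)
    then show ?case using step[of n] by (simp add: algebra_simps)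
  qed simp
  have "q \<bullet> d - C * (norm d)\<^sup>2 \<le> D 0"
  proof (rule field_le_epsilon)
    fix e :: real assume "e > 0"
    define \<epsilon> where "\<epsilon> = e / (norm d + 1)"
    have "\<epsilon> > 0" using \<open>e > 0\<close> by (simp add: \<epsilon>_def add_nonneg_pos)
    obtain \<delta> where "\<delta> > 0" and \<delta>: "\<forall>y. dist y x < \<delta> \<longrightarrow> u y - u x - q \<bullet> (y - x) \<ge> - \<epsilon> * norm (y - x)"
      using frechet_subdiffD[OF q \<open>\<epsilon> > 0\<close>] by blast
    have "(\<lambda>n. (1/2) ^ n * norm d) \<longlonglongrightarrow> 0"
      by (rule tendsto_mult_left_zero) (simp add: LIMSEQ_realpow_zero)
    then obtain n where n: "(1/2) ^ n * norm d < \<delta>"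
      using \<open>\<delta> > 0\<close> order_tendstoD(2) eventually_sequentially by (metis order_refl)
    have "u (x + (1/2) ^ n *\<^sub>R d) - u x - q \<bullet> ((1/2) ^ n *\<^sub>R d) \<ge> - \<epsilon> * ((1/2) ^ n * norm d)"
      using \<delta>[rule_format, of "x + (1/2) ^ n *\<^sub>R d"] n by (simp add: dist_norm)
    then have "2 ^ n * (u (x + (1/2) ^ n *\<^sub>R d) - u x - q \<bullet> ((1/2) ^ n *\<^sub>R d)) \<ge> 2 ^ n * (- \<epsilon> * ((1/2) ^ n * norm d))"
      by (intro mult_left_mono) auto
    moreover have "2 ^ n * (- \<epsilon> * ((1/2) ^ n * norm d)) = - \<epsilon> * norm d" by (simp add: field_simps)
    moreover have "2 ^ n * (u (x + (1/2) ^ n *\<^sub>R d) - u x - q \<bullet> ((1/2) ^ n *\<^sub>R d)) = D n - q \<bullet> d"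
      by (simp add: D_def field_simps)
    ultimately have "D n \<ge> q \<bullet> d - \<epsilon> * norm d" by linarith
    moreover have "\<epsilon> * norm d \<le> \<epsilon> * (norm d + 1)" using \<open>\<epsilon> > 0\<close> by simp
    moreover have "\<epsilon> * (norm d + 1) = e" by (simp add: \<epsilon>_def add_nonneg_eq_0_iff)
    \<comment> \<open>The total \<open>1/2\<close> is rounded up to \<open>1\<close>, so the
      conclusion carries \<open>C\<close> and not \<open>C / 2\<close>.\<close>
    moreover have "C * (1/2 - (1/2) ^ Suc n) * (norm d)\<^sup>2 \<le> C * 1 * (norm d)\<^sup>2"
      using \<open>C \<ge> 0\<close> zero_le_power[of "1/2::real" "Suc n"] by (intro mult_right_mono mult_left_mono) (linarith | simp)+
    ultimately show "q \<bullet> d - C * (norm d)\<^sup>2 \<le> D 0 + e" using D0[of n] by linarith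
  qed
  then show ?thesis by (simp add: D_def d_def)
qed

section \<open>The Hamiltonian as support function of compact convex velocity sets\<close>

locale lipschitz_inclusion =
  fixes F :: "'a::euclidean_space \<Rightarrow> 'a set" and \<rho> :: real
  assumes nonempty: "F x \<noteq> {}" and convex: "convex (F x)" and compact: "compact (F x)"
    and lipschitz: "locally_lipschitz_multi F"
    and \<rho>_pos: "\<rho> > 0" and growth: "v \<in> F x \<Longrightarrow> norm v \<le> \<rho> * (1 + norm x)"
begin

abbreviation "H \<equiv> hamiltonian F"

lemma closed: "closed (F x)"
  using compact by (rule compact_imp_closed)

lemma bdd_above_inner: "bdd_above ((\<lambda>v. v \<bullet> p) ` F x)"
  by (intro bounded_imp_bdd_above compact_imp_bounded compact_continuous_image continuous_intros compact)

lemma inner_le_H: "v \<in> F x \<Longrightarrow> v \<bullet> p \<le> H x p"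
  unfolding hamiltonian_def by (intro cSUP_upper bdd_above_inner)

lemma H_attained: obtains v where "v \<in> F x" "v \<bullet> p = H x p"
proof -
  obtain v where v: "v \<in> F x" "\<forall>w\<in>F x. w \<bullet> p \<le> v \<bullet> p"
    using continuous_attains_sup[OF compact nonempty, of x "\<lambda>v. v \<bullet> p"]
      continuous_on_inner[OF continuous_on_id continuous_on_const, of "F x" p] by auto
  have "H x p \<le> v \<bullet> p" unfolding hamiltonian_def using v nonempty by (intro cSUP_least) auto
  then show ?thesis using inner_le_H[OF v(1), of p] by (intro that[OF v(1)]) auto
qed

lemma H_add_le: "H x (p + q) \<le> H x p + H x q"
  by (metis H_attained inner_le_H add_mono inner_add_right)

lemma H_scaleR: assumes "c \<ge> 0" shows "H x (c *\<^sub>R p) = c * H x p"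
proof (rule antisym)
  show "H x (c *\<^sub>R p) \<le> c * H x p"
    by (metis H_attained inner_le_H assms inner_scaleR_right mult_left_mono)
  show "c * H x p \<le> H x (c *\<^sub>R p)"
    by (metis H_attained inner_le_H inner_scaleR_right)
qed

lemma H_zero [simp]: "H x 0 = 0"
  using H_scaleR[of 0 x 0] by simp

lemma abs_H_le: "\<bar>H x p\<bar> \<le> \<rho> * (1 + norm x) * norm p"
proof -
  obtain v where v: "v \<in> F x" "v \<bullet> p = H x p" using H_attained .
  have "\<bar>v \<bullet> p\<bar> \<le> norm v * norm p" by (rule Cauchy_Schwarz_ineq2)
  also have "\<dots> \<le> \<rho> * (1 + norm x) * norm p" using growth[OF v(1)] by (intro mult_right_mono) auto
  finally show ?thesis using v by simp
qed

lemma H_diff_le: "H x p - H x q \<le> \<rho> * (1 + norm x) * norm (p - q)"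
  using H_add_le[of x "p - q" q] abs_H_le[of x "p - q"] by simp

text \<open>Separation by the nearest point \<open>w\<close>: it maximises the pairing with
  \<open>v - w\<close> over \<open>F x\<close>, so the test vector \<open>p = v - w\<close> bounds
  the square of \<open>norm (v - w)\<close> by \<open>k * norm (v - w)\<close>. For
  \<open>k = 0\<close> this recovers \<open>F x\<close> from its support function; in general it
  converts estimates for \<open>H\<close> into nearby points of \<open>F x\<close>.\<close>

lemma approx_mem_if_inner_le:
  assumes "k \<ge> 0" "\<And>p. v \<bullet> p \<le> H x p + k * norm p"
  obtains w where "w \<in> F x" "norm (v - w) \<le> k"
proof -
  define w where "w = closest_point (F x) v"
  have w: "w \<in> F x" unfolding w_def by (rule closest_point_in_set[OF closed nonempty])
  obtain u where u: "u \<in> F x" "u \<bullet> (v - w) = H x (v - w)" using H_attained .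
  have "(v - w) \<bullet> (u - w) \<le> 0" unfolding w_def by (rule closest_point_dot[OF convex closed u(1)])
  then have "H x (v - w) \<le> w \<bullet> (v - w)" using u by (simp add: inner_commute inner_diff_right)
  then have "(v - w) \<bullet> (v - w) \<le> k * norm (v - w)"
    using assms(2)[of "v - w"] by (simp add: inner_diff_left)
  then have "norm (v - w) * norm (v - w) \<le> k * norm (v - w)"
    by (simp add: dot_square_norm power2_eq_square)
  then have "norm (v - w) \<le> k" using \<open>k \<ge> 0\<close> by (cases "v = w") auto
  then show ?thesis using that w by blast
qed

lemma infdist_le_hausdorff_dist:
  assumes "v \<in> F x"
  shows "infdist v (F y) \<le> hausdorff_dist (F x) (F y)"
proof -
  have "bdd_above ((\<lambda>a. infdist a (F y)) ` F x)"
    by (intro bounded_imp_bdd_above compact_imp_bounded compact_continuous_image continuous_on_infdist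
        continuous_on_id compact)
  then have "infdist v (F y) \<le> (SUP a\<in>F x. infdist a (F y))" using assms by (intro cSUP_upper)
  then show ?thesis unfolding hausdorff_dist_def by simp
qed

text \<open>A maximiser over \<open>F y\<close> has a point of \<open>F z\<close> within the
  Hausdorff distance; pairing with \<open>p\<close> costs that distance times
  \<open>norm p\<close>.\<close>

lemma H_lipschitz_near:
  "\<exists>r>0. \<exists>L\<ge>0. \<forall>y\<in>ball x r. \<forall>z\<in>ball x r. \<forall>p. H y p \<le> H z p + L * norm (y - z) * norm p"
proof -
  obtain r L where "r > 0" "L \<ge> 0" and L: "\<And>y z. y \<in> ball x r \<Longrightarrow> z \<in> ball x r \<Longrightarrow> hausdorff_dist (F y) (F z) \<le> L * dist y z"
    using lipschitz unfolding locally_lipschitz_multi_def by metis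
  have "H y p \<le> H z p + L * norm (y - z) * norm p" if yz: "y \<in> ball x r" "z \<in> ball x r" for y z p
  proof -
    obtain v where v: "v \<in> F y" "v \<bullet> p = H y p" using H_attained .
    obtain w where w: "w \<in> F z" "infdist v (F z) = dist v w"
      using infdist_attains_inf[OF closed nonempty] by blast
    have "norm (v - w) \<le> L * norm (y - z)"
      using infdist_le_hausdorff_dist[OF v(1), of z] L[OF yz] w(2) by (simp add: dist_norm)
    then have "norm (v - w) * norm p \<le> L * norm (y - z) * norm p" by (rule mult_right_mono) auto
    then have "(v - w) \<bullet> p \<le> L * norm (y - z) * norm p" using norm_cauchy_schwarz[of "v - w" p] by linarith
    then show ?thesis using inner_le_H[OF w(1), of p] v(2) by (simp add: inner_diff_left)
  qed
  then show ?thesis using \<open>r > 0\<close> \<open>L \<ge> 0\<close> by blast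
qed

lemma H_continuous_on: "continuous_on S (\<lambda>p. H x p)"
proof (rule lipschitz_on_continuous_on[of "\<rho> * (1 + norm x)"], rule lipschitz_onI)
  show "dist (H x p) (H x q) \<le> \<rho> * (1 + norm x) * dist p q" for p q
    using H_diff_le[of x p q] H_diff_le[of x q p] by (auto simp: dist_norm norm_minus_commute abs_le_iff)
qed (use \<rho>_pos in auto)

text \<open>Local constants are patched by the compactness theorem for
  \<open>local_lipschitz\<close>, unit vectors \<open>p\<close> playing the role of the time
  parameter; positive homogeneity then extends the estimate to all \<open>p\<close>.\<close>

lemma H_lipschitz_compact:
  assumes "compact K"
  shows "\<exists>L>0. \<forall>x\<in>K. \<forall>y\<in>K. \<forall>p. H x p \<le> H y p + L * norm (x - y) * norm p"
proof -
  have "local_lipschitz (sphere 0 1) K (\<lambda>p x. H x p)"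
  proof (rule local_lipschitzI)
    fix t x assume "x \<in> K"
    obtain r L where "r > 0" "L \<ge> 0" and L: "\<forall>y\<in>ball x r. \<forall>z\<in>ball x r. \<forall>p. H y p \<le> H z p + L * norm (y - z) * norm p"
      using H_lipschitz_near by blast
    have "L-lipschitz_on (cball x (r/2) \<inter> K) (\<lambda>x. H x p)" if "p \<in> sphere 0 1" for p
    proof (rule lipschitz_onI[OF _ \<open>L \<ge> 0\<close>])
      fix y z assume "y \<in> cball x (r/2) \<inter> K" "z \<in> cball x (r/2) \<inter> K"
      then have "y \<in> ball x r" "z \<in> ball x r" using \<open>r > 0\<close> by auto
      then have "H y p \<le> H z p + L * norm (y - z) * norm p" "H z p \<le> H y p + L * norm (z - y) * norm p"
        using L by blast+
      then show "dist (H y p) (H z p) \<le> L * dist y z"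
        using that by (auto simp: dist_norm norm_minus_commute abs_le_iff)
    qed
    then show "\<exists>u>0. \<exists>L. \<forall>t\<in>cball t u \<inter> sphere 0 1. L-lipschitz_on (cball x u \<inter> K) (\<lambda>x. H x t)"
      using \<open>r > 0\<close> by (intro exI[of _ "r/2"] conjI exI[of _ L]) auto
  qed
  then obtain L where L: "\<And>p. p \<in> sphere 0 1 \<Longrightarrow> L-lipschitz_on K (\<lambda>x. H x p)"
    using local_lipschitz_compact_implies_lipschitz[OF _ assms compact_sphere, of 0 1 "\<lambda>p x. H x p"] H_continuous_on
    by blast
  have "H x p \<le> H y p + (\<bar>L\<bar> + 1) * norm (x - y) * norm p" if xy: "x \<in> K" "y \<in> K" for x y p
  proof (cases "p = 0")
    case False
    define e where "e = (1 / norm p) *\<^sub>R p"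
    have e: "norm e = 1" and p: "p = norm p *\<^sub>R e" using False by (auto simp: e_def)
    have "H x e - H y e \<le> L * norm (x - y)"
      using lipschitz_onD[OF L, of e x y] xy e by (auto simp: dist_norm abs_le_iff)
    also have "\<dots> \<le> (\<bar>L\<bar> + 1) * norm (x - y)" by (intro mult_right_mono) auto
    finally have "norm p * (H x e - H y e) \<le> norm p * ((\<bar>L\<bar> + 1) * norm (x - y))" by (intro mult_left_mono) auto
    moreover have "H x p = norm p * H x e" "H y p = norm p * H y e" using H_scaleR[of "norm p" _ e] p by auto
    ultimately show ?thesis by (simp add: algebra_simps)
  qed simp
  then show ?thesis by (intro exI[of _ "\<bar>L\<bar> + 1"]) auto
qed

text \<open>The way back from support functions to sets: a uniform constant for \<open>H\<close> on
  a compact set becomes a uniform constant for \<open>F\<close>, with an explicit nearby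
  velocity.\<close>

lemma F_lipschitz_if_H_lipschitz:
  assumes "L \<ge> 0" "\<And>p. H x p \<le> H y p + L * norm (x - y) * norm p" and v: "v \<in> F x"
  obtains w where "w \<in> F y" "norm (v - w) \<le> L * norm (x - y)"
proof (rule approx_mem_if_inner_le[of "L * norm (x - y)" v y])
  show "v \<bullet> p \<le> H y p + L * norm (x - y) * norm p" for p
    using inner_le_H[OF v, of p] assms(2)[of p] by linarith
qed (use assms(1) that in auto)

lemma H_continuous_on2:
  assumes "continuous_on S f" "continuous_on S g"
  shows "continuous_on S (\<lambda>s. H (f s) (g s))"
proof -
  have "isCont (\<lambda>z. H (fst z) (snd z)) (x, p)" for x p
  proof -
    obtain r L where "r > 0" "L \<ge> 0" and L: "\<forall>y\<in>ball x r. \<forall>z\<in>ball x r. \<forall>p. H y p \<le> H z p + L * norm (y - z) * norm p"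
      using H_lipschitz_near by blast
    let ?B = "\<lambda>z. L * norm (fst z - x) * norm (snd z) + \<rho> * (1 + norm x) * norm (snd z - p)"
    have "((\<lambda>z. H (fst z) (snd z) - H x p) \<longlongrightarrow> 0) (at (x, p))"
    proof (rule Lim_null_comparison)
      have "\<forall>\<^sub>F z in at (x, p). fst z \<in> ball x r"
        using \<open>r > 0\<close> by (intro topological_tendstoD[OF tendsto_fst[OF tendsto_ident_at]]) auto
      then show "\<forall>\<^sub>F z in at (x, p). norm (H (fst z) (snd z) - H x p) \<le> ?B z"
      proof eventually_elim
        case (elim z)
        have "H (fst z) (snd z) \<le> H x (snd z) + L * norm (fst z - x) * norm (snd z)"
          "H x (snd z) \<le> H (fst z) (snd z) + L * norm (x - fst z) * norm (snd z)"
          using L elim \<open>r > 0\<close> by auto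
        then show ?case using H_diff_le[of x "snd z" p] H_diff_le[of x p "snd z"]
          by (auto simp: abs_le_iff norm_minus_commute)
      qed
      have "(?B \<longlongrightarrow> L * norm (fst (x, p) - x) * norm (snd (x, p)) + \<rho> * (1 + norm x) * norm (snd (x, p) - p)) (at (x, p))"
        by (intro tendsto_intros)
      then show "(?B \<longlongrightarrow> 0) (at (x, p))" by simp
    qed
    then show ?thesis by (simp add: isCont_def LIM_zero_iff)
  qed
  then have c: "continuous_on UNIV (\<lambda>z. H (fst z) (snd z))"
    by (simp add: continuous_on_eq_continuous_at)
  have "continuous_on S (\<lambda>s. (\<lambda>z. H (fst z) (snd z)) (f s, g s))"
    by (rule continuous_on_compose2[OF c]) (auto intro!: continuous_intros assms)
  then show ?thesis by simp
qed

lemma mem_if_inner_le: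
  assumes "\<And>p. v \<bullet> p \<le> H x p"
  shows "v \<in> F x"
  using approx_mem_if_inner_le[of 0 v x] assms by auto

text \<open>Closed graph argument: \<open>F (f s)\<close> is cut out by the half-space inequalities
  given by \<open>H\<close>, the condition on \<open>\<psi>\<close> isolates one of its points, and
  the growth bound puts all values into one compact ball. Nearest points of \<open>F\<close> and
  gradients of \<open>H\<close> are both unique selections of this kind.\<close>

lemma continuous_on_selection:
  fixes f :: "'b::euclidean_space \<Rightarrow> 'a"
  assumes f: "continuous_on S f" and fK: "\<And>s. s \<in> S \<Longrightarrow> f s \<in> K" and K: "bounded K"
    and g: "\<And>s. s \<in> S \<Longrightarrow> g s \<in> F (f s)"
    and \<psi>: "continuous_on (S \<times> UNIV) (\<lambda>z. \<psi> (fst z) (snd z) :: real)"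
    and g\<psi>: "\<And>s. s \<in> S \<Longrightarrow> \<psi> s (g s) \<le> 0"
    and uniq: "\<And>s c. s \<in> S \<Longrightarrow> c \<in> F (f s) \<Longrightarrow> \<psi> s c \<le> 0 \<Longrightarrow> c = g s"
  shows "continuous_on S g"
proof -
  obtain R where R: "\<And>x. x \<in> K \<Longrightarrow> norm x \<le> R" using K by (auto simp: bounded_iff)
  define T where "T = cball (0::'a) (\<rho> * (1 + R))"
  have gT: "g \<in> S \<rightarrow> T"
  proof
    fix s assume s: "s \<in> S"
    have "norm (g s) \<le> \<rho> * (1 + norm (f s))" by (rule growth[OF g[OF s]])
    also have "\<dots> \<le> \<rho> * (1 + R)" using R[OF fK[OF s]] \<rho>_pos by (intro mult_left_mono) auto
    finally show "g s \<in> T" by (simp add: T_def)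
  qed
  have cf: "continuous_on (S \<times> T) (\<lambda>z. f (fst z))"
    by (rule continuous_on_compose2[OF f continuous_on_fst[OF continuous_on_id]]) auto
  have 1: "closedin (top_of_set (S \<times> T)) ((S \<times> T) \<inter> (\<lambda>z. snd z \<bullet> p - H (f (fst z)) p) -` {..0})" for p
    by (intro continuous_closedin_preimage continuous_on_diff H_continuous_on2[OF cf] continuous_intros)
  have 2: "closedin (top_of_set (S \<times> T)) ((S \<times> T) \<inter> (\<lambda>z. \<psi> (fst z) (snd z)) -` {..0})"
    by (intro continuous_closedin_preimage continuous_on_subset[OF \<psi>]) auto
  have "(\<lambda>s. (s, g s)) ` S = ((S \<times> T) \<inter> (\<lambda>z. \<psi> (fst z) (snd z)) -` {..0}) \<inter>
      (\<Inter>p. (S \<times> T) \<inter> (\<lambda>z. snd z \<bullet> p - H (f (fst z)) p) -` {..0})" (is "?l = ?r")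
  proof
    show "?l \<subseteq> ?r" using gT g\<psi> inner_le_H[OF g] by auto
    show "?r \<subseteq> ?l"
    proof
      fix z assume z: "z \<in> ?r"
      then have "snd z \<in> F (f (fst z))" by (intro mem_if_inner_le) auto
      then have "snd z = g (fst z)" using z by (intro uniq) auto
      then show "z \<in> ?l" using z by (auto intro!: image_eqI[of _ _ "fst z"] simp: prod_eq_iff)
    qed
  qed
  moreover have "closedin (top_of_set (S \<times> T)) ?r"
    by (intro closedin_Int 2 closedin_Inter) (use 1 in auto)
  ultimately have "closedin (top_of_set (S \<times> T)) ((\<lambda>s. (s, g s)) ` S)" by simp
  moreover have "compact T" by (simp add: T_def)
  ultimately show ?thesis using continuous_closed_graph_eq[OF _ gT] by blast
qed

text \<open>The condition on \<open>\<psi>\<close> says that \<open>c\<close> maximises the pairing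
  with \<open>v s - c\<close> over \<open>F (f s)\<close>, so that \<open>v s - c\<close> is an
  outward normal at \<open>c\<close>. For a convex set this variational inequality characterises the
  nearest point.\<close>

lemma continuous_on_closest_point_F:
  fixes f v :: "real \<Rightarrow> 'a"
  assumes f: "continuous_on S f" and fK: "\<And>s. s \<in> S \<Longrightarrow> f s \<in> K" and K: "bounded K" and v: "continuous_on S v"
  shows "continuous_on S (\<lambda>s. closest_point (F (f s)) (v s))"
proof (rule continuous_on_selection[OF f fK K,
      where \<psi> = "\<lambda>s c. H (f s) (v s - c) - (v s - c) \<bullet> c"])
  show "closest_point (F (f s)) (v s) \<in> F (f s)" for s by (rule closest_point_in_set[OF closed nonempty])
  have "continuous_on (S \<times> UNIV) (\<lambda>z. f (fst z))" "continuous_on (S \<times> UNIV) (\<lambda>z. v (fst z))"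
    by (auto intro!: continuous_on_compose2[OF f] continuous_on_compose2[OF v] continuous_intros)
  then show "continuous_on (S \<times> UNIV) (\<lambda>z. H (f (fst z)) (v (fst z) - snd z) - (v (fst z) - snd z) \<bullet> snd z)"
    by (intro continuous_on_diff H_continuous_on2 continuous_intros)
next
  fix s
  let ?c = "closest_point (F (f s)) (v s)"
  obtain u where u: "u \<in> F (f s)" "u \<bullet> (v s - ?c) = H (f s) (v s - ?c)" using H_attained .
  have "(v s - ?c) \<bullet> (u - ?c) \<le> 0" by (rule closest_point_dot[OF convex closed u(1)])
  then show "H (f s) (v s - ?c) - (v s - ?c) \<bullet> ?c \<le> 0"
    using u by (simp add: inner_commute inner_diff_right)
next
  fix s c assume c: "c \<in> F (f s)" "H (f s) (v s - c) - (v s - c) \<bullet> c \<le> 0"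
  have "dist (v s) c \<le> dist (v s) u" if "u \<in> F (f s)" for u
  proof -
    have "(v s - c) \<bullet> (u - c) \<le> 0"
      using inner_le_H[OF that, of "v s - c"] c(2) by (simp add: inner_commute inner_diff_right)
    then have "(v s - c) \<bullet> (v s - c) \<le> (v s - c) \<bullet> (v s - u)" by (simp add: inner_diff_right)
    also have "\<dots> \<le> norm (v s - c) * norm (v s - u)" by (rule norm_cauchy_schwarz)
    finally have "norm (v s - c) * norm (v s - c) \<le> norm (v s - c) * norm (v s - u)"
      by (simp add: dot_square_norm power2_eq_square)
    then show ?thesis by (cases "v s = c") (auto simp: dist_norm)
  qed
  then show "c = closest_point (F (f s)) (v s)"
    by (intro closest_point_unique[OF convex closed c(1)]) auto
qed

text \<open>By sublinearity every difference quotient in direction \<open>w\<close> is at most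
  \<open>H x w\<close>; this gives the first claim, which places \<open>v\<close> in
  \<open>F x\<close>. In direction \<open>- p\<close>, convexity bounds the quotient at
  \<open>y\<close> by \<open>H x (y - p) - H x y\<close>, which tends to \<open>- H x p\<close> as
  \<open>y\<close> tends to \<open>p\<close>; hence \<open>v\<close> attains the supremum.\<close>

lemma clarke_gradient_H:
  assumes "v \<in> clarke_gradient (H x) p"
  shows "v \<bullet> w \<le> H x w" and "v \<bullet> p = H x p"
proof -
  have cd: "ereal (v \<bullet> w) \<le> Limsup (nhds p \<times>\<^sub>F at_right 0) (\<lambda>(y, s). ereal ((H x (y + s *\<^sub>R w) - H x y) / s))" for w
    using assms by (simp add: clarke_gradient_def clarke_dirderiv_def)
  \<comment> \<open>The upper bound \<open>1\<close> on the step size makes the weights of the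
    convex combination used for direction \<open>- p\<close> nonnegative.\<close>
  have s01: "\<forall>\<^sub>F z in nhds p \<times>\<^sub>F at_right (0::real). snd z > 0 \<and> snd z < 1"
  proof -
    have "\<forall>\<^sub>F s in at_right (0::real). s > 0 \<and> s < 1"
      by (auto simp: eventually_at_right_field intro!: exI[of _ 1])
    then show ?thesis by (rule eventually_compose_filterlim[OF _ filterlim_snd])
  qed
  show *: "v \<bullet> w \<le> H x w" for w
  proof -
    have "Limsup (nhds p \<times>\<^sub>F at_right 0) (\<lambda>(y, s). ereal ((H x (y + s *\<^sub>R w) - H x y) / s)) \<le> ereal (H x w)"
    proof (rule Limsup_bounded)
      show "\<forall>\<^sub>F z in nhds p \<times>\<^sub>F at_right 0. (case z of (y, s) \<Rightarrow> ereal ((H x (y + s *\<^sub>R w) - H x y) / s)) \<le> ereal (H x w)"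
        using s01
      proof eventually_elim
        case (elim z)
        have "H x (fst z + snd z *\<^sub>R w) \<le> H x (fst z) + snd z * H x w"
          using H_add_le[of x "fst z" "snd z *\<^sub>R w"] H_scaleR[of "snd z" x w] elim by simp
        then show ?case using elim by (auto simp: case_prod_beta divide_le_eq algebra_simps)
      qed
    qed
    from order_trans[OF cd this] show ?thesis by simp
  qed
  have "Limsup (nhds p \<times>\<^sub>F at_right 0) (\<lambda>(y, s). ereal ((H x (y + s *\<^sub>R (-p)) - H x y) / s)) \<le>
      Limsup (nhds p \<times>\<^sub>F at_right (0::real)) (\<lambda>z. ereal (H x (fst z - p) - H x (fst z)))"
  proof (rule Limsup_mono)
    show "\<forall>\<^sub>F z in nhds p \<times>\<^sub>F at_right 0. (case z of (y, s) \<Rightarrow> ereal ((H x (y + s *\<^sub>R (-p)) - H x y) / s))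
        \<le> ereal (H x (fst z - p) - H x (fst z))"
      using s01
    proof eventually_elim
      case (elim z)
      have "fst z + snd z *\<^sub>R (-p) = (1 - snd z) *\<^sub>R fst z + snd z *\<^sub>R (fst z - p)" by (simp add: algebra_simps)
      then have "H x (fst z + snd z *\<^sub>R (-p)) \<le> (1 - snd z) * H x (fst z) + snd z * H x (fst z - p)"
        using H_add_le[of x "(1 - snd z) *\<^sub>R fst z" "snd z *\<^sub>R (fst z - p)"]
          H_scaleR[of "snd z" x "fst z - p"] H_scaleR[of "1 - snd z" x "fst z"] elim by simp
      then have "H x (fst z + snd z *\<^sub>R (-p)) - H x (fst z) \<le> (H x (fst z - p) - H x (fst z)) * snd z"
        by (simp add: algebra_simps)
      then show ?case using elim by (simp add: case_prod_beta pos_divide_le_eq)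
    qed
  qed
  also have "\<dots> = ereal (- H x p)"
  proof (rule lim_imp_Limsup)
    have "isCont (H x) q" for q using H_continuous_on[of UNIV x] by (simp add: continuous_on_eq_continuous_at)
    then have t: "(H x \<longlongrightarrow> H x q) (nhds q)" for q
      by (simp add: isCont_def tendsto_nhds_iff)
    have f: "filterlim fst (nhds p) (nhds p \<times>\<^sub>F at_right (0::real))" by (rule filterlim_fst)
    then have "filterlim (\<lambda>z. fst z - p) (nhds (p - p)) (nhds p \<times>\<^sub>F at_right (0::real))"
      by (intro tendsto_intros)
    from tendsto_diff[OF filterlim_compose[OF t this] filterlim_compose[OF t f]]
    have "((\<lambda>z. H x (fst z - p) - H x (fst z)) \<longlongrightarrow> H x (p - p) - H x p) (nhds p \<times>\<^sub>F at_right (0::real))" .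
    then show "((\<lambda>z. ereal (H x (fst z - p) - H x (fst z))) \<longlongrightarrow> ereal (- H x p)) (nhds p \<times>\<^sub>F at_right (0::real))"
      by simp
  qed (auto simp: prod_filter_eq_bot trivial_limit_at_right_real)
  finally have "ereal (v \<bullet> (- p)) \<le> ereal (- H x p)" using cd[of "-p"] order_trans by blast
  then show "v \<bullet> p = H x p" using *[of p] by simp
qed

end

section \<open>Trajectories and the value function\<close>

text \<open>The subgradient is tested along its own direction: the step \<open>k *\<^sub>R q\<close>
  of length \<open>min \<delta> r / 2\<close> gives
  \<open>k * (q \<bullet> q) \<le> (C + e) * (k * norm q)\<close>.\<close>

lemma frechet_subgradient_norm_le:
  assumes q: "q \<in> frechet_subdiff u x" and "r > 0" "C \<ge> 0"
    and u: "\<And>y. y \<in> ball x r \<Longrightarrow> u y \<le> u x + C * norm (y - x)"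
  shows "norm q \<le> C"
proof (rule field_le_epsilon)
  fix e :: real assume "e > 0"
  obtain \<delta> where "\<delta> > 0" and \<delta>: "\<forall>y. dist y x < \<delta> \<longrightarrow> u y - u x - q \<bullet> (y - x) \<ge> - e * norm (y - x)"
    using frechet_subdiffD[OF q \<open>e > 0\<close>] by blast
  show "norm q \<le> C + e"
  proof (cases "q = 0")
    case True
    then show ?thesis using \<open>C \<ge> 0\<close> \<open>e > 0\<close> by simp
  next
    case False
    define k where "k = min \<delta> r / 2 / norm q"
    have "k > 0" using \<open>\<delta> > 0\<close> \<open>r > 0\<close> False by (simp add: k_def)
    have kq: "k * norm q = min \<delta> r / 2" using False by (simp add: k_def)
    have n: "norm (k *\<^sub>R q) = k * norm q" using \<open>k > 0\<close> by simp
    have "u (x + k *\<^sub>R q) - u x - q \<bullet> (k *\<^sub>R q) \<ge> - e * (k * norm q)"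
      using \<delta>[rule_format, of "x + k *\<^sub>R q"] n kq \<open>\<delta> > 0\<close> \<open>r > 0\<close> by (simp add: dist_norm)
    moreover have "u (x + k *\<^sub>R q) \<le> u x + C * (k * norm q)"
      using u[of "x + k *\<^sub>R q"] n kq \<open>\<delta> > 0\<close> \<open>r > 0\<close> by (simp add: dist_norm)
    ultimately have "k * (q \<bullet> q) \<le> (C + e) * (k * norm q)" by (simp add: algebra_simps)
    then have "(k * norm q) * norm q \<le> (k * norm q) * (C + e)"
      by (simp add: dot_square_norm power2_eq_square algebra_simps)
    then show ?thesis using \<open>k > 0\<close> False by simp
  qed
qed

context lipschitz_inclusion
begin

lemma trajectory_ae_deriv:
  assumes "trajectory F T t0 x0 x"
  shows "\<exists>N. negligible N \<and>
    (\<forall>s\<in>{t0..T} - N. \<exists>v\<in>F (x s). (x has_vector_derivative v) (at s within {t0..T}))"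
  using assms unfolding trajectory_def AE_lebesgue_on_Icc_iff by blast

lemma trajectory_lipschitz_on:
  assumes "trajectory F T t0 x0 x" and R: "R \<ge> 0" "\<And>s. s \<in> {t0..T} \<Longrightarrow> norm (x s) \<le> R"
  shows "(\<rho> * (1 + R))-lipschitz_on {t0..T} x"
proof -
  obtain N where N: "negligible N"
    "\<And>s. s \<in> {t0..T} - N \<Longrightarrow> \<exists>v\<in>F (x s). (x has_vector_derivative v) (at s within {t0..T})"
    using trajectory_ae_deriv[OF assms(1)] by blast
  show ?thesis
  proof (rule abs_cont_on_deriv_bound_imp_lipschitz_on[OF _ _ N(1)])
    show "abs_cont_on t0 T x" using assms by (simp add: trajectory_def)
    fix s assume s: "s \<in> {t0..T} - N"
    then obtain v where v: "v \<in> F (x s)" "(x has_vector_derivative v) (at s within {t0..T})" using N by blast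
    have "norm v \<le> \<rho> * (1 + norm (x s))" by (rule growth[OF v(1)])
    also have "\<dots> \<le> \<rho> * (1 + R)" using R(2)[of s] s \<rho>_pos by (intro mult_left_mono) auto
    finally show "\<exists>v. norm v \<le> \<rho> * (1 + R) \<and> (x has_vector_derivative v) (at s within {t0..T})" using v by blast
  qed (use \<rho>_pos R in auto)
qed

lemma trajectory_imp_lipschitz_on:
  assumes "trajectory F T t0 x0 x"
  shows "\<exists>C. C-lipschitz_on {t0..T} x"
proof -
  have "continuous_on {t0..T} x"
    using assms abs_cont_on_imp_continuous_on by (auto simp: trajectory_def)
  then obtain B where "B > 0" "\<And>s. s \<in> {t0..T} \<Longrightarrow> norm (x s) \<le> B"
    using continuous_on_Icc_norm_bound by blast
  then show ?thesis using trajectory_lipschitz_on[OF assms, of B] by auto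
qed

text \<open>Gronwall for one plus the squared norm, which is smooth in the state. With
  \<open>n = norm (x s)\<close>, the rate \<open>4 * \<rho>\<close> comes from
  \<open>2 * \<rho> * (1 + n) * n \<le> 4 * \<rho> * (1 + n * n)\<close>. The bound depends only on
  \<open>\<rho>\<close>, the initial point and the elapsed time, so it confines all competitors at
  once.\<close>

lemma trajectory_norm_le:
  assumes x: "trajectory F T t0 x0 x" and s: "s \<in> {t0..T}"
  shows "1 + x s \<bullet> x s \<le> (1 + x0 \<bullet> x0) * exp (4 * \<rho> * (s - t0))"
proof -
  obtain N where N: "negligible N"
    "\<And>s. s \<in> {t0..T} - N \<Longrightarrow> \<exists>v\<in>F (x s). (x has_vector_derivative v) (at s within {t0..T})"
    using trajectory_ae_deriv[OF x] by blast
  have "\<exists>C. C-lipschitz_on {t0..T} (\<lambda>s. x s \<bullet> x s)"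
    using trajectory_imp_lipschitz_on[OF x] by (intro lipschitz_on_Icc_inner)
  then have l: "\<exists>C. C-lipschitz_on {t0..T} (\<lambda>s. 1 + x s \<bullet> x s)"
    by (simp add: lipschitz_on_def)
  have "1 + x s \<bullet> x s \<le> (1 + x t0 \<bullet> x t0) * exp (4 * \<rho> * (s - t0))"
  proof (rule lipschitz_gronwall[OF l N(1)])
    fix s assume s: "s \<in> {t0..T} - N"
    then obtain v where v: "v \<in> F (x s)" "(x has_vector_derivative v) (at s within {t0..T})" using N by blast
    have "((\<lambda>s. 1 + x s \<bullet> x s) has_vector_derivative (2 * (v \<bullet> x s))) (at s within {t0..T})"
      using v(2) unfolding has_vector_derivative_def
      by (auto intro!: derivative_eq_intros simp: inner_commute algebra_simps)
    moreover have "2 * (v \<bullet> x s) \<le> 4 * \<rho> * (1 + x s \<bullet> x s)"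
    proof -
      define n where "n = norm (x s)"
      have "n \<ge> 0" by (simp add: n_def)
      have "v \<bullet> x s \<le> norm v * n" unfolding n_def by (rule norm_cauchy_schwarz)
      also have "\<dots> \<le> \<rho> * (1 + n) * n" using growth[OF v(1)] by (intro mult_right_mono) (auto simp: n_def)
      also have "\<dots> = \<rho> * (n + n * n)" by (simp add: algebra_simps)
      also have "\<dots> \<le> \<rho> * (2 * (1 + n * n))"
      proof (intro mult_left_mono)
        have "0 \<le> (n - 1) * (n - 1)" by simp
        then show "n + n * n \<le> 2 * (1 + n * n)" using \<open>n \<ge> 0\<close> by (simp add: algebra_simps)
      qed (use \<rho>_pos in auto)
      finally show ?thesis by (simp add: n_def dot_square_norm power2_eq_square algebra_simps)
    qed
    ultimately show "\<exists>d. d \<le> 4 * \<rho> * (1 + x s \<bullet> x s) \<and> ((\<lambda>s. 1 + x s \<bullet> x s) has_vector_derivative d) (at s within {t0..T})"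
      by blast
  qed (use s in auto)
  then show ?thesis using x by (simp add: trajectory_def)
qed

lemma trajectory_if_lipschitz_on:
  assumes "\<exists>C. C-lipschitz_on {t0..T} x" "x t0 = x0" "negligible N"
    "\<And>s. s \<in> {t0..T} - N \<Longrightarrow> \<exists>v\<in>F (x s). (x has_vector_derivative v) (at s within {t0..T})"
  shows "trajectory F T t0 x0 x"
  using assms lipschitz_on_imp_abs_cont_on unfolding trajectory_def AE_lebesgue_on_Icc_iff by blast

text \<open>A real infimum is a lower bound only if the costs are bounded below: the endpoints of
  all competitors lie in one compact ball, on which the continuous \<open>\<phi>\<close> is
  bounded.\<close>

lemma mayer_value_le:
  assumes x: "trajectory F T t0 x0 x" and "t0 \<le> T" and \<phi>: "continuous_on UNIV \<phi>"
  shows "mayer_value F \<phi> T (t0, x0) \<le> \<phi> (x T)"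
proof -
  define B where "B = (1 + x0 \<bullet> x0) * exp (4 * \<rho> * (T - t0))"
  have "bounded (\<phi> ` cball 0 (sqrt B))"
    by (intro compact_imp_bounded compact_continuous_image continuous_on_subset[OF \<phi>]) auto
  then obtain b where "\<forall>y\<in>cball 0 (sqrt B). \<bar>\<phi> y\<bar> \<le> b" by (auto simp: bounded_iff)
  then have b: "\<bar>\<phi> y\<bar> \<le> b" if "norm y \<le> sqrt B" for y using that by auto
  have "- b \<le> \<phi> (y T)" if "trajectory F T t0 x0 y" for y
  proof -
    have "1 + y T \<bullet> y T \<le> B" unfolding B_def by (rule trajectory_norm_le[OF that]) (use \<open>t0 \<le> T\<close> in auto)
    then have "norm (y T) \<le> sqrt B" by (simp add: norm_eq_sqrt_inner)
    then show ?thesis using b[of "y T"] by linarith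
  qed
  then have "bdd_below {\<phi> (x T) |x. trajectory F T t0 x0 x}" by (auto simp: bdd_below_def)
  then have "Inf {\<phi> (x T) |x. trajectory F T t0 x0 x} \<le> \<phi> (x T)" using x by (intro cInf_lower) auto
  then show ?thesis by (simp add: mayer_value_def)
qed

lemma trajectory_restrict:
  assumes x: "trajectory F T t0 x0 x" and t: "t \<in> {t0..T}"
  shows "trajectory F T t (x t) x"
proof -
  obtain N where N: "negligible N"
    "\<And>s. s \<in> {t0..T} - N \<Longrightarrow> \<exists>v\<in>F (x s). (x has_vector_derivative v) (at s within {t0..T})"
    using trajectory_ae_deriv[OF x] by blast
  have "\<exists>C. C-lipschitz_on {t..T} x"
    using trajectory_imp_lipschitz_on[OF x] lipschitz_on_subset[of _ "{t0..T}" x "{t..T}"] t by auto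
  then show ?thesis
  proof (rule trajectory_if_lipschitz_on[OF _ refl N(1)])
    fix s assume s: "s \<in> {t..T} - N"
    then obtain v where v: "v \<in> F (x s)" "(x has_vector_derivative v) (at s within {t0..T})" using N(2)[of s] t by auto
    then show "\<exists>v\<in>F (x s). (x has_vector_derivative v) (at s within {t..T})"
      using has_vector_derivative_within_subset[OF v(2), of "{t..T}"] t by auto
  qed
qed

text \<open>Lipschitz constants combine across the junction, and the junction time itself, where a
  corner may appear, joins the exceptional set.\<close>

lemma trajectory_concat:
  assumes x: "trajectory F T t0 x0 x" and t: "t \<in> {t0..T}" and y: "trajectory F T t (x t) y"
  shows "trajectory F T t0 x0 (\<lambda>s. if s \<le> t then x s else y s)" (is "trajectory F T t0 x0 ?z")
proof -
  obtain N where N: "negligible N"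
    "\<And>s. s \<in> {t0..T} - N \<Longrightarrow> \<exists>v\<in>F (x s). (x has_vector_derivative v) (at s within {t0..T})"
    using trajectory_ae_deriv[OF x] by blast
  obtain N' where N': "negligible N'"
    "\<And>s. s \<in> {t..T} - N' \<Longrightarrow> \<exists>v\<in>F (y s). (y has_vector_derivative v) (at s within {t..T})"
    using trajectory_ae_deriv[OF y] by blast
  obtain C D where C: "C-lipschitz_on {t0..T} x" and D: "D-lipschitz_on {t..T} y"
    using trajectory_imp_lipschitz_on x y by blast
  have yt: "x t = y t" using y by (simp add: trajectory_def)
  have "(max C D)-lipschitz_on {t0..T} ?z"
    by (rule lipschitz_on_concat_max[OF lipschitz_on_subset[OF C] D yt]) (use t in auto)
  moreover have "?z t0 = x0" using t x by (simp add: trajectory_def)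
  moreover have "negligible (N \<union> N' \<union> {t})" using N N' by auto
  ultimately show ?thesis
  proof (intro trajectory_if_lipschitz_on)
    fix s assume s: "s \<in> {t0..T} - (N \<union> N' \<union> {t})"
    show "\<exists>v\<in>F (?z s). (?z has_vector_derivative v) (at s within {t0..T})"
    proof (cases "s < t")
      case True
      obtain v where v: "v \<in> F (x s)" "(x has_vector_derivative v) (at s within {t0..T})" using N(2)[of s] s by auto
      have "(?z has_vector_derivative v) (at s within {t0..T})"
        by (rule has_vector_derivative_transform_within[OF v(2), of "t - s"]) (use True s in \<open>auto simp: dist_real_def\<close>)
      then show ?thesis using v True by auto
    next
      case False
      then have "s > t" using s by auto
      obtain v where v: "v \<in> F (y s)" "(y has_vector_derivative v) (at s within {t..T})"
        using N'(2)[of s] s \<open>s > t\<close> by auto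
      have "at s within {t..T} = at s within {t0..T}"
        by (rule at_within_nhd[of s "{t<..}"]) (use \<open>s > t\<close> t in auto)
      then have "(y has_vector_derivative v) (at s within {t0..T})" using v by simp
      then have "(?z has_vector_derivative v) (at s within {t0..T})"
        by (rule has_vector_derivative_transform_within[of _ _ _ _ "s - t"]) (use \<open>s > t\<close> s in \<open>auto simp: dist_real_def\<close>)
      then show ?thesis using v \<open>s > t\<close> by auto
    qed
  qed blast+
qed

text \<open>One half of the principle of optimality: a competitor issued from \<open>x t\<close>,
  preceded by \<open>x\<close>, is a competitor issued from \<open>x0\<close>, so it costs no less
  than \<open>x\<close>.\<close>

lemma mayer_optimal_value_ge:
  assumes x: "mayer_optimal F \<phi> T t0 x0 x" and t: "t \<in> {t0..T}" and \<phi>: "continuous_on UNIV \<phi>"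
  shows "\<phi> (x T) \<le> mayer_value F \<phi> T (t, x t)"
proof -
  have xt: "trajectory F T t0 x0 x" and opt: "\<phi> (x T) = mayer_value F \<phi> T (t0, x0)"
    using x by (auto simp: mayer_optimal_def)
  have "\<phi> (x T) \<le> \<phi> (y T)" if y: "trajectory F T t (x t) y" for y
  proof -
    have "x t = y t" using y by (simp add: trajectory_def)
    \<comment> \<open>For \<open>t = T\<close> the spliced curve ends with the value of
      \<open>x\<close>, which agrees with that of \<open>y\<close> at this time.\<close>
    then have "(if T \<le> t then x T else y T) = y T" using t by auto
    then show ?thesis
      using mayer_value_le[OF trajectory_concat[OF xt t y] _ \<phi>] opt t by simp
  qed
  then have "\<phi> (x T) \<le> Inf {\<phi> (y T) |y. trajectory F T t (x t) y}"
    using trajectory_restrict[OF xt t] by (intro cInf_greatest) auto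
  then show ?thesis by (simp add: mayer_value_def)
qed

end

section \<open>Nearby trajectories\<close>

context lipschitz_inclusion
begin

lemma closest_point_F_le:
  assumes "w \<in> F x" "norm (v - w) \<le> c"
  shows "norm (closest_point (F x) v - v) \<le> c"
  using closest_point_le[OF closed assms(1), of v] assms(2) by (simp add: dist_norm norm_minus_commute)

text \<open>The time averages of the reference velocity over \<open>{s-h..s}\<close> are continuous in \<open>s\<close> and nearly
  admissible by convexity; they start the Filippov iteration.\<close>

lemma perturbed_trajectory:
  assumes R: "R > 0" and xR: "\<And>s. s \<in> {t0..T} \<Longrightarrow> norm (x s) \<le> R"
    and x: "trajectory F T t0 x0 x" and t': "t0 < t'" "t' \<le> T"
  shows "\<exists>C>0. \<exists>r0>0. \<forall>\<tau>\<in>{t'..T}. \<forall>y r. 0 < r \<longrightarrow> r \<le> r0 \<longrightarrow> norm (y - x \<tau>) \<le> r \<longrightarrow>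
    (\<exists>z v. continuous_on {\<tau>..T} v \<and> z \<tau> = y \<and>
      (\<forall>s\<in>{\<tau>..T}. (z has_vector_derivative v s) (at s within {\<tau>..T}) \<and> v s \<in> F (z s) \<and>
         norm (z s - x s) \<le> C * r \<and> norm (z s) \<le> R + 1))"
proof -
  \<comment> \<open>All Lipschitz bounds live on this ball. Composing \<open>F\<close> with the
    projection \<open>\<pi>\<close> onto it makes them global for the iteration;
    \<open>\<pi>\<close> drops out at the end because the solution stays within distance
    \<open>1\<close> of \<open>x\<close>.\<close>
  define K where "K = cball (0::'a) (R + 1)"
  have K: "compact K" "closed K" "convex K" "K \<noteq> {}" "bounded K" using R by (auto simp: K_def)
  have xK: "x s \<in> K" if "s \<in> {t0..T}" for s using xR[OF that] by (simp add: K_def)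
  define \<pi> where "\<pi> = closest_point K"
  have \<pi>K: "\<pi> u \<in> K" for u unfolding \<pi>_def by (rule closest_point_in_set[OF K(2,4)])
  have \<pi>lip: "norm (\<pi> u - \<pi> w) \<le> norm (u - w)" for u w
    using closest_point_lipschitz[OF K(3,2,4), of u w] by (simp add: \<pi>_def dist_norm)
  have \<pi>id: "\<pi> u = u" if "u \<in> K" for u using that by (simp add: \<pi>_def closest_point_self)
  have \<pi>c: "continuous_on S (\<lambda>s. \<pi> (f s))" if "continuous_on S f" for S f
    by (rule continuous_on_compose2[OF continuous_on_closest_point[OF K(3,2,4), of UNIV, folded \<pi>_def] that]) auto
  obtain L where L: "L > 0" and HL: "\<And>x y p. x \<in> K \<Longrightarrow> y \<in> K \<Longrightarrow> H x p \<le> H y p + L * norm (x - y) * norm p"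
    using H_lipschitz_compact[OF K(1)] by blast
  have FL: "\<exists>w\<in>F y. norm (v - w) \<le> L * norm (x - y)" if "x \<in> K" "y \<in> K" "v \<in> F x" for x y v
    using F_lipschitz_if_H_lipschitz[of L x y v] HL[OF that(1,2)] L that(3) by (metis less_imp_le)
  define M where "M = \<rho> * (1 + R)"
  have M: "M > 0" using R \<rho>_pos by (simp add: M_def)
  have xM: "M-lipschitz_on {t0..T} x" unfolding M_def by (rule trajectory_lipschitz_on[OF x]) (use R xR in auto)
  have xMd: "norm (x s - x u) \<le> M * \<bar>s - u\<bar>" if "s \<in> {t0..T}" "u \<in> {t0..T}" for s u
    using lipschitz_onD[OF xM that] by (simp add: dist_norm)
  have xc: "continuous_on {t0..T} x" using xM by (rule lipschitz_on_continuous_on)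
  obtain N where N: "negligible N"
    and xN: "\<forall>s\<in>{t0..T} - N. \<exists>v\<in>F (x s). (x has_vector_derivative v) (at s within {t0..T})"
    using trajectory_ae_deriv[OF x] by blast
  define E where "E = exp (2 * L * (T - t0)) / L"
  have E: "E > 0" using L by (simp add: E_def)
  \<comment> \<open>Per unit of \<open>r\<close>, the starting curve has defect
    \<open>L * (1 + 3 * M)\<close> and distance \<open>1 + 2 * M\<close> from \<open>x\<close>; the
    iteration amplifies the defect by at most \<open>E\<close>.\<close>
  define C where "C = L * (1 + 3 * M) * E + (1 + 2 * M)"
  have C: "C > 0" unfolding C_def using L M E by (auto intro!: add_pos_pos)
  \<comment> \<open>\<open>t' - t0\<close> keeps the window \<open>{s - r..s}\<close> inside
    \<open>{t0..T}\<close>; \<open>1 / C\<close> keeps the solution in the ball of radius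
    \<open>R + 1\<close>.\<close>
  define r0 where "r0 = min (t' - t0) (1 / C)"
  have r0: "r0 > 0" "r0 \<le> t' - t0" "C * r0 \<le> 1" using C t' by (auto simp: r0_def min_def field_simps)
  have "\<exists>z v. continuous_on {\<tau>..T} v \<and> z \<tau> = y \<and>
      (\<forall>s\<in>{\<tau>..T}. (z has_vector_derivative v s) (at s within {\<tau>..T}) \<and> v s \<in> F (z s) \<and>
         norm (z s - x s) \<le> C * r \<and> norm (z s) \<le> R + 1)"
    if \<tau>: "\<tau> \<in> {t'..T}" and r: "0 < r" "r \<le> r0" and y: "norm (y - x \<tau>) \<le> r" for \<tau> y r
  proof -
    have rt: "t0 \<le> \<tau> - r" "t0 \<le> \<tau>" "\<tau> \<le> T" using \<tau> r r0 t' by auto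
    have sub: "s - r \<in> {t0..T}" "s \<in> {t0..T}" "{s - r..s} \<subseteq> {t0..T}" if "s \<in> {\<tau>..T}" for s using that rt r by auto
    define W where "W = (\<lambda>s. integral {t0..s} x)"
    have W: "(W has_vector_derivative x s) (at s within {t0..T})" if "s \<in> {t0..T}" for s
      unfolding W_def by (rule integral_has_vector_derivative[OF xc that])
    \<comment> \<open>\<open>w\<close> is the mean of \<open>x\<close> over a window as long as the
      perturbation size \<open>r\<close>, so smoothing displaces the curve by the order of
      \<open>r\<close> only. Its derivative \<open>v0\<close> is a difference quotient of
      \<open>x\<close>, hence continuous.\<close>
    define w where "w = (\<lambda>s. (1 / r) *\<^sub>R (W s - W (s - r)))"
    define v0 where "v0 = (\<lambda>s. (1 / r) *\<^sub>R (x s - x (s - r)))"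
    have w': "(w has_vector_derivative v0 s) (at s within {\<tau>..T})" if s: "s \<in> {\<tau>..T}" for s
    proof -
      have "(W has_vector_derivative x s) (at s within {\<tau>..T})"
        by (rule has_vector_derivative_within_subset[OF W]) (use sub[OF s] rt in auto)
      moreover have "((\<lambda>s. W (s - r)) has_vector_derivative x (s - r)) (at s within {\<tau>..T})"
      proof -
        have "((\<lambda>s. s - r) has_derivative (\<lambda>h. h)) (at s within {\<tau>..T})"
          by (auto intro!: derivative_eq_intros)
        moreover have "(W has_derivative (\<lambda>h. h *\<^sub>R x (s - r))) (at (s - r) within (\<lambda>s. s - r) ` {\<tau>..T})"
          using has_vector_derivative_within_subset[OF W[OF sub(1)[OF s]], of "(\<lambda>s. s - r) ` {\<tau>..T}"] sub(1)
          unfolding has_vector_derivative_def by blast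
        ultimately show ?thesis
          unfolding has_vector_derivative_def by (rule has_derivative_in_compose)
      qed
      ultimately have "((\<lambda>s. W s - W (s - r)) has_vector_derivative (x s - x (s - r))) (at s within {\<tau>..T})"
        by (rule has_vector_derivative_diff)
      then show ?thesis unfolding w_def v0_def
        by (rule bounded_linear.has_vector_derivative[OF bounded_linear_scaleR_right])
    qed
    have wx: "norm (w s - x s) \<le> M * r" if s: "s \<in> {\<tau>..T}" for s
    proof -
      have ix: "x integrable_on {t0..s}" "x integrable_on {s - r..s}"
        using sub[OF s] by (auto intro!: integrable_continuous_real intro: continuous_on_subset[OF xc])
      have "W (s - r) + integral {s - r..s} x = W s" unfolding W_def
        by (rule Henstock_Kurzweil_Integration.integral_combine) (use sub[OF s] r ix in auto)
      then have "W s - W (s - r) - r *\<^sub>R x s = integral {s - r..s} (\<lambda>u. x u - x s)"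
        using r by (simp add: integral_diff[OF ix(2) integrable_const_ivl] algebra_simps)
      moreover have "norm (integral {s - r..s} (\<lambda>u. x u - x s)) \<le> (M * r) * (s - (s - r))"
      proof (rule integral_bound)
        show "continuous_on {s - r..s} (\<lambda>u. x u - x s)"
          by (intro continuous_intros continuous_on_subset[OF xc] sub s)
        fix u assume u: "u \<in> {s - r..s}"
        have "norm (x u - x s) \<le> M * \<bar>u - s\<bar>" using u sub[OF s] by (intro xMd) auto
        also have "\<dots> \<le> M * r" using u M by (intro mult_left_mono) auto
        finally show "norm (x u - x s) \<le> M * r" .
      qed (use r in auto)
      ultimately have "norm (W s - W (s - r) - r *\<^sub>R x s) \<le> r * (M * r)" by (simp add: mult.commute)
      moreover have "w s - x s = (1 / r) *\<^sub>R (W s - W (s - r) - r *\<^sub>R x s)"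
        using r by (simp add: w_def scaleR_diff_right)
      ultimately show ?thesis using r by (simp add: divide_le_eq mult.commute)
    qed
    define z0 where "z0 = (\<lambda>s. y + (w s - w \<tau>))"
    have z0': "(z0 has_vector_derivative v0 s) (at s within {\<tau>..T})" if "s \<in> {\<tau>..T}" for s
      using w'[OF that] unfolding z0_def has_vector_derivative_def by (auto intro!: derivative_eq_intros)
    have z0x: "norm (z0 s - x s) \<le> (1 + 2 * M) * r" if s: "s \<in> {\<tau>..T}" for s
    proof -
      have "z0 s - x s = (y - x \<tau>) + (w s - x s) - (w \<tau> - x \<tau>)" by (simp add: z0_def)
      also have "norm \<dots> \<le> norm (y - x \<tau>) + norm (w s - x s) + norm (w \<tau> - x \<tau>)"
        by (meson add_mono norm_triangle_ineq norm_triangle_ineq4 order_refl order_trans)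
      also have "\<dots> \<le> r + M * r + M * r" using y wx[OF s] wx[of \<tau>] rt by (intro add_mono) auto
      finally show ?thesis by (simp add: algebra_simps)
    qed
    have v0c: "continuous_on {\<tau>..T} v0" unfolding v0_def
      by (intro continuous_intros continuous_on_compose2[OF xc]) (use sub r in auto)
    \<comment> \<open>Averaging is done on support functions: for every \<open>p\<close> the slope
      of \<open>x u \<bullet> p\<close> on the window is at most
      \<open>H (x s) p + L * M * r * norm p\<close>, so \<open>v0 s\<close> obeys the same bound,
      and separation returns a point of the convex set \<open>F (x s)\<close>.\<close>
    have v0F: "\<exists>u\<in>F (x s). norm (v0 s - u) \<le> L * M * r" if s: "s \<in> {\<tau>..T}" for s
    proof -
      have "v0 s \<bullet> p \<le> H (x s) p + L * M * r * norm p" for p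
      proof -
        have lip: "\<exists>C. C-lipschitz_on {s - r..s} (\<lambda>u. x u \<bullet> p)"
        proof (rule lipschitz_on_Icc_inner)
          show "\<exists>C. C-lipschitz_on {s - r..s} x" using lipschitz_on_subset[OF xM sub(3)[OF s]] by blast
          show "\<exists>C. C-lipschitz_on {s - r..s} (\<lambda>_. p)" by (auto simp: lipschitz_on_def)
        qed
        have "x s \<bullet> p \<le> x (s - r) \<bullet> p + (H (x s) p + L * M * r * norm p) * (s - (s - r))"
        proof (rule lipschitz_deriv_bound_imp_le[OF lip _ N])
          fix u assume u: "u \<in> {s - r..s} - N"
          then have u': "u \<in> {t0..T}" using sub[OF s] by auto
          then obtain v where v: "v \<in> F (x u)" "(x has_vector_derivative v) (at u within {t0..T})" using xN u by blast
          have "v \<bullet> p \<le> H (x u) p" by (rule inner_le_H[OF v(1)])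
          also have "\<dots> \<le> H (x s) p + L * norm (x u - x s) * norm p" by (intro HL xK u' sub s)
          also have "\<dots> \<le> H (x s) p + L * (M * r) * norm p"
          proof -
            have "norm (x u - x s) \<le> M * \<bar>u - s\<bar>" by (intro xMd u' sub s)
            also have "\<dots> \<le> M * r" using u M by (intro mult_left_mono) auto
            finally show ?thesis using L by (intro add_left_mono mult_right_mono mult_left_mono) auto
          qed
          finally have "v \<bullet> p \<le> H (x s) p + L * M * r * norm p" by (simp add: mult.assoc)
          moreover have "((\<lambda>u. x u \<bullet> p) has_vector_derivative v \<bullet> p) (at u within {s - r..s})"
            using has_vector_derivative_within_subset[OF v(2) sub(3)[OF s]]
            unfolding has_vector_derivative_def by (auto intro!: derivative_eq_intros)
          ultimately show "\<exists>d\<le>H (x s) p + L * M * r * norm p. ((\<lambda>u. x u \<bullet> p) has_vector_derivative d) (at u within {s - r..s})"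
            by blast
        qed (use r in auto)
        then show ?thesis using r by (simp add: v0_def inner_diff_left divide_le_eq algebra_simps)
      qed
      then show ?thesis
        using approx_mem_if_inner_le[of "L * M * r" "v0 s" "x s"] L M r by (metis less_imp_le mult_pos_pos)
    qed
    \<comment> \<open>The defect is \<open>L * M * r\<close> from averaging plus
      \<open>L * (1 + 2 * M) * r\<close> from moving the base point from \<open>x s\<close> to
      \<open>\<pi> (z0 s)\<close>.\<close>
    have init: "norm (closest_point (F (\<pi> (z0 s))) (v0 s) - v0 s) \<le> L * (1 + 3 * M) * r" if s: "s \<in> {\<tau>..T}" for s
    proof -
      obtain u where u: "u \<in> F (x s)" "norm (v0 s - u) \<le> L * M * r" using v0F[OF s] by blast
      obtain u' where u': "u' \<in> F (\<pi> (z0 s))" "norm (u - u') \<le> L * norm (x s - \<pi> (z0 s))"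
        using FL[OF xK[OF sub(2)[OF s]] \<pi>K u(1)] by blast
      have "norm (x s - \<pi> (z0 s)) \<le> (1 + 2 * M) * r"
        using \<pi>lip[of "x s" "z0 s"] \<pi>id[OF xK[OF sub(2)[OF s]]] z0x[OF s] by (simp add: norm_minus_commute)
      then have "L * norm (x s - \<pi> (z0 s)) \<le> L * ((1 + 2 * M) * r)" using L by (intro mult_left_mono) auto
      then have "norm (v0 s - u') \<le> L * M * r + L * ((1 + 2 * M) * r)"
        using u(2) u'(2) norm_triangle_ineq[of "v0 s - u" "u - u'"] by simp
      also have "\<dots> = L * (1 + 3 * M) * r" by (simp add: algebra_simps)
      finally show ?thesis by (rule closest_point_F_le[OF u'(1)])
    qed
    have "\<exists>z v. continuous_on {\<tau>..T} v \<and> z \<tau> = z0 \<tau> \<and>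
     (\<forall>s\<in>{\<tau>..T}. (z has_vector_derivative v s) (at s within {\<tau>..T}) \<and> v s \<in> F (\<pi> (z s)) \<and>
        norm (z s - z0 s) \<le> (L * (1 + 3 * M) * r) * (exp (2 * L * (T - \<tau>)) / L))"
    proof (rule filippov_continuous[OF L, where P = "\<lambda>s u. closest_point (F (\<pi> u))"])
      show "closest_point (F (\<pi> u)) v \<in> F (\<pi> u)" for u v by (rule closest_point_in_set[OF closed nonempty])
      show "norm (closest_point (F (\<pi> u)) v - v) \<le> L * norm (u - y)" if vy: "v \<in> F (\<pi> y)" for u y v
      proof -
        obtain w where w: "w \<in> F (\<pi> u)" "norm (v - w) \<le> L * norm (\<pi> y - \<pi> u)" using FL[OF \<pi>K \<pi>K vy] by blast
        have "L * norm (\<pi> y - \<pi> u) \<le> L * norm (u - y)"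
          using L \<pi>lip[of y u] by (simp add: norm_minus_commute)
        then show ?thesis using w by (intro closest_point_F_le[OF w(1)]) auto
      qed
      show "continuous_on {\<tau>..T} (\<lambda>s. closest_point (F (\<pi> (u s))) (v s))"
        if "continuous_on {\<tau>..T} u" "continuous_on {\<tau>..T} v" for u v
        by (rule continuous_on_closest_point_F[OF \<pi>c[OF that(1)] \<pi>K K(5) that(2)])
    qed (use closed v0c z0' init in auto)
    then obtain z v where v: "continuous_on {\<tau>..T} v" and z\<tau>: "z \<tau> = z0 \<tau>"
      and z: "\<And>s. s \<in> {\<tau>..T} \<Longrightarrow> (z has_vector_derivative v s) (at s within {\<tau>..T})"
      and vF: "\<And>s. s \<in> {\<tau>..T} \<Longrightarrow> v s \<in> F (\<pi> (z s))"
      and zz0: "\<And>s. s \<in> {\<tau>..T} \<Longrightarrow> norm (z s - z0 s) \<le> (L * (1 + 3 * M) * r) * (exp (2 * L * (T - \<tau>)) / L)"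
      by blast
    have zx: "norm (z s - x s) \<le> C * r" if s: "s \<in> {\<tau>..T}" for s
    proof -
      have "exp (2 * L * (T - \<tau>)) / L \<le> E" unfolding E_def using L rt by (intro divide_right_mono) auto
      then have "(L * (1 + 3 * M) * r) * (exp (2 * L * (T - \<tau>)) / L) \<le> (L * (1 + 3 * M) * r) * E"
        using L M r by (intro mult_left_mono) auto
      then have "norm (z s - x s) \<le> (L * (1 + 3 * M) * r) * E + (1 + 2 * M) * r"
        using zz0[OF s] z0x[OF s] norm_triangle_ineq[of "z s - z0 s" "z0 s - x s"] by simp
      then show ?thesis by (simp add: C_def algebra_simps)
    qed
    have zR: "norm (z s) \<le> R + 1" if s: "s \<in> {\<tau>..T}" for s
    proof -
      have "C * r \<le> C * r0" using r C by (intro mult_left_mono) auto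
      then have "norm (z s - x s) \<le> 1" using zx[OF s] r0 by linarith
      then show ?thesis using xR[OF sub(2)[OF s]] norm_triangle_ineq[of "z s - x s" "x s"] by simp
    qed
    have "z \<tau> = y" using z\<tau> by (simp add: z0_def)
    moreover have "v s \<in> F (z s)" if "s \<in> {\<tau>..T}" for s using vF[OF that] \<pi>id[of "z s"] zR[OF that] by (simp add: K_def)
    ultimately show ?thesis using v z zx zR by blast
  qed
  then show ?thesis using C r0(1) by blast
qed

text \<open>As a function of \<open>q\<close>, \<open>H x q - v \<bullet> q\<close> is nonnegative
  and vanishes at \<open>p\<close>, so its derivative there is zero. Differentiability of
  \<open>H\<close> thus leaves a single maximising velocity.\<close>

lemma gderiv_H_unique_maximizer:
  assumes G: "GDERIV (H x) p :> G" and v: "v \<in> F x" "v \<bullet> p = H x p"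
  shows "v = G"
proof -
  have "(H x has_derivative (\<lambda>h. h \<bullet> G)) (at p)" using G by (simp add: gderiv_def)
  then have d: "((\<lambda>q. H x q - v \<bullet> q) has_derivative (\<lambda>h. h \<bullet> G - v \<bullet> h)) (at p)"
    by (auto intro!: derivative_eq_intros)
  have "(\<lambda>h. h \<bullet> G - v \<bullet> h) = (\<lambda>h. 0)"
    by (rule has_derivative_local_min[OF d]) (use v inner_le_H[OF v(1)] in \<open>auto intro!: always_eventually\<close>)
  then have "(G - v) \<bullet> G - v \<bullet> (G - v) = 0" by meson
  then have "(G - v) \<bullet> (G - v) = 0" by (simp add: inner_diff_left inner_diff_right inner_commute)
  then show ?thesis by simp
qed

lemma gderiv_H_mem:
  assumes G: "GDERIV (H x) p :> G"
  shows "G \<in> F x" "G \<bullet> p = H x p"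
proof -
  obtain v where v: "v \<in> F x" "v \<bullet> p = H x p" using H_attained .
  then have "v = G" by (rule gderiv_H_unique_maximizer[OF G])
  then show "G \<in> F x" "G \<bullet> p = H x p" using v by auto
qed

text \<open>The Lipschitz hypothesis controls the gradient in the state only. Joint continuity in
  state and costate holds because the gradient is the unique maximiser of the pairing.\<close>

lemma gderiv_H_continuous_on:
  fixes f p :: "'b::euclidean_space \<Rightarrow> 'a"
  assumes f: "continuous_on S f" "\<And>s. s \<in> S \<Longrightarrow> f s \<in> K" "bounded K" and p: "continuous_on S p"
    and G: "\<And>s. s \<in> S \<Longrightarrow> GDERIV (H (f s)) (p s) :> G (f s) (p s)"
  shows "continuous_on S (\<lambda>s. G (f s) (p s))"
proof (rule continuous_on_selection[OF f, where \<psi> = "\<lambda>s c. H (f s) (p s) - c \<bullet> p s"])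
  have "continuous_on (S \<times> UNIV) (\<lambda>z. f (fst z))" "continuous_on (S \<times> UNIV) (\<lambda>z. p (fst z))"
    by (auto intro!: continuous_on_compose2[OF f(1)] continuous_on_compose2[OF p] continuous_intros)
  then show "continuous_on (S \<times> UNIV) (\<lambda>z. H (f (fst z)) (p (fst z)) - snd z \<bullet> p (fst z))"
    by (intro continuous_on_diff H_continuous_on2 continuous_intros)
next
  fix s c assume s: "s \<in> S" and c: "c \<in> F (f s)" "H (f s) (p s) - c \<bullet> p s \<le> 0"
  then have "c \<bullet> p s = H (f s) (p s)" using inner_le_H[OF c(1), of "p s"] by simp
  then show "c = G (f s) (p s)" by (rule gderiv_H_unique_maximizer[OF G[OF s] c(1)])
qed (use gderiv_H_mem[OF G] in auto)

text \<open>Same patching of local constants as for \<open>H\<close>, with the costates in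
  \<open>P\<close> as parameter; the continuity in the parameter that it requires is that of the
  unique maximiser.\<close>

lemma gderiv_H_lipschitz_on:
  assumes K: "compact K" and P: "compact P"
    and G: "\<And>x p. x \<in> K \<Longrightarrow> p \<in> P \<Longrightarrow> GDERIV (H x) p :> G x p"
    and loc: "\<forall>x\<in>K. \<exists>r>0. \<exists>L. \<forall>p\<in>P. L-lipschitz_on (ball x r \<inter> K) (\<lambda>y. G y p)"
  shows "\<exists>L>0. \<forall>p\<in>P. \<forall>x\<in>K. \<forall>y\<in>K. norm (G x p - G y p) \<le> L * norm (x - y)"
proof -
  have "local_lipschitz P K (\<lambda>p x. G x p)"
  proof (rule local_lipschitzI)
    fix t x assume "x \<in> K"
    then obtain r L where "r > 0" and L: "\<forall>p\<in>P. L-lipschitz_on (ball x r \<inter> K) (\<lambda>y. G y p)" using loc by blast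
    have "L-lipschitz_on (cball x (r/2) \<inter> K) (\<lambda>y. G y p)" if "p \<in> P" for p
      by (rule lipschitz_on_subset[of L "ball x r \<inter> K"]) (use L that \<open>r > 0\<close> in auto)
    then show "\<exists>u>0. \<exists>L. \<forall>t\<in>cball t u \<inter> P. L-lipschitz_on (cball x u \<inter> K) (\<lambda>x. G x t)"
      using \<open>r > 0\<close> by (intro exI[of _ "r/2"] conjI exI[of _ L]) auto
  qed
  moreover have "continuous_on P (\<lambda>p. G x p)" if "x \<in> K" for x
    by (rule gderiv_H_continuous_on[of P "\<lambda>_. x" K "\<lambda>p. p"])
      (use that G compact_imp_bounded[OF K] in \<open>auto intro: continuous_intros\<close>)
  ultimately obtain L where L: "\<And>p. p \<in> P \<Longrightarrow> L-lipschitz_on K (\<lambda>x. G x p)"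
    using local_lipschitz_compact_implies_lipschitz[OF _ K P, of "\<lambda>p x. G x p"] by blast
  have "norm (G x p - G y p) \<le> (\<bar>L\<bar> + 1) * norm (x - y)" if "p \<in> P" "x \<in> K" "y \<in> K" for x y p
  proof -
    have "norm (G x p - G y p) \<le> L * norm (x - y)" using lipschitz_onD[OF L that(2,3)] that by (simp add: dist_norm)
    also have "\<dots> \<le> (\<bar>L\<bar> + 1) * norm (x - y)" by (intro mult_right_mono) auto
    finally show ?thesis .
  qed
  then show ?thesis by (intro exI[of _ "\<bar>L\<bar> + 1"]) auto
qed

text \<open>A continuous costate without zeros has a compact image away from \<open>0\<close>, so
  \<open>G\<close> is uniformly Lipschitz in the state along \<open>p\<close>. The velocity sets are
  singletons and the Filippov iteration becomes Picard's, started at the translate of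
  \<open>x\<close> through \<open>y\<close>. With no averaging window, all starting times in
  \<open>{t0..T}\<close> are available.\<close>

lemma perturbed_extremal:
  assumes R: "R > 0" and xR: "\<And>s. s \<in> {t0..T} \<Longrightarrow> norm (x s) \<le> R"
    and x: "trajectory F T t0 x0 x" and p: "continuous_on {t0..T} p" "\<And>s. s \<in> {t0..T} \<Longrightarrow> p s \<noteq> 0"
    and N: "negligible N"
    and max: "\<And>s. s \<in> {t0..T} - N \<Longrightarrow> \<exists>v\<in>F (x s). (x has_vector_derivative v) (at s within {t0..T}) \<and> v \<bullet> p s = H (x s) (p s)"
    and G: "\<And>x p. norm x \<le> R + 1 \<Longrightarrow> p \<noteq> 0 \<Longrightarrow> GDERIV (H x) p :> G x p"
    and Gloc: "\<And>P. compact P \<Longrightarrow> P \<subseteq> - {0} \<Longrightarrow>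
        \<forall>x\<in>cball 0 (R + 1). \<exists>r>0. \<exists>L. \<forall>p\<in>P. L-lipschitz_on (ball x r \<inter> cball 0 (R + 1)) (\<lambda>y. G y p)"
  shows "\<exists>C>0. \<exists>r0>0. \<forall>\<tau>\<in>{t0..T}. \<forall>y r. 0 < r \<longrightarrow> r \<le> r0 \<longrightarrow> norm (y - x \<tau>) \<le> r \<longrightarrow>
    (\<exists>z v. continuous_on {\<tau>..T} v \<and> z \<tau> = y \<and>
      (\<forall>s\<in>{\<tau>..T}. (z has_vector_derivative v s) (at s within {\<tau>..T}) \<and> v s \<in> F (z s) \<and>
         v s \<bullet> p s = H (z s) (p s) \<and> norm (z s - x s) \<le> C * r \<and> norm (z s) \<le> R + 1))"
proof -
  define K where "K = cball (0::'a) (R + 1)"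
  have K: "compact K" "closed K" "convex K" "K \<noteq> {}" "bounded K" using R by (auto simp: K_def)
  have xK: "x s \<in> K" if "s \<in> {t0..T}" for s using xR[OF that] by (simp add: K_def)
  define \<pi> where "\<pi> = closest_point K"
  have \<pi>K: "\<pi> u \<in> K" for u unfolding \<pi>_def by (rule closest_point_in_set[OF K(2,4)])
  have \<pi>lip: "norm (\<pi> u - \<pi> w) \<le> norm (u - w)" for u w
    using closest_point_lipschitz[OF K(3,2,4), of u w] by (simp add: \<pi>_def dist_norm)
  have \<pi>id: "\<pi> u = u" if "u \<in> K" for u using that by (simp add: \<pi>_def closest_point_self)
  have \<pi>c: "continuous_on S (\<lambda>s. \<pi> (f s))" if "continuous_on S f" for S f
    by (rule continuous_on_compose2[OF continuous_on_closest_point[OF K(3,2,4), of UNIV, folded \<pi>_def] that]) auto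
  have GK: "GDERIV (H u) (p s) :> G u (p s)" if "u \<in> K" "s \<in> {t0..T}" for u s
    using G p that by (simp add: K_def)
  have "\<exists>L>0. \<forall>q\<in>p ` {t0..T}. \<forall>x\<in>K. \<forall>y\<in>K. norm (G x q - G y q) \<le> L * norm (x - y)"
  proof (rule gderiv_H_lipschitz_on[OF K(1)])
    show "compact (p ` {t0..T})" by (rule compact_continuous_image[OF p(1)]) simp
    then show "\<forall>x\<in>K. \<exists>r>0. \<exists>L. \<forall>q\<in>p ` {t0..T}. L-lipschitz_on (ball x r \<inter> K) (\<lambda>y. G y q)"
      unfolding K_def by (rule Gloc) (use p in auto)
  qed (use GK in auto)
  then obtain L where L: "L > 0"
    and GL: "\<And>s u w. s \<in> {t0..T} \<Longrightarrow> u \<in> K \<Longrightarrow> w \<in> K \<Longrightarrow> norm (G u (p s) - G w (p s)) \<le> L * norm (u - w)"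
    by blast
  have xlip: "\<exists>C. C-lipschitz_on {t0..T} x" by (rule trajectory_imp_lipschitz_on[OF x])
  then have xc: "continuous_on {t0..T} x" using lipschitz_on_continuous_on by blast
  have Gc: "continuous_on S (\<lambda>s. G (f s) (p s))" if "continuous_on S f" "S \<subseteq> {t0..T}" "\<And>s. s \<in> S \<Longrightarrow> f s \<in> K" for S f
    by (rule gderiv_H_continuous_on[OF that(1,3) K(5) continuous_on_subset[OF p(1) that(2)]]) (use that GK in auto)
  \<comment> \<open>Maximality gives the gradient equation almost everywhere; its right-hand side is
    continuous along \<open>x\<close>, so it holds everywhere and can serve as the continuous
    starting velocity.\<close>
  have x': "(x has_vector_derivative G (x s) (p s)) (at s within {t0..T})" if "s \<in> {t0..T}" for s
  proof (rule lipschitz_ae_deriv_imp_C1[OF xlip N _ _ that])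
    show "continuous_on {t0..T} (\<lambda>s. G (x s) (p s))" by (rule Gc[OF xc]) (use xK in auto)
    fix s assume s: "s \<in> {t0..T} - N"
    then obtain v where v: "v \<in> F (x s)" "(x has_vector_derivative v) (at s within {t0..T})" "v \<bullet> p s = H (x s) (p s)"
      using max by blast
    moreover have "v = G (x s) (p s)" by (rule gderiv_H_unique_maximizer[OF GK v(1,3)]) (use s xK in auto)
    ultimately show "(x has_vector_derivative G (x s) (p s)) (at s within {t0..T})" by simp
  qed
  define E where "E = exp (2 * L * (T - t0)) / L"
  have E: "E > 0" using L by (simp add: E_def)
  \<comment> \<open>The translate lies within \<open>r\<close> of \<open>x\<close> and has defect at
    most \<open>L * r\<close>, which the iteration amplifies by at most \<open>E\<close>.\<close>
  define C where "C = L * E + 1"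
  have C: "C > 0" unfolding C_def using L E by (auto intro!: add_pos_pos)
  have "\<exists>z v. continuous_on {\<tau>..T} v \<and> z \<tau> = y \<and>
      (\<forall>s\<in>{\<tau>..T}. (z has_vector_derivative v s) (at s within {\<tau>..T}) \<and> v s \<in> F (z s) \<and>
         v s \<bullet> p s = H (z s) (p s) \<and> norm (z s - x s) \<le> C * r \<and> norm (z s) \<le> R + 1)"
    if \<tau>: "\<tau> \<in> {t0..T}" and r: "0 < r" "r \<le> 1 / C" and y: "norm (y - x \<tau>) \<le> r" for \<tau> y r
  proof -
    have sub: "s \<in> {t0..T}" if "s \<in> {\<tau>..T}" for s using that \<tau> by auto
    define z0 where "z0 = (\<lambda>s. y + (x s - x \<tau>))"
    define v0 where "v0 = (\<lambda>s. G (x s) (p s))"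
    have z0': "(z0 has_vector_derivative v0 s) (at s within {\<tau>..T})" if "s \<in> {\<tau>..T}" for s
      using has_vector_derivative_within_subset[OF x'[OF sub[OF that]], of "{\<tau>..T}"] \<tau>
      unfolding z0_def v0_def has_vector_derivative_def by (auto intro!: derivative_eq_intros)
    have z0x: "norm (z0 s - x s) \<le> r" for s using y by (simp add: z0_def)
    have "\<exists>z v. continuous_on {\<tau>..T} v \<and> z \<tau> = z0 \<tau> \<and>
     (\<forall>s\<in>{\<tau>..T}. (z has_vector_derivative v s) (at s within {\<tau>..T}) \<and> v s \<in> {G (\<pi> (z s)) (p s)} \<and>
        norm (z s - z0 s) \<le> (L * r) * (exp (2 * L * (T - \<tau>)) / L))"
    proof (rule filippov_continuous[OF L, where P = "\<lambda>s u v. G (\<pi> u) (p s)" and ?v0.0 = v0])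
      show "norm (G (\<pi> u) (p s) - v) \<le> L * norm (u - w)" if "s \<in> {\<tau>..T}" "v \<in> {G (\<pi> w) (p s)}" for s u w v
      proof -
        have "norm (G (\<pi> u) (p s) - v) \<le> L * norm (\<pi> u - \<pi> w)"
          using GL[OF sub[OF that(1)] \<pi>K \<pi>K] that(2) by simp
        also have "\<dots> \<le> L * norm (u - w)" using L by (intro mult_left_mono \<pi>lip) auto
        finally show ?thesis .
      qed
      show "continuous_on {\<tau>..T} (\<lambda>s. G (\<pi> (u s)) (p s))" if "continuous_on {\<tau>..T} u" for u
        by (rule Gc[OF \<pi>c[OF that]]) (use sub \<pi>K in auto)
      show "continuous_on {\<tau>..T} v0" unfolding v0_def
        by (rule Gc[OF continuous_on_subset[OF xc]]) (use sub xK in auto)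
      show "norm (G (\<pi> (z0 s)) (p s) - v0 s) \<le> L * r" if s: "s \<in> {\<tau>..T}" for s
      proof -
        have "norm (G (\<pi> (z0 s)) (p s) - v0 s) \<le> L * norm (\<pi> (z0 s) - \<pi> (x s))"
          using GL[OF sub[OF s] \<pi>K, of "x s" "z0 s"] \<pi>id xK sub[OF s] by (simp add: v0_def)
        also have "\<dots> \<le> L * r" using \<pi>lip[of "z0 s" "x s"] z0x[of s] L by (intro mult_left_mono) auto
        finally show ?thesis .
      qed
    qed (use z0' in auto)
    then obtain z v where v: "continuous_on {\<tau>..T} v" and z\<tau>: "z \<tau> = z0 \<tau>"
      and z: "\<And>s. s \<in> {\<tau>..T} \<Longrightarrow> (z has_vector_derivative v s) (at s within {\<tau>..T})"
      and vG: "\<And>s. s \<in> {\<tau>..T} \<Longrightarrow> v s = G (\<pi> (z s)) (p s)"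
      and zz0: "\<And>s. s \<in> {\<tau>..T} \<Longrightarrow> norm (z s - z0 s) \<le> (L * r) * (exp (2 * L * (T - \<tau>)) / L)"
      by blast
    have zx: "norm (z s - x s) \<le> C * r" if s: "s \<in> {\<tau>..T}" for s
    proof -
      have "exp (2 * L * (T - \<tau>)) / L \<le> E" unfolding E_def using L \<tau> by (intro divide_right_mono) auto
      then have "(L * r) * (exp (2 * L * (T - \<tau>)) / L) \<le> (L * r) * E"
        using L r by (intro mult_left_mono) auto
      then have "norm (z s - x s) \<le> (L * r) * E + r"
        using zz0[OF s] z0x[of s] norm_triangle_ineq[of "z s - z0 s" "z0 s - x s"] by simp
      then show ?thesis by (simp add: C_def algebra_simps)
    qed
    have zR: "norm (z s) \<le> R + 1" if s: "s \<in> {\<tau>..T}" for s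
    proof -
      have "C * r \<le> 1" using r C by (simp add: field_simps)
      then have "norm (z s - x s) \<le> 1" using zx[OF s] by linarith
      then show ?thesis using xR[OF sub[OF s]] norm_triangle_ineq[of "z s - x s" "x s"] by simp
    qed
    have zK: "z s \<in> K" if "s \<in> {\<tau>..T}" for s using zR[OF that] by (simp add: K_def)
    have "v s \<in> F (z s)" "v s \<bullet> p s = H (z s) (p s)" if "s \<in> {\<tau>..T}" for s
      using gderiv_H_mem[OF GK[OF zK[OF that] sub[OF that]]] vG[OF that] \<pi>id[OF zK[OF that]] by auto
    moreover have "z \<tau> = y" using z\<tau> by (simp add: z0_def)
    ultimately show ?thesis using v z zx zR by blast
  qed
  then show ?thesis using C by (intro exI[of _ C] conjI exI[of _ "1 / C"]) auto
qed

end

section \<open>The sensitivity relation\<close>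

context lipschitz_inclusion
begin

text \<open>For fixed \<open>p\<close> the Hamiltonian is Lipschitz in the state with constant
  \<open>L * norm p\<close>, which bounds its subgradients. The ball of radius \<open>R + 1\<close>
  contains a unit ball around every state considered. The linear dependence on \<open>norm p\<close>
  is what permits Gronwall's inequality for costates.\<close>

lemma costate_deriv_norm_le:
  assumes R: "R > 0"
  shows "\<exists>L>0. \<forall>y p q. norm y \<le> R \<longrightarrow> - q \<in> frechet_subdiff (\<lambda>x. H x p) y \<longrightarrow> norm q \<le> L * norm p"
proof -
  have "compact (cball (0::'a) (R + 1))" by simp
  then obtain L where L: "L > 0"
    and HL: "\<forall>x\<in>cball 0 (R + 1). \<forall>y\<in>cball 0 (R + 1). \<forall>p. H x p \<le> H y p + L * norm (x - y) * norm p"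
    using H_lipschitz_compact by blast
  have "norm q \<le> L * norm p" if y: "norm y \<le> R" and q: "- q \<in> frechet_subdiff (\<lambda>x. H x p) y" for y p q
  proof -
    have "norm (- q) \<le> L * norm p"
    proof (rule frechet_subgradient_norm_le[OF q zero_less_one])
      fix z assume "z \<in> ball y 1"
      then have "norm (z - y) \<le> 1" by (simp add: dist_norm norm_minus_commute)
      then have "norm z \<le> R + 1" using y norm_triangle_ineq[of "z - y" y] by simp
      then show "H z p \<le> H y p + L * norm p * norm (z - y)" using HL y by (auto simp: algebra_simps)
    qed (use L in auto)
    then show ?thesis by simp
  qed
  then show ?thesis using L by blast
qed

lemma costate_lipschitz_on:
  assumes xR: "\<And>s. s \<in> {t0..T} \<Longrightarrow> norm (x s) \<le> R" and R: "R > 0"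
    and p: "abs_cont_on t0 T p" and N: "negligible N"
    and adj: "\<And>s. s \<in> {t0..T} - N \<Longrightarrow> \<exists>q. (p has_vector_derivative q) (at s within {t0..T}) \<and>
        - q \<in> frechet_subdiff (\<lambda>x. H x (p s)) (x s)"
  shows "\<exists>C. C-lipschitz_on {t0..T} p"
proof -
  obtain L where L: "L > 0"
    "\<forall>y p q. norm y \<le> R \<longrightarrow> - q \<in> frechet_subdiff (\<lambda>x. H x p) y \<longrightarrow> norm q \<le> L * norm p"
    using costate_deriv_norm_le[OF R] by blast
  obtain B where B: "B > 0" "\<And>s. s \<in> {t0..T} \<Longrightarrow> norm (p s) \<le> B"
    using continuous_on_Icc_norm_bound[OF abs_cont_on_imp_continuous_on[OF p]] by blast
  have "(L * B)-lipschitz_on {t0..T} p"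
  proof (rule abs_cont_on_deriv_bound_imp_lipschitz_on[OF p _ N])
    fix s assume s: "s \<in> {t0..T} - N"
    then obtain q where q: "(p has_vector_derivative q) (at s within {t0..T})"
      "- q \<in> frechet_subdiff (\<lambda>x. H x (p s)) (x s)" using adj by blast
    have "norm q \<le> L * norm (p s)" using L(2) q(2) xR s by blast
    also have "\<dots> \<le> L * B" using L B(2)[of s] s by (intro mult_left_mono) auto
    finally show "\<exists>v. norm v \<le> L * B \<and> (p has_vector_derivative v) (at s within {t0..T})" using q by blast
  qed (use L B in auto)
  then show ?thesis by blast
qed

text \<open>The derivative of \<open>p \<bullet> p\<close> is bounded in modulus by a multiple of
  \<open>p \<bullet> p\<close>, so Gronwall's inequality, forward and backward, spreads one zero
  over the whole interval.\<close>

lemma costate_zero: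
  assumes xR: "\<And>s. s \<in> {t0..T} \<Longrightarrow> norm (x s) \<le> R" and R: "R > 0"
    and p: "abs_cont_on t0 T p" and N: "negligible N"
    and adj: "\<And>s. s \<in> {t0..T} - N \<Longrightarrow> \<exists>q. (p has_vector_derivative q) (at s within {t0..T}) \<and>
        - q \<in> frechet_subdiff (\<lambda>x. H x (p s)) (x s)"
    and su: "s \<in> {t0..T}" "u \<in> {t0..T}" and "p u = 0"
  shows "p s = 0"
proof -
  obtain L where L: "L > 0"
    "\<forall>y p q. norm y \<le> R \<longrightarrow> - q \<in> frechet_subdiff (\<lambda>x. H x p) y \<longrightarrow> norm q \<le> L * norm p"
    using costate_deriv_norm_le[OF R] by blast
  have lip: "\<exists>C. C-lipschitz_on {t0..T} (\<lambda>s. p s \<bullet> p s)"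
    by (intro lipschitz_on_Icc_inner costate_lipschitz_on[OF xR R p N adj])
  then have lip': "\<exists>C. C-lipschitz_on {t0..T} (\<lambda>s. - (p s \<bullet> p s))" using lipschitz_on_minus by blast
  have d: "\<exists>d. \<bar>d\<bar> \<le> (2 * L) * (p s \<bullet> p s) \<and> ((\<lambda>s. p s \<bullet> p s) has_vector_derivative d) (at s within {t0..T})"
    if s: "s \<in> {t0..T} - N" for s
  proof -
    obtain q where q: "(p has_vector_derivative q) (at s within {t0..T})"
      "- q \<in> frechet_subdiff (\<lambda>x. H x (p s)) (x s)" using adj s by blast
    have "norm q \<le> L * norm (p s)" using L(2) q(2) xR s by blast
    then have "norm q * norm (p s) \<le> L * norm (p s) * norm (p s)" by (rule mult_right_mono) simp
    then have "\<bar>2 * (q \<bullet> p s)\<bar> \<le> (2 * L) * (p s \<bullet> p s)"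
      using Cauchy_Schwarz_ineq2[of q "p s"] by (simp add: dot_square_norm power2_eq_square abs_mult)
    moreover have "((\<lambda>s. p s \<bullet> p s) has_vector_derivative (2 * (q \<bullet> p s))) (at s within {t0..T})"
      using q(1) unfolding has_vector_derivative_def
      by (auto intro!: derivative_eq_intros simp: inner_commute algebra_simps)
    ultimately show ?thesis by blast
  qed
  have "p s \<bullet> p s \<le> 0"
  proof (cases "u \<le> s")
    case True
    have "p s \<bullet> p s \<le> (p u \<bullet> p u) * exp ((2 * L) * (s - u))"
    proof (rule lipschitz_gronwall[OF lip N _ True])
      fix s assume "s \<in> {t0..T} - N"
      from d[OF this] show "\<exists>d. d \<le> (2 * L) * (p s \<bullet> p s) \<and> ((\<lambda>s. p s \<bullet> p s) has_vector_derivative d) (at s within {t0..T})"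
        by (meson abs_le_D1)
    qed (use su in auto)
    then show ?thesis using \<open>p u = 0\<close> by simp
  next
    case False
    \<comment> \<open>To the left of \<open>u\<close>, Gronwall runs from \<open>s\<close> to
      \<open>u\<close> for the negative of \<open>p \<bullet> p\<close>, with the negative rate
      \<open>- 2 * L\<close>; the vanishing left-hand side then forces
      \<open>p s \<bullet> p s \<le> 0\<close>.\<close>
    have "- (p u \<bullet> p u) \<le> - (p s \<bullet> p s) * exp ((- 2 * L) * (u - s))"
    proof (rule lipschitz_gronwall[OF lip' N])
      fix s assume "s \<in> {t0..T} - N"
      then obtain e where e: "\<bar>e\<bar> \<le> (2 * L) * (p s \<bullet> p s)" "((\<lambda>s. p s \<bullet> p s) has_vector_derivative e) (at s within {t0..T})"
        using d by blast
      have "- e \<le> (- 2 * L) * - (p s \<bullet> p s)" using e(1) by (simp add: abs_le_iff)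
      then show "\<exists>d. d \<le> (- 2 * L) * - (p s \<bullet> p s) \<and> ((\<lambda>s. - (p s \<bullet> p s)) has_vector_derivative d) (at s within {t0..T})"
        using has_vector_derivative_minus[OF e(2)] by blast
    qed (use su False in auto)
    then have "(p s \<bullet> p s) * exp ((- 2 * L) * (u - s)) \<le> 0 * exp ((- 2 * L) * (u - s))" using \<open>p u = 0\<close> by simp
    then show ?thesis by (simp only: mult_le_cancel_right_pos exp_gt_zero)
  qed
  then show ?thesis by (metis inner_gt_zero_iff not_less)
qed

text \<open>The term \<open>q \<bullet> (z s - x s)\<close> from the moving costate cancels against
  the linear term of the subgradient inequality, leaving only the semiconvexity defect. Both curves
  lie in one ball, so it contains the segment joining them.\<close>

lemma adjoint_estimate:
  assumes xK: "\<And>s. s \<in> {\<tau>..T} \<Longrightarrow> norm (x s) \<le> R" and zK: "\<And>s. s \<in> {\<tau>..T} \<Longrightarrow> norm (z s) \<le> R"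
    and lip: "\<exists>C. C-lipschitz_on {\<tau>..T} x" "\<exists>C. C-lipschitz_on {\<tau>..T} z" "\<exists>C. C-lipschitz_on {\<tau>..T} p"
    and "\<tau> \<le> T" and N: "negligible N"
    and ext: "\<And>s. s \<in> {\<tau>..T} - N \<Longrightarrow> \<exists>q v w. (p has_vector_derivative q) (at s within {\<tau>..T}) \<and>
         (x has_vector_derivative v) (at s within {\<tau>..T}) \<and> (z has_vector_derivative w) (at s within {\<tau>..T}) \<and>
         - q \<in> frechet_subdiff (\<lambda>x. H x (p s)) (x s) \<and> v \<bullet> p s = H (x s) (p s) \<and> w \<bullet> p s = H (z s) (p s)"
    and c: "c \<ge> 0" "\<And>p. semiconvex_on (cball 0 R) (c * norm p) (\<lambda>x. H x p)"
    and B: "\<And>s. s \<in> {\<tau>..T} \<Longrightarrow> norm (p s) \<le> B"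
    and e: "\<And>s. s \<in> {\<tau>..T} \<Longrightarrow> norm (z s - x s) \<le> e"
  shows "p \<tau> \<bullet> (z \<tau> - x \<tau>) \<le> p T \<bullet> (z T - x T) + c * B * e\<^sup>2 * (T - \<tau>)"
proof -
  \<comment> \<open>The sign is reversed because the integrated criterion takes upper bounds on
    derivatives, while that of the pairing is bounded from below.\<close>
  have "- (p T \<bullet> (z T - x T)) \<le> - (p \<tau> \<bullet> (z \<tau> - x \<tau>)) + c * B * e\<^sup>2 * (T - \<tau>)"
  proof (rule lipschitz_deriv_bound_imp_le[OF _ \<open>\<tau> \<le> T\<close> N])
    have "\<exists>C. C-lipschitz_on {\<tau>..T} (\<lambda>s. p s \<bullet> (z s - x s))"
      by (intro lipschitz_on_Icc_inner lipschitz_on_Icc_diff lip)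
    then show "\<exists>C. C-lipschitz_on {\<tau>..T} (\<lambda>s. - (p s \<bullet> (z s - x s)))" using lipschitz_on_minus by blast
    fix s assume s: "s \<in> {\<tau>..T} - N"
    then obtain q v w where d: "(p has_vector_derivative q) (at s within {\<tau>..T})"
         "(x has_vector_derivative v) (at s within {\<tau>..T})" "(z has_vector_derivative w) (at s within {\<tau>..T})"
      and q: "- q \<in> frechet_subdiff (\<lambda>x. H x (p s)) (x s)" and vw: "v \<bullet> p s = H (x s) (p s)" "w \<bullet> p s = H (z s) (p s)"
      using ext by blast
    have D: "((\<lambda>s. - (p s \<bullet> (z s - x s))) has_vector_derivative (- (q \<bullet> (z s - x s) + p s \<bullet> (w - v)))) (at s within {\<tau>..T})"
      using d unfolding has_vector_derivative_def
      by (auto intro!: derivative_eq_intros simp: algebra_simps)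
    have "closed_segment (x s) (z s) \<subseteq> cball 0 R"
      by (rule closed_segment_subset) (use xK zK s in auto)
    then have "H (x s) (p s) + - q \<bullet> (z s - x s) - c * norm (p s) * (norm (z s - x s))\<^sup>2 \<le> H (z s) (p s)"
      using semiconvex_on_subgradient_le[OF c(2) _ q] c(1) by simp
    moreover have "c * norm (p s) * (norm (z s - x s))\<^sup>2 \<le> c * B * e\<^sup>2"
      using c(1) B[of s] e[of s] s order_trans[OF norm_ge_zero B[of s]] by (intro mult_mono power_mono) auto
    moreover have "p s \<bullet> (w - v) = H (z s) (p s) - H (x s) (p s)"
      using vw by (simp add: inner_commute[of "p s"] inner_diff_left)
    ultimately have "- (q \<bullet> (z s - x s) + p s \<bullet> (w - v)) \<le> c * B * e\<^sup>2" by simp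
    then show "\<exists>d\<le>c * B * e\<^sup>2. ((\<lambda>s. - (p s \<bullet> (z s - x s))) has_vector_derivative d) (at s within {\<tau>..T})"
      using D by blast
  qed
  then show ?thesis by simp
qed

text \<open>\<open>x\<close> need not be differentiable at \<open>t\<close>, but \<open>H (x s) (p s)\<close> is Lipschitz in \<open>s\<close>.\<close>

lemma state_increment_estimate:
  assumes xR: "\<And>s. s \<in> {t0..T} \<Longrightarrow> norm (x s) \<le> R" and R: "R > 0"
    and xM: "M-lipschitz_on {t0..T} x" and pM: "Q-lipschitz_on {t0..T} p"
    and N: "negligible N"
    and max: "\<And>s. s \<in> {t0..T} - N \<Longrightarrow> \<exists>v\<in>F (x s). (x has_vector_derivative v) (at s within {t0..T}) \<and> v \<bullet> p s = H (x s) (p s)"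
  shows "\<exists>D\<ge>0. \<forall>t\<in>{t0..T}. \<forall>\<tau>\<in>{t0..T}. \<bar>p t \<bullet> (x \<tau> - x t) - H (x t) (p t) * (\<tau> - t)\<bar> \<le> D * (\<tau> - t)\<^sup>2"
proof -
  have "compact (cball (0::'a) R)" by simp
  then obtain L where L: "L > 0"
    and HL: "\<forall>x\<in>cball 0 R. \<forall>y\<in>cball 0 R. \<forall>p. H x p \<le> H y p + L * norm (x - y) * norm p"
    using H_lipschitz_compact by blast
  obtain B where B: "B > 0" "\<And>s. s \<in> {t0..T} \<Longrightarrow> norm (p s) \<le> B"
    using continuous_on_Icc_norm_bound[OF lipschitz_on_continuous_on[OF pM]] by blast
  have MQ: "M \<ge> 0" "Q \<ge> 0" using xM pM lipschitz_on_nonneg by blast+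
  define M' where "M' = \<rho> * (1 + R)"
  have M': "M' \<ge> 0" using \<rho>_pos R by (simp add: M'_def)
  \<comment> \<open>\<open>L * M * B\<close> accounts for moving the state in \<open>H\<close>;
    \<open>M' * Q\<close> occurs twice, for replacing \<open>p s\<close> by \<open>p t\<close> in
    \<open>H\<close> and in the pairing with the velocity.\<close>
  define D where "D = L * M * B + 2 * M' * Q"
  have D: "D \<ge> 0" unfolding D_def using L MQ M' B by (intro add_nonneg_nonneg mult_nonneg_nonneg) auto
  have "\<bar>p t \<bullet> (x \<tau> - x t) - H (x t) (p t) * (\<tau> - t)\<bar> \<le> D * (\<tau> - t)\<^sup>2"
    if t: "t \<in> {t0..T}" and \<tau>: "\<tau> \<in> {t0..T}" for t \<tau>
  proof -
    define I where "I = {min t \<tau>..max t \<tau>}"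
    have I: "I \<subseteq> {t0..T}" using t \<tau> by (auto simp: I_def)
    let ?f = "\<lambda>s. x s \<bullet> p t - H (x t) (p t) * s"
    \<comment> \<open>The Lipschitz constant is proportional to the length of the interval, so the
      increment is quadratic. The endpoints \<open>min\<close> and \<open>max\<close> treat both
      time directions together.\<close>
    have "(D * \<bar>\<tau> - t\<bar>)-lipschitz_on {min t \<tau>..max t \<tau>} ?f"
    proof (rule abs_cont_on_deriv_bound_imp_lipschitz_on[OF _ _ N])
      show "abs_cont_on (min t \<tau>) (max t \<tau>) ?f"
        by (rule abs_cont_on_inner_affine[OF lipschitz_on_imp_abs_cont_on[OF lipschitz_on_subset[OF xM I[unfolded I_def]]]])
      fix s assume "s \<in> {min t \<tau>..max t \<tau>} - N"
      then have s: "s \<in> {t0..T} - N" "s \<in> I" "\<bar>s - t\<bar> \<le> \<bar>\<tau> - t\<bar>" using I by (auto simp: I_def)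
      then obtain v where v: "v \<in> F (x s)" "(x has_vector_derivative v) (at s within {t0..T})" "v \<bullet> p s = H (x s) (p s)"
        using max by blast
      have xst: "norm (x s - x t) \<le> M * \<bar>s - t\<bar>" and pst: "norm (p s - p t) \<le> Q * \<bar>s - t\<bar>"
        using lipschitz_onD[OF xM, of s t] lipschitz_onD[OF pM, of s t] s t by (auto simp: dist_norm)
      have gb: "\<rho> * (1 + norm (x u)) \<le> M'" if "u \<in> {t0..T}" for u
        unfolding M'_def using xR[OF that] \<rho>_pos by (intro mult_left_mono) auto
      have h1: "\<bar>H (x s) (p s) - H (x t) (p s)\<bar> \<le> L * M * B * \<bar>s - t\<bar>"
      proof -
        have "\<bar>H (x s) (p s) - H (x t) (p s)\<bar> \<le> L * norm (x s - x t) * norm (p s)"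
        proof -
          have "x s \<in> cball 0 R" "x t \<in> cball 0 R" using xR s t by auto
          then have "H (x s) (p s) \<le> H (x t) (p s) + L * norm (x s - x t) * norm (p s)"
            "H (x t) (p s) \<le> H (x s) (p s) + L * norm (x t - x s) * norm (p s)"
            using HL by blast+
          then show ?thesis by (simp add: abs_le_iff norm_minus_commute)
        qed
        also have "\<dots> \<le> L * (M * \<bar>s - t\<bar>) * B"
          using L xst B s MQ by (intro mult_mono) auto
        finally show ?thesis by (simp add: algebra_simps)
      qed
      have h2: "\<bar>H (x t) (p s) - H (x t) (p t)\<bar> \<le> M' * Q * \<bar>s - t\<bar>"
      proof -
        have "\<bar>H (x t) (p s) - H (x t) (p t)\<bar> \<le> \<rho> * (1 + norm (x t)) * norm (p s - p t)"
          using H_diff_le[of "x t" "p s" "p t"] H_diff_le[of "x t" "p t" "p s"] by (auto simp: abs_le_iff norm_minus_commute)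
        also have "\<dots> \<le> M' * (Q * \<bar>s - t\<bar>)" using gb[OF t] pst M' by (intro mult_mono) auto
        finally show ?thesis by (simp add: mult.assoc)
      qed
      have h3: "\<bar>v \<bullet> p t - v \<bullet> p s\<bar> \<le> M' * Q * \<bar>s - t\<bar>"
      proof -
        have "\<bar>v \<bullet> p t - v \<bullet> p s\<bar> \<le> norm v * norm (p s - p t)"
          using Cauchy_Schwarz_ineq2[of v "p t - p s"] by (simp add: inner_diff_right norm_minus_commute)
        also have "\<dots> \<le> M' * (Q * \<bar>s - t\<bar>)" using growth[OF v(1)] gb[of s] s pst M' by (intro mult_mono) auto
        finally show ?thesis by (simp add: mult.assoc)
      qed
      have "\<bar>v \<bullet> p t - H (x t) (p t)\<bar> \<le> L * M * B * \<bar>s - t\<bar> + M' * Q * \<bar>s - t\<bar> + M' * Q * \<bar>s - t\<bar>"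
        using h1 h2 h3 v(3) by linarith
      also have "\<dots> = D * \<bar>s - t\<bar>" by (simp add: D_def algebra_simps)
      also have "\<dots> \<le> D * \<bar>\<tau> - t\<bar>" using D s by (intro mult_left_mono) auto
      finally have "norm (v \<bullet> p t - H (x t) (p t)) \<le> D * \<bar>\<tau> - t\<bar>" by simp
      moreover have "(?f has_vector_derivative (v \<bullet> p t - H (x t) (p t))) (at s within {min t \<tau>..max t \<tau>})"
        using has_vector_derivative_within_subset[OF v(2) I[unfolded I_def]]
        unfolding has_vector_derivative_def by (auto intro!: derivative_eq_intros simp: algebra_simps)
      ultimately show "\<exists>v. norm v \<le> D * \<bar>\<tau> - t\<bar> \<and> (?f has_vector_derivative v) (at s within {min t \<tau>..max t \<tau>})"
        by blast
    qed (use D in auto)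
    from lipschitz_onD[OF this, of \<tau> t]
    have "\<bar>?f \<tau> - ?f t\<bar> \<le> D * \<bar>\<tau> - t\<bar> * \<bar>\<tau> - t\<bar>" by (simp add: dist_norm)
    moreover have "?f \<tau> - ?f t = p t \<bullet> (x \<tau> - x t) - H (x t) (p t) * (\<tau> - t)"
      by (simp add: inner_commute inner_diff_left algebra_simps)
    ultimately show ?thesis by (simp add: power2_eq_square mult.assoc flip: abs_mult)
  qed
  then show ?thesis using D by blast
qed

text \<open>Common interface to the two kinds of costate. If the costate vanishes identically, the
  maximality condition \<open>v s \<bullet> p s = H (z s) (p s)\<close> reads \<open>0 = 0\<close>;
  the starting times \<open>\<tau> \<ge> t' > t0\<close> leave room for the averaging windows of
  that case.\<close>

lemma perturbed_trajectory_maximal: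
  assumes R: "R > 0" and xR: "\<And>s. s \<in> {t0..T} \<Longrightarrow> norm (x s) \<le> R"
    and x: "trajectory F T t0 x0 x" and t': "t0 < t'" "t' \<le> T"
    and p: "abs_cont_on t0 T p" and N: "negligible N"
    and ext: "\<And>s. s \<in> {t0..T} - N \<Longrightarrow> \<exists>q v. (p has_vector_derivative q) (at s within {t0..T}) \<and>
        - q \<in> frechet_subdiff (\<lambda>x. H x (p s)) (x s) \<and>
        v \<in> F (x s) \<and> (x has_vector_derivative v) (at s within {t0..T}) \<and> v \<bullet> p s = H (x s) (p s)"
    and G: "\<And>x p. norm x \<le> R + 1 \<Longrightarrow> p \<noteq> 0 \<Longrightarrow> GDERIV (H x) p :> G x p"
    and Gloc: "\<And>P. compact P \<Longrightarrow> P \<subseteq> - {0} \<Longrightarrow>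
        \<forall>x\<in>cball 0 (R + 1). \<exists>r>0. \<exists>L. \<forall>p\<in>P. L-lipschitz_on (ball x r \<inter> cball 0 (R + 1)) (\<lambda>y. G y p)"
  shows "\<exists>C>0. \<exists>r0>0. \<forall>\<tau>\<in>{t'..T}. \<forall>y r. 0 < r \<longrightarrow> r \<le> r0 \<longrightarrow> norm (y - x \<tau>) \<le> r \<longrightarrow>
    (\<exists>z v. continuous_on {\<tau>..T} v \<and> z \<tau> = y \<and>
      (\<forall>s\<in>{\<tau>..T}. (z has_vector_derivative v s) (at s within {\<tau>..T}) \<and> v s \<in> F (z s) \<and>
         v s \<bullet> p s = H (z s) (p s) \<and> norm (z s - x s) \<le> C * r \<and> norm (z s) \<le> R + 1))"
proof (cases "\<exists>u\<in>{t0..T}. p u = 0")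
  case True
  then obtain u where u: "u \<in> {t0..T}" "p u = 0" by blast
  have p0: "p s = 0" if "s \<in> {t0..T}" for s
    by (rule costate_zero[where x = x and R = R, OF xR R p N _ that u]) (use ext in blast)+
  obtain C r0 where "C > 0" "r0 > 0" and *: "\<forall>\<tau>\<in>{t'..T}. \<forall>y r. 0 < r \<longrightarrow> r \<le> r0 \<longrightarrow> norm (y - x \<tau>) \<le> r \<longrightarrow>
    (\<exists>z v. continuous_on {\<tau>..T} v \<and> z \<tau> = y \<and>
      (\<forall>s\<in>{\<tau>..T}. (z has_vector_derivative v s) (at s within {\<tau>..T}) \<and> v s \<in> F (z s) \<and>
         norm (z s - x s) \<le> C * r \<and> norm (z s) \<le> R + 1))"
    using perturbed_trajectory[OF R xR x t'] by blast
  have "\<exists>z v. continuous_on {\<tau>..T} v \<and> z \<tau> = y \<and>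
      (\<forall>s\<in>{\<tau>..T}. (z has_vector_derivative v s) (at s within {\<tau>..T}) \<and> v s \<in> F (z s) \<and>
         v s \<bullet> p s = H (z s) (p s) \<and> norm (z s - x s) \<le> C * r \<and> norm (z s) \<le> R + 1)"
    if h: "\<tau> \<in> {t'..T}" "0 < r" "r \<le> r0" "norm (y - x \<tau>) \<le> r" for \<tau> y r
  proof -
    obtain z v where zv: "continuous_on {\<tau>..T} v" "z \<tau> = y"
      "\<forall>s\<in>{\<tau>..T}. (z has_vector_derivative v s) (at s within {\<tau>..T}) \<and> v s \<in> F (z s) \<and>
         norm (z s - x s) \<le> C * r \<and> norm (z s) \<le> R + 1"
      using *[rule_format, OF h] by blast
    have "p s = 0" if "s \<in> {\<tau>..T}" for s using p0[of s] that h(1) t' by auto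
    then show ?thesis using zv by (intro exI[of _ z] exI[of _ v]) auto
  qed
  then show ?thesis using \<open>C > 0\<close> \<open>r0 > 0\<close> by blast
next
  case False
  \<comment> \<open>Shrinks the set of starting times, with the body of the quantifiers abstracted
    to \<open>P\<close>.\<close>
  have mono: "\<exists>C>0. \<exists>r0>0. \<forall>\<tau>\<in>S. P C r0 \<tau>"
    if "\<exists>C>0. \<exists>r0>0. \<forall>\<tau>\<in>S'. P C r0 \<tau>" "S \<subseteq> S'" for S S' and P :: "real \<Rightarrow> real \<Rightarrow> real \<Rightarrow> bool"
    using that by (meson subsetD)
  have "\<exists>C>0. \<exists>r0>0. \<forall>\<tau>\<in>{t0..T}. \<forall>y r. 0 < r \<longrightarrow> r \<le> r0 \<longrightarrow> norm (y - x \<tau>) \<le> r \<longrightarrow>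
    (\<exists>z v. continuous_on {\<tau>..T} v \<and> z \<tau> = y \<and>
      (\<forall>s\<in>{\<tau>..T}. (z has_vector_derivative v s) (at s within {\<tau>..T}) \<and> v s \<in> F (z s) \<and>
         v s \<bullet> p s = H (z s) (p s) \<and> norm (z s - x s) \<le> C * r \<and> norm (z s) \<le> R + 1))"
    by (rule perturbed_extremal[OF R xR x abs_cont_on_imp_continuous_on[OF p] _ N _ G Gloc])
      (use False ext in blast)+
  moreover have "{t'..T} \<subseteq> {t0..T}" using t' by auto
  ultimately show ?thesis by (rule mono)
qed

text \<open>Error budget: with \<open>\<nu>\<close> the distance from \<open>(\<tau>, y)\<close> to
  \<open>(t, x t)\<close>, transversality contributes \<open>\<epsilon> / 2 * \<nu>\<close> and
  everything else at most \<open>A * \<nu>\<^sup>2\<close>, which the other half absorbs for small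
  \<open>\<nu>\<close>.\<close>

lemma full_sensitivity_relation:
  assumes opt: "mayer_optimal F \<phi> T t0 x0 x" and t: "t0 < t" "t < T" and \<phi>: "continuous_on UNIV \<phi>"
    and p: "abs_cont_on t0 T p" and N: "negligible N"
    and ext: "\<And>s. s \<in> {t0..T} - N \<Longrightarrow> \<exists>q v. (p has_vector_derivative q) (at s within {t0..T}) \<and>
        (x has_vector_derivative v) (at s within {t0..T}) \<and>
        - q \<in> frechet_subdiff (\<lambda>x. H x (p s)) (x s) \<and> v \<in> clarke_gradient (H (x s)) (p s)"
    and transv: "- p T \<in> frechet_superdiff \<phi> (x T)"
    and semi: "\<And>K. K \<noteq> {} \<Longrightarrow> convex K \<Longrightarrow> compact K \<Longrightarrow> \<exists>c\<ge>0. \<forall>p. semiconvex_on K (c * norm p) (\<lambda>x. H x p)"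
    and grad: "\<And>K. K \<noteq> {} \<Longrightarrow> convex K \<Longrightarrow> compact K \<Longrightarrow>
           \<exists>G. (\<forall>x\<in>K. \<forall>p. p \<noteq> 0 \<longrightarrow> GDERIV (H x) p :> G x p) \<and>
               (\<forall>P. compact P \<longrightarrow> P \<subseteq> - {0} \<longrightarrow>
                  (\<forall>x\<in>K. \<exists>r>0. \<exists>L. \<forall>p\<in>P. L-lipschitz_on (ball x r \<inter> K) (\<lambda>y. G y p)))"
  shows "(H (x t) (p t), - p t) \<in> frechet_superdiff (mayer_value F \<phi> T) (t, x t)"
proof -
  have x: "trajectory F T t0 x0 x" using opt by (simp add: mayer_optimal_def)
  have xlip: "\<exists>C. C-lipschitz_on {t0..T} x" by (rule trajectory_imp_lipschitz_on[OF x])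
  then obtain M where M: "M-lipschitz_on {t0..T} x" by blast
  then have M0: "M \<ge> 0" by (rule lipschitz_on_nonneg)
  obtain R where R: "R > 0" "\<And>s. s \<in> {t0..T} \<Longrightarrow> norm (x s) \<le> R"
    using continuous_on_Icc_norm_bound[OF lipschitz_on_continuous_on[OF M]] by blast
  have K: "cball (0::'a) (R + 1) \<noteq> {}" "convex (cball (0::'a) (R + 1))" "compact (cball (0::'a) (R + 1))"
    using R(1) by auto
  obtain c where c: "c \<ge> 0" "\<And>p. semiconvex_on (cball 0 (R + 1)) (c * norm p) (\<lambda>x. H x p)"
    using semi[OF K] by blast
  obtain G where "\<forall>x\<in>cball 0 (R + 1). \<forall>p. p \<noteq> 0 \<longrightarrow> GDERIV (H x) p :> G x p"
    and Gloc: "\<And>P. compact P \<Longrightarrow> P \<subseteq> - {0} \<Longrightarrow>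
        \<forall>x\<in>cball 0 (R + 1). \<exists>r>0. \<exists>L. \<forall>p\<in>P. L-lipschitz_on (ball x r \<inter> cball 0 (R + 1)) (\<lambda>y. G y p)"
    using grad[OF K] by blast
  then have G: "\<And>x p. norm x \<le> R + 1 \<Longrightarrow> p \<noteq> 0 \<Longrightarrow> GDERIV (H x) p :> G x p" by simp
  have ext': "\<exists>q v. (p has_vector_derivative q) (at s within {t0..T}) \<and>
        - q \<in> frechet_subdiff (\<lambda>x. H x (p s)) (x s) \<and>
        v \<in> F (x s) \<and> (x has_vector_derivative v) (at s within {t0..T}) \<and> v \<bullet> p s = H (x s) (p s)"
    if s: "s \<in> {t0..T} - N" for s
  proof -
    obtain q v where qv: "(p has_vector_derivative q) (at s within {t0..T})" "(x has_vector_derivative v) (at s within {t0..T})"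
      "- q \<in> frechet_subdiff (\<lambda>x. H x (p s)) (x s)" "v \<in> clarke_gradient (H (x s)) (p s)" using ext[OF s] by blast
    show ?thesis using qv mem_if_inner_le[OF clarke_gradient_H(1)[OF qv(4)]] clarke_gradient_H(2)[OF qv(4)] by blast
  qed
  then have max: "\<exists>v\<in>F (x s). (x has_vector_derivative v) (at s within {t0..T}) \<and> v \<bullet> p s = H (x s) (p s)"
    if "s \<in> {t0..T} - N" for s using that by blast
  have plip: "\<exists>C. C-lipschitz_on {t0..T} p"
    by (rule costate_lipschitz_on[OF R(2,1) p N]) (use ext' in blast)+
  then obtain Q where Q: "Q-lipschitz_on {t0..T} p" by blast
  then have Q0: "Q \<ge> 0" by (rule lipschitz_on_nonneg)
  obtain B where B: "B > 0" "\<And>s. s \<in> {t0..T} \<Longrightarrow> norm (p s) \<le> B"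
    using continuous_on_Icc_norm_bound[OF lipschitz_on_continuous_on[OF Q]] by blast
  obtain D where D: "D \<ge> 0" "\<And>t \<tau>. t \<in> {t0..T} \<Longrightarrow> \<tau> \<in> {t0..T} \<Longrightarrow>
      \<bar>p t \<bullet> (x \<tau> - x t) - H (x t) (p t) * (\<tau> - t)\<bar> \<le> D * (\<tau> - t)\<^sup>2"
    using state_increment_estimate[OF R(2,1) M Q N max] by blast
  \<comment> \<open>A time strictly between \<open>t0\<close> and \<open>t\<close>, so that starting
    times on both sides of \<open>t\<close> are covered.\<close>
  define t' where "t' = (t0 + t) / 2"
  have t': "t0 < t'" "t' < t" "t' \<le> T" using t by (auto simp: t'_def)
  obtain C r0 where C: "C > 0" "r0 > 0" and pert: "\<And>\<tau> y r. \<tau> \<in> {t'..T} \<Longrightarrow> 0 < r \<Longrightarrow> r \<le> r0 \<Longrightarrow> norm (y - x \<tau>) \<le> r \<Longrightarrow>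
    \<exists>z v. continuous_on {\<tau>..T} v \<and> z \<tau> = y \<and>
      (\<forall>s\<in>{\<tau>..T}. (z has_vector_derivative v s) (at s within {\<tau>..T}) \<and> v s \<in> F (z s) \<and>
         v s \<bullet> p s = H (z s) (p s) \<and> norm (z s - x s) \<le> C * r \<and> norm (z s) \<le> R + 1)"
    using perturbed_trajectory_maximal[OF R x t'(1,3) p N ext' G Gloc] by blast
  have tI: "t \<in> {t0..T}" using t by auto
  \<comment> \<open>Coefficients of the quadratic errors: semiconvexity along the two curves, change
    of the costate between \<open>\<tau>\<close> and \<open>t\<close>, increment of \<open>x\<close>
    between these times.\<close>
  define A where "A = c * B * (C * (1 + M))\<^sup>2 * (T - t0) + Q * (1 + M) + D"
  have A: "A \<ge> 0" unfolding A_def using c(1) B(1) t Q0 M0 D(1) by (intro add_nonneg_nonneg mult_nonneg_nonneg) auto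
  show ?thesis
  proof (rule frechet_superdiffI)
    fix \<epsilon> :: real assume "\<epsilon> > 0"
    \<comment> \<open>At time \<open>T\<close> the two curves differ by at most
      \<open>C * (1 + M) * \<nu>\<close>, so the transversality error becomes
      \<open>\<epsilon> / 2 * \<nu>\<close>.\<close>
    define \<epsilon>1 where "\<epsilon>1 = \<epsilon> / 2 / (C * (1 + M))"
    have CM: "C * (1 + M) > 0" using C(1) M0 by (auto intro!: mult_pos_pos)
    have \<epsilon>1: "\<epsilon>1 > 0" "\<epsilon>1 * (C * (1 + M)) = \<epsilon> / 2" using \<open>\<epsilon> > 0\<close> CM by (simp add: \<epsilon>1_def, metis \<epsilon>1_def CM less_irrefl nonzero_divide_eq_eq)
    obtain \<delta>1 where \<delta>1: "\<delta>1 > 0"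
      "\<And>y. dist y (x T) < \<delta>1 \<Longrightarrow> \<phi> y - \<phi> (x T) - (- p T) \<bullet> (y - x T) \<le> \<epsilon>1 * norm (y - x T)"
      using frechet_superdiffD[OF transv \<epsilon>1(1)] by blast
    \<comment> \<open>In order: the perturbation is small enough for the nearby trajectory to exist,
      its endpoint lies where transversality applies, \<open>\<tau>\<close> stays in
      \<open>{t'..T}\<close> (two entries), and the quadratic error is absorbed.\<close>
    define \<delta> where "\<delta> = Min {r0 / (1 + M), \<delta>1 / (C * (1 + M)), t - t', T - t, \<epsilon> / 2 / (A + 1)}"
    have \<delta>pos: "\<delta> > 0" using C M0 \<delta>1 CM t t' A \<open>\<epsilon> > 0\<close> by (auto simp: \<delta>_def)
    have \<delta>le: "\<delta> \<le> r0 / (1 + M)" "\<delta> \<le> \<delta>1 / (C * (1 + M))" "\<delta> \<le> t - t'" "\<delta> \<le> T - t" "\<delta> \<le> \<epsilon> / 2 / (A + 1)"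
      by (auto simp: \<delta>_def)
    have "mayer_value F \<phi> T (\<tau>, y) - mayer_value F \<phi> T (t, x t) - (H (x t) (p t), - p t) \<bullet> ((\<tau>, y) - (t, x t))
        \<le> \<epsilon> * norm ((\<tau>, y) - (t, x t))"
      if ne: "(\<tau>, y) \<noteq> (t, x t)" and d: "dist (\<tau>, y) (t, x t) < \<delta>" for \<tau> y
    proof -
      define \<nu> where "\<nu> = norm ((\<tau>, y) - (t, x t))"
      have \<nu>: "\<nu> > 0" "\<nu> < \<delta>" using ne d by (simp_all only: \<nu>_def dist_norm zero_less_norm_iff right_minus_eq not_False_eq_True)
      have \<nu>1: "\<bar>\<tau> - t\<bar> \<le> \<nu>" "norm (y - x t) \<le> \<nu>"
        using norm_fst_le[of "\<tau> - t" "y - x t"] norm_snd_le[of "y - x t" "\<tau> - t"] by (auto simp: \<nu>_def)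
      have \<tau>: "\<tau> \<in> {t'..T}" "\<tau> \<in> {t0..T}" using \<nu>1(1) \<nu>(2) \<delta>le(3,4) t' by auto
      \<comment> \<open>The perturbation is measured from \<open>x \<tau>\<close> and not from
        \<open>x t\<close>; the drift of \<open>x\<close> between the two times adds
        \<open>M * \<nu>\<close>.\<close>
      define r where "r = (1 + M) * \<nu>"
      have r: "0 < r" using M0 \<nu> by (simp add: r_def)
      have "norm (x \<tau> - x t) \<le> M * \<nu>"
        using lipschitz_onD[OF M \<tau>(2) tI] mult_left_mono[OF \<nu>1(1) M0] by (simp add: dist_norm)
      then have yr: "norm (y - x \<tau>) \<le> r"
        using norm_triangle_ineq4[of "y - x t" "x \<tau> - x t"] \<nu>1(2) by (simp add: r_def algebra_simps)
      have rr0: "r \<le> r0"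
      proof -
        have "\<nu> \<le> r0 / (1 + M)" using \<nu>(2) \<delta>le(1) by linarith
        then show ?thesis using M0 by (simp add: r_def pos_le_divide_eq mult.commute)
      qed
      have Cr: "C * r < \<delta>1"
      proof -
        have "\<nu> < \<delta>1 / (C * (1 + M))" using \<nu>(2) \<delta>le(2) by linarith
        then show ?thesis using CM by (simp add: r_def pos_less_divide_eq mult_ac)
      qed
      obtain z v where vc: "continuous_on {\<tau>..T} v" and z\<tau>: "z \<tau> = y"
        and z: "\<And>s. s \<in> {\<tau>..T} \<Longrightarrow> (z has_vector_derivative v s) (at s within {\<tau>..T})"
        and vF: "\<And>s. s \<in> {\<tau>..T} \<Longrightarrow> v s \<in> F (z s)"
        and vp: "\<And>s. s \<in> {\<tau>..T} \<Longrightarrow> v s \<bullet> p s = H (z s) (p s)"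
        and zx: "\<And>s. s \<in> {\<tau>..T} \<Longrightarrow> norm (z s - x s) \<le> C * r"
        and zR: "\<And>s. s \<in> {\<tau>..T} \<Longrightarrow> norm (z s) \<le> R + 1"
        using pert[OF \<tau>(1) r rr0 yr] by blast
      have TI: "T \<in> {\<tau>..T}" and \<tau>T: "\<tau> \<le> T" using \<tau> by auto
      have sub: "{\<tau>..T} \<subseteq> {t0..T}" using \<tau> by auto
      have zlip: "\<exists>C. C-lipschitz_on {\<tau>..T} z" by (rule C1_imp_lipschitz_on_Icc[OF vc z])
      have "trajectory F T \<tau> y z"
        by (rule trajectory_if_lipschitz_on[OF zlip z\<tau> negligible_empty]) (use z vF in blast)
      then have V1: "mayer_value F \<phi> T (\<tau>, y) \<le> \<phi> (z T)" by (rule mayer_value_le[OF _ \<tau>T \<phi>])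
      have V2: "\<phi> (x T) \<le> mayer_value F \<phi> T (t, x t)" by (rule mayer_optimal_value_ge[OF opt tI \<phi>])
      have "\<phi> (z T) - \<phi> (x T) - (- p T) \<bullet> (z T - x T) \<le> \<epsilon>1 * norm (z T - x T)"
        by (rule \<delta>1(2)) (use zx[OF TI] Cr in \<open>auto simp: dist_norm\<close>)
      also have "\<dots> \<le> \<epsilon>1 * (C * r)" using zx[OF TI] \<epsilon>1(1) by (intro mult_left_mono) auto
      also have "\<dots> = (\<epsilon>1 * (C * (1 + M))) * \<nu>" by (simp add: r_def)
      also have "\<dots> = \<epsilon> / 2 * \<nu>" by (simp only: \<epsilon>1(2))
      finally have \<phi>z: "\<phi> (z T) - \<phi> (x T) \<le> - (p T \<bullet> (z T - x T)) + \<epsilon> / 2 * \<nu>" by simp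
      have "p \<tau> \<bullet> (z \<tau> - x \<tau>) \<le> p T \<bullet> (z T - x T) + c * B * (C * r)\<^sup>2 * (T - \<tau>)"
      proof (rule adjoint_estimate[where R = "R + 1", OF _ zR _ zlip _ \<tau>T N _ c _ zx])
        show "norm (x s) \<le> R + 1" "norm (p s) \<le> B" if "s \<in> {\<tau>..T}" for s
          using R(2)[of s] B(2)[of s] that sub by auto
        show "\<exists>C. C-lipschitz_on {\<tau>..T} x" "\<exists>C. C-lipschitz_on {\<tau>..T} p"
          using lipschitz_on_subset[OF M sub] lipschitz_on_subset[OF Q sub] by blast+
        fix s assume s: "s \<in> {\<tau>..T} - N"
        then obtain q w where q: "(p has_vector_derivative q) (at s within {t0..T})" "(x has_vector_derivative w) (at s within {t0..T})"
          "- q \<in> frechet_subdiff (\<lambda>x. H x (p s)) (x s)" "w \<bullet> p s = H (x s) (p s)"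
          using ext'[of s] sub by blast
        have sI: "s \<in> {\<tau>..T}" using s by blast
        show "\<exists>q v w. (p has_vector_derivative q) (at s within {\<tau>..T}) \<and>
         (x has_vector_derivative v) (at s within {\<tau>..T}) \<and> (z has_vector_derivative w) (at s within {\<tau>..T}) \<and>
         - q \<in> frechet_subdiff (\<lambda>x. H x (p s)) (x s) \<and> v \<bullet> p s = H (x s) (p s) \<and> w \<bullet> p s = H (z s) (p s)"
          using has_vector_derivative_within_subset[OF q(1) sub] has_vector_derivative_within_subset[OF q(2) sub]
            q(3,4) z[OF sI] vp[OF sI] by blast
      qed
      also have "c * B * (C * r)\<^sup>2 * (T - \<tau>) \<le> c * B * (C * r)\<^sup>2 * (T - t0)"
        using c(1) B(1) \<tau> by (intro mult_left_mono) auto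
      finally have adj: "- (p T \<bullet> (z T - x T)) \<le> - (p \<tau> \<bullet> (y - x \<tau>)) + c * B * (C * r)\<^sup>2 * (T - t0)"
        using z\<tau> by simp
      have "\<bar>(p t - p \<tau>) \<bullet> (y - x \<tau>)\<bar> \<le> norm (p t - p \<tau>) * norm (y - x \<tau>)" by (rule Cauchy_Schwarz_ineq2)
      also have "\<dots> \<le> (Q * \<nu>) * r"
      proof (rule mult_mono)
        have "norm (p t - p \<tau>) \<le> Q * \<bar>\<tau> - t\<bar>" using lipschitz_onD[OF Q tI \<tau>(2)] by (simp add: dist_norm abs_minus_commute)
        then show "norm (p t - p \<tau>) \<le> Q * \<nu>" using mult_left_mono[OF \<nu>1(1) Q0] by linarith
      qed (use yr Q0 \<nu> in auto)
      finally have cs: "(p t - p \<tau>) \<bullet> (y - x \<tau>) \<le> Q * (1 + M) * \<nu>\<^sup>2"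
        by (simp add: r_def power2_eq_square mult_ac)
      have "D * (\<tau> - t)\<^sup>2 \<le> D * \<nu>\<^sup>2"
        using \<nu>1(1) \<nu>(1) by (intro mult_left_mono D(1) abs_le_square_iff[THEN iffD1]) auto
      then have xinc: "p t \<bullet> (x \<tau> - x t) \<le> H (x t) (p t) * (\<tau> - t) + D * \<nu>\<^sup>2"
        using D(2)[OF tI \<tau>(2)] by linarith
      \<comment> \<open>The base time of the pairing moves from \<open>\<tau>\<close> to
        \<open>t\<close>: the first term is the space part of the supergradient, the second yields
        its time part \<open>H (x t) (p t) * (\<tau> - t)\<close>, and the third is a product of two
        factors of order \<open>\<nu>\<close>.\<close>
      have "- (p \<tau> \<bullet> (y - x \<tau>)) = - (p t \<bullet> (y - x t)) + p t \<bullet> (x \<tau> - x t) + (p t - p \<tau>) \<bullet> (y - x \<tau>)"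
        by (simp add: inner_diff_left inner_diff_right)
      moreover have "(H (x t) (p t), - p t) \<bullet> ((\<tau>, y) - (t, x t)) = H (x t) (p t) * (\<tau> - t) - p t \<bullet> (y - x t)"
        by simp
      moreover have "c * B * (C * r)\<^sup>2 * (T - t0) + Q * (1 + M) * \<nu>\<^sup>2 + D * \<nu>\<^sup>2 = A * \<nu>\<^sup>2"
      proof -
        have "(C * r)\<^sup>2 = (C * (1 + M))\<^sup>2 * \<nu>\<^sup>2" by (simp only: r_def power_mult_distrib mult.assoc)
        then show ?thesis by (simp only: A_def distrib_right mult.assoc mult.commute[of "\<nu>\<^sup>2"])
      qed
      moreover have "A * \<nu>\<^sup>2 \<le> \<epsilon> / 2 * \<nu>"
      proof -
        have "(A + 1) * \<nu> \<le> \<epsilon> / 2"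
        proof -
          have "\<nu> \<le> \<epsilon> / 2 / (A + 1)" using \<nu>(2) \<delta>le(5) by linarith
          then show ?thesis using A by (simp add: pos_le_divide_eq algebra_simps)
        qed
        then have "((A + 1) * \<nu>) * \<nu> \<le> \<epsilon> / 2 * \<nu>" using \<nu>(1) by (intro mult_right_mono) auto
        moreover have "A * \<nu>\<^sup>2 \<le> ((A + 1) * \<nu>) * \<nu>" by (simp add: power2_eq_square algebra_simps)
        ultimately show ?thesis by linarith
      qed
      moreover have "\<epsilon> / 2 * \<nu> + \<epsilon> / 2 * \<nu> = \<epsilon> * \<nu>" by simp
      ultimately show ?thesis
        unfolding \<nu>_def[symmetric] using V1 V2 \<phi>z adj cs xinc by linarith
    qed
    then show "\<exists>\<delta>>0. \<forall>z. z \<noteq> (t, x t) \<longrightarrow> dist z (t, x t) < \<delta> \<longrightarrow>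
        mayer_value F \<phi> T z - mayer_value F \<phi> T (t, x t) - (H (x t) (p t), - p t) \<bullet> (z - (t, x t)) \<le> \<epsilon> * norm (z - (t, x t))"
      using \<delta>pos by (intro exI[of _ \<delta>]) auto
  qed
qed

end

theorem theorem3p4:
  fixes F :: "real ^ 'n \<Rightarrow> (real ^ 'n) set"
    and \<phi> :: "real ^ 'n \<Rightarrow> real"
    and T t0 \<rho> :: real
    and x0 :: "real ^ 'n"
    and xbar pbar :: "real \<Rightarrow> real ^ 'n"
  assumes "T > 0"
    and "\<And>x. F x \<noteq> {} \<and> convex (F x) \<and> compact (F x)"
    and "locally_lipschitz_multi F"
    and "\<rho> > 0" and "\<And>x v. v \<in> F x \<Longrightarrow> norm v \<le> \<rho> * (1 + norm x)"
    and "\<And>K. K \<noteq> {} \<Longrightarrow> convex K \<Longrightarrow> compact K \<Longrightarrow>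
           \<exists>c\<ge>0. \<forall>p. semiconvex_on K (c * norm p) (\<lambda>x. hamiltonian F x p)"
    and "\<And>K. K \<noteq> {} \<Longrightarrow> convex K \<Longrightarrow> compact K \<Longrightarrow>
           \<exists>G. (\<forall>x\<in>K. \<forall>p. p \<noteq> 0 \<longrightarrow> GDERIV (hamiltonian F x) p :> G x p) \<and>
               (\<forall>P. compact P \<longrightarrow> P \<subseteq> - {0} \<longrightarrow>
                  (\<forall>x\<in>K. \<exists>r>0. \<exists>L. \<forall>p\<in>P. L-lipschitz_on (ball x r \<inter> K) (\<lambda>y. G y p)))"
    and "locally_lipschitz \<phi>"
    and "t0 \<in> {0..T}"
    and "mayer_optimal F \<phi> T t0 x0 xbar"
    and "abs_cont_on t0 T pbar"
    and "AE t in lebesgue_on {t0..T}.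
           \<exists>q v. (pbar has_vector_derivative q) (at t within {t0..T}) \<and>
                 (xbar has_vector_derivative v) (at t within {t0..T}) \<and>
                 - q \<in> frechet_subdiff (\<lambda>x. hamiltonian F x (pbar t)) (xbar t) \<and>
                 v \<in> clarke_gradient (hamiltonian F (xbar t)) (pbar t)"
    and "- pbar T \<in> frechet_superdiff \<phi> (xbar T)"
  shows "\<forall>t\<in>{t0<..<T}.
           (hamiltonian F (xbar t) (pbar t), - pbar t)
             \<in> frechet_superdiff (mayer_value F \<phi> T) (t, xbar t)"
proof -
  interpret lipschitz_inclusion F \<rho>
    by unfold_locales (use assms(2-5) in auto)
  obtain N where N: "negligible N" and ext: "\<And>s. s \<in> {t0..T} - N \<Longrightarrow>
      \<exists>q v. (pbar has_vector_derivative q) (at s within {t0..T}) \<and>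
        (xbar has_vector_derivative v) (at s within {t0..T}) \<and>
        - q \<in> frechet_subdiff (\<lambda>x. hamiltonian F x (pbar s)) (xbar s) \<and>
        v \<in> clarke_gradient (hamiltonian F (xbar s)) (pbar s)"
    using assms(12) unfolding AE_lebesgue_on_Icc_iff by blast
  have "isCont \<phi> x" for x
  proof -
    obtain r L where "r > 0" "L-lipschitz_on (ball x r) \<phi>" using assms(8) unfolding locally_lipschitz_def by blast
    then show ?thesis
      using continuous_on_interior[OF lipschitz_on_continuous_on, of L "ball x r" \<phi> x] by simp
  qed
  then have \<phi>: "continuous_on UNIV \<phi>" by (simp add: continuous_on_eq_continuous_at)
  show ?thesis
    by (intro ballI full_sensitivity_relation[OF assms(10) _ _ \<phi> assms(11) N ext assms(13,6,7)]) auto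
qed

end
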